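(* Let $\psi,f\in L^2_\mu(\mathbb{R})$ be such that $\|\psi\|_{\mu,2}=\|f\|_{\mu,2}=1$, and let $\Omega\subset\mathbb{R}_+\times\mathbb{R}$ be a measurable subset satisfying $$|\Omega|:=\iint_\Omega|x|^{2\mu+1}\,dx\,\frac{dt}{t}<+\infty$$ and $$\forall\varepsilon>0,\quad\iint_\Omega\big|\Phi^{D,M}_\psi f(t,x)\big|^2\,|x|^{2\mu+1}\,dx\,\frac{dt}{t}\ge1-\varepsilon.$$ Then $$\forall\varepsilon>0,\quad|\Omega|\ge1-\varepsilon.$$
   Context: Fix a real $\mu>-\tfrac12$ and $M=\begin{pmatrix}a&b\\c&d\end{pmatrix}\in SL(2,\mathbb{R})$ with $b\neq0$. $L^p_\mu(\mathbb{R})$ is the Lebesgue space on $\mathbb{R}$ for the measure $|y|^{2\mu+1}dy$, with norm $\|\cdot\|_{\mu,p}$. Points of $\mathbb{R}_+\times\mathbb{R}$ are written $(t,x)$ with $t>0$. Dunkl translation: for $x,y\neq0$, $\mathcal{T}^\mu_x f(y)=\int_{\mathbb{R}}f(z)\mathcal{W}_\mu(x,y,z)|z|^{2\mu+1}dz$, with $\mathcal{T}^\mu_0f(y)=f(y)$ and $\mathcal{T}^\mu_xf(0)=f(x)$. Here $$\mathcal{W}_\mu(x,y,z)=\tfrac12\big(1-\sigma_{x,y,z}+\sigma_{z,x,y}+\sigma_{z,y,x}\big)\,k_\mu(|x|,|y|,|z|),\qquad \sigma_{u,v,w}=\frac{u^2+v^2-w^2}{2uv},$$ $$k_\mu(r,s,w)=\frac{2^{1-2\mu}\Gamma(\mu+1)}{\sqrt\pi\,\Gamma(\mu+\frac12)}\frac{[((r+s)^2-w^2)(w^2-(r-s)^2)]^{\mu-\frac12}}{(rsw)^{2\mu}}\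 \text{ if } |r-s|<w<r+s,\ \text{ and } 0\text{ otherwise.}$$ Dilation: $\delta_t\psi(x)=t^{-(\mu+1)}\psi(x/t)$ for $t>0$. Wavelet family: for $t>0$, $x\in\mathbb{R}$, $\psi_{t,x}^M(y)=e^{-\frac{ia}{2b}(y^2-x^2)}\mathcal{T}^\mu_x(\delta_t\psi)(y)$. Continuous linear canonical Dunkl wavelet transform: $\Phi^{D,M}_\psi f(t,x)=\int_{\mathbb{R}}f(z)\overline{\psi^M_{t,x}(z)}|z|^{2\mu+1}dz$. *)

theory Defs
  imports "HOL-Analysis.Analysis"
begin

definition dunkl_measure :: "real \<Rightarrow> real measure" where
  "dunkl_measure \<mu> = density lebesgue (\<lambda>y. ennreal (\<bar>y\<bar> powr (2 * \<mu> + 1)))"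

(* Functions rather than classes modulo null sets; p is meant to satisfy 1 <= p < infinity. *)
definition dunkl_Lp :: "real \<Rightarrow> real \<Rightarrow> (real \<Rightarrow> complex) set" where
  "dunkl_Lp \<mu> p = {f \<in> borel_measurable (dunkl_measure \<mu>).
     integrable (dunkl_measure \<mu>) (\<lambda>y. norm (f y) powr p)}"

definition dunkl_norm :: "real \<Rightarrow> real \<Rightarrow> (real \<Rightarrow> complex) \<Rightarrow> real" where
  "dunkl_norm \<mu> p f = (LINT y|dunkl_measure \<mu>. norm (f y) powr p) powr (1 / p)"

definition dunkl_sigma :: "real \<Rightarrow> real \<Rightarrow> real \<Rightarrow> real" where
  "dunkl_sigma u v w = (u\<^sup>2 + v\<^sup>2 - w\<^sup>2) / (2 * u * v)"

definition dunkl_k :: "real \<Rightarrow> real \<Rightarrow> real \<Rightarrow> real \<Rightarrow> real" where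
  "dunkl_k \<mu> r s w =
    (if \<bar>r - s\<bar> < w \<and> w < r + s
     then 2 powr (1 - 2 * \<mu>) * Gamma (\<mu> + 1) / (sqrt pi * Gamma (\<mu> + 1/2))
          * ((((r + s)\<^sup>2 - w\<^sup>2) * (w\<^sup>2 - (r - s)\<^sup>2)) powr (\<mu> - 1/2)
             / (r * s * w) powr (2 * \<mu>))
     else 0)"

definition dunkl_W :: "real \<Rightarrow> real \<Rightarrow> real \<Rightarrow> real \<Rightarrow> real" where
  "dunkl_W \<mu> x y z =
    1/2 * (1 - dunkl_sigma x y z + dunkl_sigma z x y + dunkl_sigma z y x)
    * dunkl_k \<mu> \<bar>x\<bar> \<bar>y\<bar> \<bar>z\<bar>"

(* For f in L^2 and fixed x the integral converges absolutely for almost every y;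
   at the remaining y the Bochner integral is 0 by convention. *)
definition dunkl_translation :: "real \<Rightarrow> real \<Rightarrow> (real \<Rightarrow> complex) \<Rightarrow> real \<Rightarrow> complex" where
  "dunkl_translation \<mu> x f y =
    (if x = 0 then f y
     else if y = 0 then f x
     else (LINT z|dunkl_measure \<mu>. f z * of_real (dunkl_W \<mu> x y z)))"

definition dunkl_dilation :: "real \<Rightarrow> real \<Rightarrow> (real \<Rightarrow> complex) \<Rightarrow> real \<Rightarrow> complex" where
  "dunkl_dilation \<mu> t \<psi> x = of_real (t powr (- (\<mu> + 1))) * \<psi> (x / t)"

definition lc_dunkl_wavelet ::
  "real \<Rightarrow> real^2^2 \<Rightarrow> (real \<Rightarrow> complex) \<Rightarrow> real \<Rightarrow> real \<Rightarrow> real \<Rightarrow> complex" where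
  "lc_dunkl_wavelet \<mu> M \<psi> t x y =
    exp (- (\<i> * of_real (M$1$1 / (2 * M$1$2) * (y\<^sup>2 - x\<^sup>2))))
    * dunkl_translation \<mu> x (dunkl_dilation \<mu> t \<psi>) y"

definition lc_dunkl_wavelet_transform ::
  "real \<Rightarrow> real^2^2 \<Rightarrow> (real \<Rightarrow> complex) \<Rightarrow> (real \<Rightarrow> complex) \<Rightarrow> real \<Rightarrow> real \<Rightarrow> complex" where
  "lc_dunkl_wavelet_transform \<mu> M \<psi> f t x =
    (LINT z|dunkl_measure \<mu>. f z * cnj (lc_dunkl_wavelet \<mu> M \<psi> t x z))"

(* The measure |x|^(2 mu + 1) dx dt/t; its space is the open half-plane of pairs (t, x), t > 0. *)
definition half_plane_measure :: "real \<Rightarrow> (real \<times> real) measure" where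
  "half_plane_measure \<mu> =
    density (lebesgue_on ({0<..} \<times> UNIV)) (\<lambda>(t, x). ennreal (\<bar>x\<bar> powr (2 * \<mu> + 1) / t))"

end

theory Submission
  imports Defs "HOL-Probability.Probability_Measure"
begin

text \<open>
  The wavelet transform is bounded by 1 at every point, so its squared modulus integrates over \<open>\<Omega>\<close> to at
  most the measure of \<open>\<Omega>\<close>; this gives the claim.  The bound follows from the Cauchy--Schwarz
  inequality once the Dunkl translation $T_x$ is known to be a contraction of the weighted $L^2$ space
  (\<open>dunkl_translation_contraction\<close>), as the dilation is an isometry and the chirp has modulus 1.

  The difficulty is that the kernel of $T_x$ changes sign, so integrating its absolute value only gives some constant
  larger than 1.  The contraction property is obtained here directly from the kernel, without the Dunkl transform.

  The law of cosines \<open>w\<^sup>2 = x\<^sup>2 + y\<^sup>2 + 2 * x * y * c\<close> turns the kernel integral into an expectation over a random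
  cosine \<open>c\<close> with density proportional to \<open>(1 - c\<^sup>2) powr (\<mu> - 1/2)\<close> (\<open>integral_dunkl_W\<close>).  In this form a Bessel
  inequality under the expectation, applied to the cosines of the angles of the triangle with sides \<open>x\<close>, \<open>y\<close>, \<open>w\<close>,
  bounds the four values of $T_{\pm x} g$ at $\pm y$ together (\<open>angular_translation_four_reflections\<close>).  Integrated over \<open>y\<close>, this is
  $\|T_x g\|^2 + \|T_{-x} g\|^2 \le 2 \|g\|^2$.

  It remains to see that the two norms on the left agree.  Symmetry of the kernel makes $T_{-x}$ the adjoint of $T_x$
  (\<open>angular_translation_adjoint\<close>), so this is normality of $T_x$, that is, commutation of $T_x$ with $T_{-x}$
  (\<open>angular_translation_commute\<close>).  On polynomials it follows from a binomial formula for translated monomials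
  (\<open>angular_translation_dunkl_power\<close>), which holds because translations commute with the Dunkl
  operator; uniform approximation extends it to continuous functions.  The contraction property for continuous
  compactly supported functions then passes to all square-integrable functions by Fatou's lemma.
\<close>

section \<open>The angular distribution\<close>

text \<open>
  For $\<mu> = n/2 - 1$ this is the density of the first coordinate of a uniformly distributed point
  of the unit sphere in $n$ dimensions.  In the translation it is, up to a sign, the law of the cosine \<open>c\<close> of the
  angle between sides of lengths \<open>\<bar>x\<bar>\<close> and \<open>\<bar>y\<bar>\<close>.
\<close>

definition angle_density :: "real \<Rightarrow> real \<Rightarrow> real" where
  "angle_density \<mu> c =
    (if -1 < c \<and> c < 1
     then Gamma (\<mu> + 1) / (sqrt pi * Gamma (\<mu> + 1/2)) * (1 - c\<^sup>2) powr (\<mu> - 1/2) else 0)"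

definition angle_measure :: "real \<Rightarrow> real measure" where
  "angle_measure \<mu> = density lborel (\<lambda>c. ennreal (angle_density \<mu> c))"

lemma sets_angle_measure [measurable_cong, simp]: "sets (angle_measure \<mu>) = sets borel"
  by (simp add: angle_measure_def)

lemma space_angle_measure [simp]: "space (angle_measure \<mu>) = UNIV"
  by (simp add: angle_measure_def)

lemma angle_density_measurable [measurable]: "angle_density \<mu> \<in> borel_measurable borel"
  unfolding angle_density_def by measurable

lemma angle_density_nonneg: "\<mu> > -1/2 \<Longrightarrow> angle_density \<mu> c \<ge> 0"
  by (auto simp: angle_density_def intro!: mult_nonneg_nonneg divide_nonneg_nonneg)

lemma Gamma_legendre_duplication_real:
  fixes z :: real
  assumes "z > 0"
  shows "Gamma z * Gamma (z + 1/2) = 2 powr (1 - 2 * z) * sqrt pi * Gamma (2 * z)"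
proof -
  have ni: "complex_of_real a \<notin> \<int>\<^sub>\<le>\<^sub>0" if "a > 0" for a :: real
  proof
    assume "complex_of_real a \<in> \<int>\<^sub>\<le>\<^sub>0"
    then obtain n where "complex_of_real a = of_int n" "n \<le> 0" by (rule nonpos_Ints_cases)
    then have "a = of_int n" by (metis of_real_eq_iff of_real_of_int_eq)
    with \<open>n \<le> 0\<close> that show False by simp
  qed
  have "complex_of_real (Gamma z * Gamma (z + 1/2)) = Gamma (of_real z) * Gamma (of_real z + 1/2)"
    using Gamma_complex_of_real[of z] Gamma_complex_of_real[of "z + 1/2"] by simp
  also have "\<dots> = exp ((1 - 2 * of_real z) * of_real (ln 2)) * of_real (sqrt pi) * Gamma (2 * of_real z)"
    using ni[of z] ni[of "z + 1/2"] assms by (intro Gamma_legendre_duplication) auto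
  also have "\<dots> = complex_of_real (2 powr (1 - 2 * z) * sqrt pi * Gamma (2 * z))"
    using Gamma_complex_of_real[of "2 * z"] by (simp add: powr_def flip: exp_of_real)
  finally show ?thesis by (simp only: of_real_eq_iff)
qed

text \<open>
  The mass is a Beta integral after the substitution \<open>c = 2 * t - 1\<close>; Legendre's duplication formula
  shows that it is cancelled by the constant of the kernel.
\<close>

lemma angle_measure_prob_space:
  assumes mu: "\<mu> > -1/2"
  shows "prob_space (angle_measure \<mu>)"
proof
  define C where "C = Gamma (\<mu> + 1) / (sqrt pi * Gamma (\<mu> + 1/2))"
  have C: "C > 0" using mu by (auto simp: C_def)
  let ?b = "\<lambda>t. t powr (\<mu> - 1/2) * (1 - t) powr (\<mu> - 1/2) * indicator {0..1} t :: real"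
  have "((\<lambda>t. t powr (\<mu> + 1/2 - 1) * (1 - t) powr (\<mu> + 1/2 - 1)) has_integral Beta (\<mu> + 1/2) (\<mu> + 1/2)) {0..1}"
    using mu by (intro has_integral_Beta_real) auto
  then have "((\<lambda>t. if t \<in> {0..1} then t powr (\<mu> - 1/2) * (1 - t) powr (\<mu> - 1/2) else 0)
       has_integral Beta (\<mu> + 1/2) (\<mu> + 1/2)) UNIV"
    by (subst has_integral_restrict_UNIV) simp
  moreover have "(\<lambda>t. if t \<in> {0..1} then t powr (\<mu> - 1/2) * (1 - t) powr (\<mu> - 1/2) else 0) = ?b"
    by (auto simp: fun_eq_iff)
  ultimately have hi: "(?b has_integral Beta (\<mu> + 1/2) (\<mu> + 1/2)) UNIV"
    by simp
  have "(\<integral>\<^sup>+t. ennreal (?b t) \<partial>lborel) = ennreal (Beta (\<mu> + 1/2) (\<mu> + 1/2))"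
    using hi by (intro nn_integral_has_integral_lborel) auto
  have "emeasure (angle_measure \<mu>) UNIV = (\<integral>\<^sup>+c. ennreal (angle_density \<mu> c) \<partial>lborel)"
    unfolding angle_measure_def by (subst emeasure_density) auto
  also have "\<dots> = ennreal \<bar>2\<bar> * (\<integral>\<^sup>+t. ennreal (angle_density \<mu> (-1 + 2 * t)) \<partial>lborel)"
    by (rule nn_integral_real_affine) auto
  also have "(\<integral>\<^sup>+t. ennreal (angle_density \<mu> (-1 + 2 * t)) \<partial>lborel)
      = (\<integral>\<^sup>+t. ennreal (C * 4 powr (\<mu> - 1/2)) * ennreal (?b t) \<partial>lborel)"
  proof (intro nn_integral_cong)
    fix t :: real
    have "1 - (-1 + 2 * t)\<^sup>2 = 4 * (t * (1 - t))" by (simp add: power2_eq_square algebra_simps)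
    then have "angle_density \<mu> (-1 + 2 * t) = C * 4 powr (\<mu> - 1/2) * ?b t"
      by (auto simp: angle_density_def C_def powr_mult indicator_def)
    then show "ennreal (angle_density \<mu> (-1 + 2 * t)) = ennreal (C * 4 powr (\<mu> - 1/2)) * ennreal (?b t)"
      using C by (simp add: ennreal_mult')
  qed
  also have "\<dots> = ennreal (C * 4 powr (\<mu> - 1/2)) * ennreal (Beta (\<mu> + 1/2) (\<mu> + 1/2))"
    using \<open>(\<integral>\<^sup>+t. ennreal (?b t) \<partial>lborel) = _\<close> by (subst nn_integral_cmult) auto
  also have "ennreal \<bar>2\<bar> * \<dots> = ennreal (2 * (C * 4 powr (\<mu> - 1/2) * Beta (\<mu> + 1/2) (\<mu> + 1/2)))"
    using C by (simp add: ennreal_mult')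
  also have "2 * (C * 4 powr (\<mu> - 1/2) * Beta (\<mu> + 1/2) (\<mu> + 1/2)) = 1"
  proof -
    have 4: "(4::real) powr (\<mu> - 1/2) = 2 powr (2 * \<mu>) / 2"
      using powr_powr[of "2::real" 2 "\<mu> - 1/2"] powr_diff[of "2::real" "2 * \<mu>" 1] by (simp add: algebra_simps)
    have pos: "Gamma (\<mu> + 1/2) > 0" "Gamma (2 * \<mu> + 1) > 0" "Gamma (\<mu> + 1) > 0" using mu by auto
    have "\<mu> + 1/2 + (\<mu> + 1/2) = 2 * \<mu> + 1" by simp
    then have beta: "Beta (\<mu> + 1/2) (\<mu> + 1/2) = Gamma (\<mu> + 1/2) * Gamma (\<mu> + 1/2) / Gamma (2 * \<mu> + 1)"
      by (simp only: Beta_def)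
    have dup: "Gamma (\<mu> + 1/2) * Gamma (\<mu> + 1) = 2 powr (- 2 * \<mu>) * sqrt pi * Gamma (2 * \<mu> + 1)"
      using Gamma_legendre_duplication_real[of "\<mu> + 1/2"] mu by (simp add: algebra_simps)
    have "2 * (C * 4 powr (\<mu> - 1/2) * Beta (\<mu> + 1/2) (\<mu> + 1/2))
        = 2 powr (2 * \<mu>) * (Gamma (\<mu> + 1/2) * Gamma (\<mu> + 1)) / (sqrt pi * Gamma (2 * \<mu> + 1))"
      using pos unfolding 4 C_def beta by (simp add: field_simps)
    also have "\<dots> = 1"
      unfolding dup using pos powr_minus[of "2::real" "2 * \<mu>"] by (simp add: field_simps)
    finally show ?thesis .
  qed
  finally show "emeasure (angle_measure \<mu>) (space (angle_measure \<mu>)) = 1" by simp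
qed

lemma AE_angle_measure: "AE c in angle_measure \<mu>. c \<in> {-1<..<1}"
  unfolding angle_measure_def by (subst AE_density) (auto simp: angle_density_def)

lemma integrable_angle_measure:
  fixes f :: "real \<Rightarrow> real"
  assumes "\<mu> > -1/2" and [measurable]: "f \<in> borel_measurable borel"
    and B: "\<And>c. c \<in> {-1<..<1} \<Longrightarrow> \<bar>f c\<bar> \<le> B"
  shows "integrable (angle_measure \<mu>) f"
proof -
  interpret prob_space "angle_measure \<mu>" by (rule angle_measure_prob_space) fact
  have "AE c in angle_measure \<mu>. norm (f c) \<le> B"
    using AE_angle_measure by (rule eventually_mono) (use B in simp)
  then show ?thesis
    by (rule integrable_const_bound) simp
qed

lemma integrable_angle_measure_continuous:
  fixes g :: "real \<Rightarrow> real"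
  assumes mu: "\<mu> > -1/2" and g: "continuous_on UNIV g"
  shows "integrable (angle_measure \<mu>) g"
proof -
  have "compact (g ` {-1..1})"
    by (rule compact_continuous_image[OF continuous_on_subset[OF g]]) simp_all
  then have "bounded (g ` {-1..1})" by (rule compact_imp_bounded)
  then obtain B where B: "\<forall>y \<in> g ` {-1..1}. norm y \<le> B" unfolding bounded_iff ..
  show ?thesis
  proof (rule integrable_angle_measure[OF mu])
    show "g \<in> borel_measurable borel" using g by (rule borel_measurable_continuous_onI)
    show "\<bar>g c\<bar> \<le> B" if "c \<in> {-1<..<1}" for c
      using B that by auto
  qed
qed

lemma angle_measure_uminus:
  "distr (angle_measure \<mu>) borel uminus = angle_measure \<mu>"
proof -
  have even_dens: "angle_density \<mu> (- c) = angle_density \<mu> c" for c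
    by (auto simp: angle_density_def)
  have "distr (angle_measure \<mu>) borel uminus
      = density (distr lborel borel uminus) (\<lambda>c. ennreal (angle_density \<mu> c))"
    unfolding angle_measure_def
    by (subst density_distr) (simp_all add: even_dens)
  then show ?thesis
    by (simp add: lborel_distr_uminus angle_measure_def)
qed

lemma integral_angle_measure_uminus:
  fixes f :: "real \<Rightarrow> real"
  assumes "f \<in> borel_measurable borel"
  shows "(\<integral>c. f (- c) \<partial>angle_measure \<mu>) = (\<integral>c. f c \<partial>angle_measure \<mu>)"
  by (subst (2) angle_measure_uminus[symmetric], subst integral_distr) (use assms in auto)

lemma nn_integral_angle_measure_uminus:
  assumes "f \<in> borel_measurable borel"
  shows "(\<integral>\<^sup>+c. f (- c) \<partial>angle_measure \<mu>) = (\<integral>\<^sup>+c. f c \<partial>angle_measure \<mu>)"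
  by (subst (2) angle_measure_uminus[symmetric], subst nn_integral_distr) (use assms in auto)

text \<open>
  The function \<open>(1 - c\<^sup>2) powr (\<mu> + 1/2)\<close> vanishes at both ends of the interval because
  \<open>\<mu> > -1/2\<close>, and its derivative is \<open>- (2 * \<mu> + 1) * c\<close> times the angular density up to the constant.
  This is where the coefficient \<open>2 * \<mu> + 1\<close> of the Dunkl operator comes from.
\<close>

lemma angle_measure_by_parts:
  assumes mu: "\<mu> > -1/2"
    and der: "\<And>c. (p has_real_derivative p' c) (at c)" and cont: "continuous_on UNIV p'"
  shows "(2 * \<mu> + 1) * (\<integral>c. c * p c \<partial>angle_measure \<mu>) = (\<integral>c. (1 - c\<^sup>2) * p' c \<partial>angle_measure \<mu>)"
proof -
  define C where "C = Gamma (\<mu> + 1) / (sqrt pi * Gamma (\<mu> + 1/2))"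
  have contp: "continuous_on UNIV p"
    by (rule DERIV_continuous_on) (rule der)
  have [measurable]: "p \<in> borel_measurable borel" "p' \<in> borel_measurable borel"
    using contp cont by (auto intro: borel_measurable_continuous_onI)
  have int: "integrable (angle_measure \<mu>) g" if "continuous_on UNIV g" for g :: "real \<Rightarrow> real"
    using that by (rule integrable_angle_measure_continuous[OF mu])
  let ?h = "\<lambda>c. (1 - c\<^sup>2) * p' c - (2 * \<mu> + 1) * (c * p c)"
  let ?F = "\<lambda>c. C * (1 - c\<^sup>2) powr (\<mu> + 1/2) * p c"
  have conth: "continuous_on UNIV ?h"
    by (intro continuous_intros cont contp)
  have "integrable lborel (\<lambda>c. angle_density \<mu> c *\<^sub>R ?h c)"
    using int[OF conth] unfolding angle_measure_def
    by (subst (asm) integrable_density) (auto simp: angle_density_nonneg[OF mu])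
  then have "((\<lambda>c. angle_density \<mu> c *\<^sub>R ?h c) has_integral (\<integral>c. angle_density \<mu> c *\<^sub>R ?h c \<partial>lborel)) UNIV"
    by (rule has_integral_integral_lborel)
  then have "((\<lambda>c. if c \<in> {-1..1} then angle_density \<mu> c *\<^sub>R ?h c else 0) has_integral (\<integral>c. angle_density \<mu> c *\<^sub>R ?h c \<partial>lborel)) UNIV"
    by (rule has_integral_eq[rotated]) (auto simp: angle_density_def)
  then have 1: "((\<lambda>c. angle_density \<mu> c *\<^sub>R ?h c) has_integral (\<integral>c. angle_density \<mu> c *\<^sub>R ?h c \<partial>lborel)) {-1..1}"
    by (subst (asm) has_integral_restrict_UNIV)
  have 2: "((\<lambda>c. angle_density \<mu> c *\<^sub>R ?h c) has_integral (?F 1 - ?F (-1))) {-1..1}"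
  proof (rule fundamental_theorem_of_calculus_interior)
    show "continuous_on {-1..1} ?F"
      using mu by (intro continuous_intros continuous_on_powr' continuous_on_subset[OF contp] ballI)
        (auto simp: abs_square_le_1 abs_le_iff)
    fix c :: real assume c: "c \<in> {-1<..<1}"
    then have pos: "1 - c\<^sup>2 > 0" by (simp add: abs_square_less_1 abs_less_iff)
    have "(?F has_real_derivative C * (1 - c\<^sup>2) powr (\<mu> - 1/2) * ?h c) (at c)"
    proof -
      have d: "(?F has_real_derivative
          C * ((\<mu> + 1/2) * (1 - c\<^sup>2) powr (\<mu> + 1/2 - 1) * (- (2 * c))) * p c
          + p' c * (C * (1 - c\<^sup>2) powr (\<mu> + 1/2))) (at c)"
        using pos by (auto intro!: derivative_eq_intros der simp: powr_diff field_simps)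
      have e: "(1 - c\<^sup>2) powr (\<mu> + 1/2) = (1 - c\<^sup>2) powr (\<mu> - 1/2) * (1 - c\<^sup>2)"
        using powr_add[of "1 - c\<^sup>2" "\<mu> - 1/2" 1] pos by (simp add: algebra_simps)
      show ?thesis
        by (rule DERIV_cong[OF d]) (simp add: e algebra_simps)
    qed
    then show "(?F has_vector_derivative angle_density \<mu> c *\<^sub>R ?h c) (at c)"
      using c by (simp add: has_real_derivative_iff_has_vector_derivative angle_density_def C_def)
  qed auto
  have "(\<integral>c. ?h c \<partial>angle_measure \<mu>) = (\<integral>c. angle_density \<mu> c *\<^sub>R ?h c \<partial>lborel)"
    unfolding angle_measure_def by (subst integral_density) (auto simp: angle_density_nonneg[OF mu])
  also have "\<dots> = 0"
    using has_integral_unique[OF 1 2] mu by simp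
  finally have "(\<integral>c. ?h c \<partial>angle_measure \<mu>) = 0" .
  moreover have "(\<integral>c. ?h c \<partial>angle_measure \<mu>)
      = (\<integral>c. (1 - c\<^sup>2) * p' c \<partial>angle_measure \<mu>) - (2 * \<mu> + 1) * (\<integral>c. c * p c \<partial>angle_measure \<mu>)"
    by (subst Bochner_Integration.integral_diff)
       (intro int continuous_intros cont contp | simp)+
  ultimately show ?thesis by simp
qed

section \<open>From the kernel to the angle\<close>

text \<open>
  The law of cosines, with a plus sign and with signed \<open>x\<close> and \<open>y\<close>.  As the angular distribution is
  even in \<open>c\<close>, one formula then serves all four sign patterns.
\<close>

definition third_side :: "real \<Rightarrow> real \<Rightarrow> real \<Rightarrow> real" where
  "third_side x y c = sqrt (x\<^sup>2 + y\<^sup>2 + 2 * x * y * c)"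

text \<open>
  The restriction of \<open>dunkl_measure\<close> to Borel sets, whose completion is \<open>dunkl_measure\<close> again.  Joint
  measurability of the kernel is a statement about Borel sets, so Fubini's theorem is applied to this measure.
\<close>

definition dunkl_borel :: "real \<Rightarrow> real measure" where
  "dunkl_borel \<mu> = density lborel (\<lambda>y. ennreal (\<bar>y\<bar> powr (2 * \<mu> + 1)))"

lemma sets_dunkl_borel [measurable_cong, simp]: "sets (dunkl_borel \<mu>) = sets borel"
  by (simp add: dunkl_borel_def)

lemma space_dunkl_borel [simp]: "space (dunkl_borel \<mu>) = UNIV"
  by (simp add: dunkl_borel_def)

lemma third_side_measurable [measurable (raw)]:
  assumes [measurable]: "f \<in> borel_measurable M" "g \<in> borel_measurable M" "h \<in> borel_measurable M"
  shows "(\<lambda>\<omega>. third_side (f \<omega>) (g \<omega>) (h \<omega>)) \<in> borel_measurable M"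
  unfolding third_side_def by measurable

text \<open>
  In a triangle with sides \<open>x\<close>, \<open>y\<close>, the third side splits into the projection \<open>y + x * c\<close> and the
  height, whose square is \<open>x\<^sup>2 * (1 - c\<^sup>2)\<close>.  All bounds on the kernel come from these two identities.
\<close>

lemma third_side_radicand:
  fixes x y c :: real
  shows "x\<^sup>2 + y\<^sup>2 + 2 * x * y * c = (y + x * c)\<^sup>2 + x\<^sup>2 * (1 - c\<^sup>2)"
    and "x\<^sup>2 + y\<^sup>2 + 2 * x * y * c = (x + y * c)\<^sup>2 + y\<^sup>2 * (1 - c\<^sup>2)"
  by (simp_all add: power2_eq_square algebra_simps)

lemma third_side_nonneg: "\<bar>c\<bar> \<le> 1 \<Longrightarrow> third_side x y c \<ge> 0"
  and third_side_square: "\<bar>c\<bar> \<le> 1 \<Longrightarrow> (third_side x y c)\<^sup>2 = x\<^sup>2 + y\<^sup>2 + 2 * x * y * c"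
proof -
  assume "\<bar>c\<bar> \<le> 1"
  then have "x\<^sup>2 + y\<^sup>2 + 2 * x * y * c \<ge> 0"
    unfolding third_side_radicand(1) by (simp add: abs_square_le_1)
  then show "third_side x y c \<ge> 0" "(third_side x y c)\<^sup>2 = x\<^sup>2 + y\<^sup>2 + 2 * x * y * c"
    by (simp_all add: third_side_def)
qed

lemma third_side_pos: "x \<noteq> 0 \<Longrightarrow> \<bar>c\<bar> < 1 \<Longrightarrow> third_side x y c > 0"
  unfolding third_side_def third_side_radicand(1)
  by (simp add: abs_square_less_1 add_nonneg_pos)

lemma third_side_ge:
  assumes "\<bar>c\<bar> \<le> 1"
  shows "\<bar>y + x * c\<bar> \<le> third_side x y c" "\<bar>x + y * c\<bar> \<le> third_side x y c"
proof -
  have "1 - c\<^sup>2 \<ge> 0" using assms by (simp add: abs_square_le_1)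
  then have "(y + x * c)\<^sup>2 \<le> (third_side x y c)\<^sup>2" "(x + y * c)\<^sup>2 \<le> (third_side x y c)\<^sup>2"
    unfolding third_side_square[OF assms]
    by (subst third_side_radicand(1), simp, subst third_side_radicand(2), simp)
  then show "\<bar>y + x * c\<bar> \<le> third_side x y c" "\<bar>x + y * c\<bar> \<le> third_side x y c"
    using third_side_nonneg[OF assms] by (auto simp: abs_le_square_iff[symmetric])
qed

lemma third_side_le: "\<bar>c\<bar> \<le> 1 \<Longrightarrow> third_side x y c \<le> \<bar>x\<bar> + \<bar>y\<bar>"
proof -
  assume c: "\<bar>c\<bar> \<le> 1"
  have "x * y * c \<le> \<bar>x * y * c\<bar>" by simp
  also have "\<dots> \<le> \<bar>x\<bar> * \<bar>y\<bar>" using c by (simp add: abs_mult mult_left_le)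
  finally have "(third_side x y c)\<^sup>2 \<le> (\<bar>x\<bar> + \<bar>y\<bar>)\<^sup>2"
    unfolding third_side_square[OF c] by (simp add: power2_sum)
  then show ?thesis by (rule power2_le_imp_le) simp
qed

lemma third_side_minus:
  "third_side (- x) y c = third_side x y (- c)" "third_side x (- y) c = third_side x y (- c)"
  "third_side (- x) (- y) c = third_side x y c"
  by (simp_all add: third_side_def)

text \<open>
  The density, with respect to Lebesgue measure, of the law of the length \<open>third_side x y c\<close>.
\<close>

definition half_kernel :: "real \<Rightarrow> real \<Rightarrow> real \<Rightarrow> real \<Rightarrow> real" where
  "half_kernel \<mu> x y w = (if w > 0 then dunkl_k \<mu> \<bar>x\<bar> \<bar>y\<bar> w * w powr (2 * \<mu> + 1) else 0)"

lemma dunkl_k_nonneg: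
  assumes "\<mu> > -1/2" "r \<ge> 0" "s \<ge> 0"
  shows "dunkl_k \<mu> r s w \<ge> 0"
  using assms by (auto simp: dunkl_k_def intro!: mult_nonneg_nonneg divide_nonneg_nonneg)

lemma dunkl_k_measurable [measurable (raw)]:
  assumes [measurable]: "f \<in> borel_measurable M" "g \<in> borel_measurable M" "h \<in> borel_measurable M"
  shows "(\<lambda>\<omega>. dunkl_k \<mu> (f \<omega>) (g \<omega>) (h \<omega>)) \<in> borel_measurable M"
  unfolding dunkl_k_def by measurable

lemma half_kernel_measurable [measurable]: "half_kernel \<mu> x y \<in> borel_measurable borel"
  unfolding half_kernel_def by measurable

lemma half_kernel_nonneg: "\<mu> > -1/2 \<Longrightarrow> half_kernel \<mu> x y w \<ge> 0"
  by (auto simp: half_kernel_def dunkl_k_nonneg)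

text \<open>
  The Jacobian computation: \<open>g\<close> solves the law of cosines for \<open>c\<close>, and
  \<open>1 - (g w)\<^sup>2\<close> is sixteen times the squared area of the triangle (Heron) over \<open>(2 * r * s)\<^sup>2\<close>.
\<close>

lemma half_kernel_angle_density:
  fixes r s w :: real
  assumes mu: "\<mu> > -1/2" and rs: "r > 0" "s > 0"
  defines "g \<equiv> \<lambda>w. (w\<^sup>2 - r\<^sup>2 - s\<^sup>2) / (2 * r * s)"
  assumes w: "\<bar>r - s\<bar> \<le> w" "w \<le> r + s"
  shows "angle_density \<mu> (g w) * (w / (r * s)) = half_kernel \<mu> r s w"
proof (cases "\<bar>r - s\<bar> < w \<and> w < r + s")
  case True
  then have wpos: "w > 0" by linarith
  define D where "D = ((r + s)\<^sup>2 - w\<^sup>2) * (w\<^sup>2 - (r - s)\<^sup>2)"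
  have "w\<^sup>2 < (r + s)\<^sup>2" using True wpos by (intro power_strict_mono) auto
  moreover have "(r - s)\<^sup>2 < w\<^sup>2"
    using power_strict_mono[of "\<bar>r - s\<bar>" w 2] True by simp
  ultimately have Dpos: "D > 0" by (simp add: D_def)
  have one: "1 - (g w)\<^sup>2 = D / (2 * r * s)\<^sup>2"
    using rs by (simp add: g_def D_def field_simps power2_eq_square)
  moreover have "D / (2 * r * s)\<^sup>2 > 0" using Dpos rs by simp
  ultimately have "(g w)\<^sup>2 < 1" by linarith
  then have "-1 < g w" "g w < 1" by (auto simp: abs_square_less_1)
  moreover have pw: "(D / (2 * r * s)\<^sup>2) powr (\<mu> - 1/2) = D powr (\<mu> - 1/2) * (2 * r * s) / ((2 powr (2 * \<mu>)) * (r * s) powr (2 * \<mu>))"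
  proof -
    have "((2 * r * s)\<^sup>2) powr (\<mu> - 1/2) = ((2 * r * s) powr 2) powr (\<mu> - 1/2)"
      using rs by simp
    also have "\<dots> = (2 * r * s) powr (2 * \<mu> - 1)"
      unfolding powr_powr by (simp add: algebra_simps)
    also have "\<dots> = 2 powr (2 * \<mu>) * (r * s) powr (2 * \<mu>) / (2 * r * s)"
      using rs by (simp add: powr_diff powr_mult mult.assoc)
    finally show ?thesis using Dpos by (simp add: powr_divide)
  qed
  moreover have hk: "half_kernel \<mu> r s w
     = 2 powr (1 - 2 * \<mu>) * Gamma (\<mu> + 1) / (sqrt pi * Gamma (\<mu> + 1/2)) * (D powr (\<mu> - 1/2) / ((r * s) powr (2 * \<mu>) * w powr (2 * \<mu>))) * (w powr (2 * \<mu>) * w)"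
    using True rs wpos by (simp add: half_kernel_def dunkl_k_def D_def powr_mult powr_add)
  moreover have two: "2 powr (1 - 2 * \<mu>) = 2 / 2 powr (2 * \<mu>)" by (simp add: powr_diff)
  ultimately have "angle_density \<mu> (g w) = Gamma (\<mu> + 1) / (sqrt pi * Gamma (\<mu> + 1/2))
      * (D powr (\<mu> - 1/2) * (2 * r * s) / (2 powr (2 * \<mu>) * (r * s) powr (2 * \<mu>)))"
    by (simp only: angle_density_def one) simp
  then show ?thesis
    unfolding hk two using rs wpos by (simp add: ac_simps)
next
  case False
  with w consider "w = \<bar>r - s\<bar>" | "w = r + s" by linarith
  then have "g w = -1 \<or> g w = 1"
    by cases (use rs in \<open>simp_all add: g_def field_simps power2_eq_square\<close>)
  then show ?thesis using False rs by (auto simp: angle_density_def half_kernel_def dunkl_k_def)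
qed

text \<open>
  Substituting \<open>c = g w\<close> instead of \<open>w = third_side x y c\<close> keeps the substitution polynomial; the
  square root is not differentiable where the third side has length 0.
\<close>

lemma nn_integral_third_side:
  assumes mu: "\<mu> > -1/2" and xy: "x \<noteq> 0" "y \<noteq> 0" and F [measurable]: "F \<in> borel_measurable borel"
  shows "(\<integral>\<^sup>+c. F (third_side x y c) \<partial>angle_measure \<mu>) = (\<integral>\<^sup>+w. ennreal (half_kernel \<mu> x y w) * F w \<partial>lborel)"
proof -
  have pos: "(\<integral>\<^sup>+c. F (third_side r s c) \<partial>angle_measure \<mu>) = (\<integral>\<^sup>+w. ennreal (half_kernel \<mu> r s w) * F w \<partial>lborel)"
    if rs: "r > 0" "s > 0" for r s
  proof -
    define g where "g = (\<lambda>w. (w\<^sup>2 - r\<^sup>2 - s\<^sup>2) / (2 * r * s))"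
    have ga: "g \<bar>r - s\<bar> = -1" and gb: "g (r + s) = 1"
      using rs by (simp_all add: g_def field_simps power2_eq_square)
    have "(\<integral>\<^sup>+c. F (third_side r s c) \<partial>angle_measure \<mu>)
       = (\<integral>\<^sup>+c. ennreal (angle_density \<mu> c) * F (third_side r s c) \<partial>lborel)"
      unfolding angle_measure_def by (subst nn_integral_density) auto
    also have "\<dots> = (\<integral>\<^sup>+c. (ennreal (angle_density \<mu> c) * F (third_side r s c)) * indicator {g \<bar>r - s\<bar>..g (r + s)} c \<partial>lborel)"
      unfolding ga gb by (intro nn_integral_cong) (auto simp: indicator_def angle_density_def)
    also have "\<dots> = (\<integral>\<^sup>+w. (ennreal (angle_density \<mu> (g w)) * F (third_side r s (g w))) * ennreal (w / (r * s)) * indicator {\<bar>r - s\<bar>..r + s} w \<partial>lborel)"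
    proof (rule nn_integral_substitution_aux)
      show "(g has_real_derivative w / (r * s)) (at w)" for w
        unfolding g_def using rs by (auto intro!: derivative_eq_intros simp: field_simps)
      show "continuous_on {\<bar>r - s\<bar>..r + s} (\<lambda>w. w / (r * s))"
        using rs by (intro continuous_intros) auto
    qed (use rs in \<open>auto simp: abs_less_iff\<close>)
    also have "\<dots> = (\<integral>\<^sup>+w. ennreal (half_kernel \<mu> r s w) * F w \<partial>lborel)"
    proof (intro nn_integral_cong)
      fix w :: real
      show "(ennreal (angle_density \<mu> (g w)) * F (third_side r s (g w))) * ennreal (w / (r * s)) * indicator {\<bar>r - s\<bar>..r + s} w
          = ennreal (half_kernel \<mu> r s w) * F w"
      proof (cases "w \<in> {\<bar>r - s\<bar>..r + s}")
        case True
        then have "third_side r s (g w) = w"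
          using rs by (auto simp: third_side_def g_def)
        moreover have "half_kernel \<mu> r s w = angle_density \<mu> (g w) * (w / (r * s))"
          using half_kernel_angle_density[OF mu rs] True by (simp add: g_def)
        then have "ennreal (half_kernel \<mu> r s w) = ennreal (angle_density \<mu> (g w)) * ennreal (w / (r * s))"
          using angle_density_nonneg[OF mu] by (simp only: ennreal_mult')
        ultimately show ?thesis
          using True by (simp add: ac_simps)
      next
        case False
        then show ?thesis using rs by (auto simp: half_kernel_def dunkl_k_def)
      qed
    qed
    finally show ?thesis .
  qed
  have "half_kernel \<mu> \<bar>x\<bar> \<bar>y\<bar> = half_kernel \<mu> x y" by (simp add: half_kernel_def fun_eq_iff)
  moreover have "(\<integral>\<^sup>+c. F (third_side x y c) \<partial>angle_measure \<mu>) = (\<integral>\<^sup>+c. F (third_side \<bar>x\<bar> \<bar>y\<bar> c) \<partial>angle_measure \<mu>)"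
  proof -
    have "third_side x y c = third_side \<bar>x\<bar> \<bar>y\<bar> c \<or> (\<forall>c. third_side x y c = third_side \<bar>x\<bar> \<bar>y\<bar> (- c))" for c
      by (cases "x \<ge> 0"; cases "y \<ge> 0") (simp_all add: third_side_def)
    then consider "third_side x y = third_side \<bar>x\<bar> \<bar>y\<bar>" | "third_side x y = (\<lambda>c. third_side \<bar>x\<bar> \<bar>y\<bar> (- c))"
      by (auto simp: fun_eq_iff)
    then show ?thesis
      by cases (simp_all add: nn_integral_angle_measure_uminus[of "\<lambda>c. F (third_side \<bar>x\<bar> \<bar>y\<bar> c)"])
  qed
  ultimately show ?thesis using pos[of "\<bar>x\<bar>" "\<bar>y\<bar>"] xy by simp
qed

lemma distr_third_side:
  assumes mu: "\<mu> > -1/2" and xy: "x \<noteq> 0" "y \<noteq> 0"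
  shows "distr (angle_measure \<mu>) borel (third_side x y) = density lborel (\<lambda>w. ennreal (half_kernel \<mu> x y w))"
proof (rule measure_eqI)
  fix A assume "A \<in> sets (distr (angle_measure \<mu>) borel (third_side x y))"
  then have [measurable]: "A \<in> sets borel" by simp
  show "emeasure (distr (angle_measure \<mu>) borel (third_side x y)) A = emeasure (density lborel (\<lambda>w. ennreal (half_kernel \<mu> x y w))) A"
    using nn_integral_third_side[OF assms, of "indicator A"] nn_integral_distr[of "third_side x y" "angle_measure \<mu>" borel "indicator A"]
    by (simp add: emeasure_density)
qed simp

lemma dunkl_k_split:
  "dunkl_k \<mu> \<bar>x\<bar> \<bar>y\<bar> \<bar>z\<bar> * \<bar>z\<bar> powr (2 * \<mu> + 1) = half_kernel \<mu> x y z + half_kernel \<mu> x y (- z)"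
  by (auto simp: half_kernel_def dunkl_k_def)

text \<open>
  Integration against the kernel averages over both signs of the third side, so the total mass
  of the kernel on the real line is 2.
\<close>

lemma nn_integral_dunkl_k:
  assumes mu: "\<mu> > -1/2" and xy: "x \<noteq> 0" "y \<noteq> 0" and F [measurable]: "F \<in> borel_measurable borel"
  shows "(\<integral>\<^sup>+z. F z * ennreal (dunkl_k \<mu> \<bar>x\<bar> \<bar>y\<bar> \<bar>z\<bar>) \<partial>dunkl_borel \<mu>)
    = (\<integral>\<^sup>+c. F (third_side x y c) + F (- third_side x y c) \<partial>angle_measure \<mu>)"
proof -
  let ?h = "\<lambda>z. ennreal (half_kernel \<mu> x y z)"
  have "(\<integral>\<^sup>+z. F z * ennreal (dunkl_k \<mu> \<bar>x\<bar> \<bar>y\<bar> \<bar>z\<bar>) \<partial>dunkl_borel \<mu>)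
    = (\<integral>\<^sup>+z. ennreal (\<bar>z\<bar> powr (2 * \<mu> + 1)) * (F z * ennreal (dunkl_k \<mu> \<bar>x\<bar> \<bar>y\<bar> \<bar>z\<bar>)) \<partial>lborel)"
    unfolding dunkl_borel_def by (subst nn_integral_density) auto
  also have "\<dots> = (\<integral>\<^sup>+z. ?h z * F z + ?h (- z) * F z \<partial>lborel)"
  proof (intro nn_integral_cong)
    fix z
    have "ennreal (\<bar>z\<bar> powr (2 * \<mu> + 1)) * (F z * ennreal (dunkl_k \<mu> \<bar>x\<bar> \<bar>y\<bar> \<bar>z\<bar>))
      = ennreal (dunkl_k \<mu> \<bar>x\<bar> \<bar>y\<bar> \<bar>z\<bar> * \<bar>z\<bar> powr (2 * \<mu> + 1)) * F z"
      using dunkl_k_nonneg[OF mu] by (simp add: ennreal_mult' ac_simps)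
    then show "ennreal (\<bar>z\<bar> powr (2 * \<mu> + 1)) * (F z * ennreal (dunkl_k \<mu> \<bar>x\<bar> \<bar>y\<bar> \<bar>z\<bar>)) = ?h z * F z + ?h (- z) * F z"
      unfolding dunkl_k_split using half_kernel_nonneg[OF mu] by (simp add: distrib_right)
  qed
  also have "\<dots> = (\<integral>\<^sup>+z. ?h z * F z \<partial>lborel) + (\<integral>\<^sup>+z. ?h (- z) * F z \<partial>lborel)"
    by (rule nn_integral_add) auto
  also have "(\<integral>\<^sup>+z. ?h (- z) * F z \<partial>lborel) = (\<integral>\<^sup>+z. ?h z * F (- z) \<partial>lborel)"
    by (subst nn_integral_real_affine[of _ "-1" 0]) auto
  also have "(\<integral>\<^sup>+z. ?h z * F z \<partial>lborel) + (\<integral>\<^sup>+z. ?h z * F (- z) \<partial>lborel)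
     = (\<integral>\<^sup>+c. F (third_side x y c) \<partial>angle_measure \<mu>) + (\<integral>\<^sup>+c. F (- third_side x y c) \<partial>angle_measure \<mu>)"
    using nn_integral_third_side[OF mu xy, of F] nn_integral_third_side[OF mu xy, of "\<lambda>z. F (- z)"] by simp
  also have "\<dots> = (\<integral>\<^sup>+c. F (third_side x y c) + F (- third_side x y c) \<partial>angle_measure \<mu>)"
    by (rule nn_integral_add[symmetric]) auto
  finally show ?thesis .
qed

lemma integral_dunkl_k:
  fixes g :: "real \<Rightarrow> real"
  assumes mu: "\<mu> > -1/2" and xy: "x \<noteq> 0" "y \<noteq> 0" and g [measurable]: "g \<in> borel_measurable borel"
    and B: "\<And>c. c \<in> {-1<..<1} \<Longrightarrow> \<bar>g (third_side x y c)\<bar> \<le> B" "\<And>c. c \<in> {-1<..<1} \<Longrightarrow> \<bar>g (- third_side x y c)\<bar> \<le> B"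
  shows "integrable (dunkl_borel \<mu>) (\<lambda>z. g z * dunkl_k \<mu> \<bar>x\<bar> \<bar>y\<bar> \<bar>z\<bar>)" (is ?I)
    and "(\<integral>z. g z * dunkl_k \<mu> \<bar>x\<bar> \<bar>y\<bar> \<bar>z\<bar> \<partial>dunkl_borel \<mu>)
      = (\<integral>c. g (third_side x y c) + g (- third_side x y c) \<partial>angle_measure \<mu>)" (is ?E)
proof -
  let ?h = "half_kernel \<mu> x y"
  have nn: "AE z in lborel. 0 \<le> ?h z" by (simp add: half_kernel_nonneg[OF mu])
  have int: "integrable (angle_measure \<mu>) (\<lambda>c. g (third_side x y c))" "integrable (angle_measure \<mu>) (\<lambda>c. g (- third_side x y c))"
    by (rule integrable_angle_measure[OF mu, where B = B]; use B in simp)+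
  have one: "integrable lborel (\<lambda>z. ?h z *\<^sub>R f z) \<and> (\<integral>z. ?h z *\<^sub>R f z \<partial>lborel) = (\<integral>c. f (third_side x y c) \<partial>angle_measure \<mu>)"
    if f: "f \<in> borel_measurable borel" "integrable (angle_measure \<mu>) (\<lambda>c. f (third_side x y c))" for f :: "real \<Rightarrow> real"
  proof
    have "integrable (distr (angle_measure \<mu>) borel (third_side x y)) f"
      using f by (subst integrable_distr_eq) auto
    then show "integrable lborel (\<lambda>z. ?h z *\<^sub>R f z)"
      unfolding distr_third_side[OF mu xy] using f nn by (subst (asm) integrable_density) auto
    have "(\<integral>c. f (third_side x y c) \<partial>angle_measure \<mu>) = (\<integral>z. f z \<partial>distr (angle_measure \<mu>) borel (third_side x y))"
      using f by (subst integral_distr) auto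
    also have "\<dots> = (\<integral>z. ?h z *\<^sub>R f z \<partial>lborel)"
      unfolding distr_third_side[OF mu xy] using f nn by (subst integral_density) auto
    finally show "(\<integral>z. ?h z *\<^sub>R f z \<partial>lborel) = (\<integral>c. f (third_side x y c) \<partial>angle_measure \<mu>)" ..
  qed
  have p: "integrable lborel (\<lambda>z. ?h z *\<^sub>R g z)" "(\<integral>z. ?h z *\<^sub>R g z \<partial>lborel) = (\<integral>c. g (third_side x y c) \<partial>angle_measure \<mu>)"
    using one[of g] int by auto
  have m: "integrable lborel (\<lambda>z. ?h z *\<^sub>R g (- z))" "(\<integral>z. ?h z *\<^sub>R g (- z) \<partial>lborel) = (\<integral>c. g (- third_side x y c) \<partial>angle_measure \<mu>)"
    using one[of "\<lambda>z. g (- z)"] int by auto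
  have m': "integrable lborel (\<lambda>z. ?h (- z) *\<^sub>R g z)"
    using lborel_integrable_real_affine[OF m(1), of "-1" 0] by simp
  have m'': "(\<integral>z. ?h (- z) *\<^sub>R g z \<partial>lborel) = (\<integral>z. ?h z *\<^sub>R g (- z) \<partial>lborel)"
    by (subst lborel_integral_real_affine[of "-1" _ 0]) auto
  have eq: "(\<lambda>z. \<bar>z\<bar> powr (2 * \<mu> + 1) *\<^sub>R (g z * dunkl_k \<mu> \<bar>x\<bar> \<bar>y\<bar> \<bar>z\<bar>)) = (\<lambda>z. ?h z *\<^sub>R g z + ?h (- z) *\<^sub>R g z)"
  proof
    fix z
    show "\<bar>z\<bar> powr (2 * \<mu> + 1) *\<^sub>R (g z * dunkl_k \<mu> \<bar>x\<bar> \<bar>y\<bar> \<bar>z\<bar>) = ?h z *\<^sub>R g z + ?h (- z) *\<^sub>R g z"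
      using arg_cong[OF dunkl_k_split[of \<mu> x y z], of "\<lambda>t. t * g z"] by (simp add: algebra_simps)
  qed
  show ?I
    unfolding dunkl_borel_def by (subst integrable_density) (auto simp del: real_scaleR_def simp: eq intro!: Bochner_Integration.integrable_add p m')
  have "(\<integral>z. g z * dunkl_k \<mu> \<bar>x\<bar> \<bar>y\<bar> \<bar>z\<bar> \<partial>dunkl_borel \<mu>) = (\<integral>z. ?h z *\<^sub>R g z + ?h (- z) *\<^sub>R g z \<partial>lborel)"
    unfolding dunkl_borel_def by (subst integral_density) (auto simp del: real_scaleR_def simp: eq)
  also have "\<dots> = (\<integral>c. g (third_side x y c) \<partial>angle_measure \<mu>) + (\<integral>c. g (- third_side x y c) \<partial>angle_measure \<mu>)"
    using p m m' m'' by (subst Bochner_Integration.integral_add) auto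
  also have "\<dots> = (\<integral>c. g (third_side x y c) + g (- third_side x y c) \<partial>angle_measure \<mu>)"
    by (rule Bochner_Integration.integral_add[symmetric]) (rule int)+
  finally show ?E .
qed

section \<open>The angular form of the Dunkl translation\<close>

text \<open>
  Every \<open>g\<close> is \<open>even_part g w + w * odd_quotient g w\<close>, and both parts are even in \<open>w\<close>, hence functions of
  the polynomial \<open>w\<^sup>2 = x\<^sup>2 + y\<^sup>2 + 2 * x * y * c\<close>.  The default value of the quotient at \<open>w = 0\<close> is met with
  probability 0: for \<open>x \<noteq> 0\<close> the third side vanishes at most at \<open>c = 1\<close> or \<open>c = -1\<close>.
\<close>

definition even_part :: "(real \<Rightarrow> real) \<Rightarrow> real \<Rightarrow> real" where
  "even_part g w = (g w + g (- w)) / 2"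

definition odd_quotient :: "(real \<Rightarrow> real) \<Rightarrow> real \<Rightarrow> real" where
  "odd_quotient g w = (g w - g (- w)) / (2 * w)"

text \<open>
  On the triangle the signed factor of the kernel equals \<open>1/2 * (1 + c) * (1 + (x + y) / z)\<close>, where
  \<open>z\<close> is plus or minus the third side; adding the two signs gives this integrand.
\<close>

definition angular_integrand :: "real \<Rightarrow> (real \<Rightarrow> real) \<Rightarrow> real \<Rightarrow> real \<Rightarrow> real" where
  "angular_integrand x g y c =
    (1 + c) * (even_part g (third_side x y c) + (x + y) * odd_quotient g (third_side x y c))"

definition angular_translation :: "real \<Rightarrow> real \<Rightarrow> (real \<Rightarrow> real) \<Rightarrow> real \<Rightarrow> real" where
  "angular_translation \<mu> x g y = (\<integral>c. angular_integrand x g y c \<partial>angle_measure \<mu>)"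

text \<open>
  A class which contains the continuous functions, is preserved by translations, and
  on which the angular integral converges at every point.
\<close>

definition locally_bounded_borel :: "(real \<Rightarrow> real) \<Rightarrow> bool" where
  "locally_bounded_borel g \<longleftrightarrow>
    g \<in> borel_measurable borel \<and> (\<forall>R. \<exists>B. \<forall>z. \<bar>z\<bar> \<le> R \<longrightarrow> \<bar>g z\<bar> \<le> B)"

lemma even_part_measurable [measurable (raw)]:
  assumes [measurable]: "g \<in> borel_measurable borel" "f \<in> borel_measurable M"
  shows "(\<lambda>\<omega>. even_part g (f \<omega>)) \<in> borel_measurable M"
  unfolding even_part_def by measurable

lemma odd_quotient_measurable [measurable (raw)]:
  assumes [measurable]: "g \<in> borel_measurable borel" "f \<in> borel_measurable M"
  shows "(\<lambda>\<omega>. odd_quotient g (f \<omega>)) \<in> borel_measurable M"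
  unfolding odd_quotient_def by measurable

lemma angular_integrand_measurable [measurable (raw)]:
  assumes [measurable]: "g \<in> borel_measurable borel" "f \<in> borel_measurable M" "h \<in> borel_measurable M"
  shows "(\<lambda>\<omega>. angular_integrand x g (f \<omega>) (h \<omega>)) \<in> borel_measurable M"
  unfolding angular_integrand_def by measurable

lemma angular_integrand_measurable_angle:
  assumes "g \<in> borel_measurable borel"
  shows "angular_integrand x g y \<in> borel_measurable borel"
  by (rule angular_integrand_measurable[OF assms, of "\<lambda>_. y" borel "\<lambda>c. c"]) simp_all

lemma abs_even_part_le:
  assumes "\<bar>g w\<bar> \<le> B" "\<bar>g (- w)\<bar> \<le> B"
  shows "\<bar>even_part g w\<bar> \<le> B"
  using assms unfolding even_part_def by (auto simp: abs_le_iff)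

text \<open>
  The singularity of the odd quotient at \<open>w = 0\<close> is compensated by a factor of size at most \<open>w\<close>.
\<close>

lemma abs_mult_odd_quotient_le:
  assumes "\<bar>a\<bar> \<le> w" "\<bar>g w\<bar> \<le> B" "\<bar>g (- w)\<bar> \<le> B"
  shows "\<bar>a * odd_quotient g w\<bar> \<le> B"
proof (cases "w = 0")
  case False
  then have w: "w > 0" using assms(1) by linarith
  have "\<bar>a * odd_quotient g w\<bar> = \<bar>a\<bar> / w * \<bar>(g w - g (- w)) / 2\<bar>"
    using w by (simp add: odd_quotient_def abs_mult)
  also have "\<dots> \<le> 1 * B"
    using assms w by (intro mult_mono) (auto simp: field_simps)
  finally show ?thesis by simp
qed (use assms in \<open>auto simp: odd_quotient_def\<close>)

text \<open>
  The factor \<open>(1 + c) * (x + y)\<close> is the sum of the two projections \<open>y + x * c\<close> and \<open>x + y * c\<close>,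
  each of which is dominated by the third side.
\<close>

lemma angular_integrand_bound:
  assumes c: "c \<in> {-1<..<1}" and B: "\<bar>g (third_side x y c)\<bar> \<le> B" "\<bar>g (- third_side x y c)\<bar> \<le> B"
  shows "\<bar>angular_integrand x g y c\<bar> \<le> 4 * B"
proof -
  let ?w = "third_side x y c"
  have c': "\<bar>c\<bar> \<le> 1" using c by auto
  have "angular_integrand x g y c
     = (1 + c) * even_part g ?w + (y + x * c) * odd_quotient g ?w + (x + y * c) * odd_quotient g ?w"
    by (simp add: angular_integrand_def algebra_simps)
  moreover have "\<bar>(1 + c) * even_part g ?w\<bar> \<le> 2 * B"
    unfolding abs_mult using c abs_even_part_le[OF B] by (intro mult_mono) auto
  moreover have "\<bar>(y + x * c) * odd_quotient g ?w\<bar> \<le> B" "\<bar>(x + y * c) * odd_quotient g ?w\<bar> \<le> B"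
    using third_side_ge[OF c'] B by (auto intro!: abs_mult_odd_quotient_le)
  ultimately show ?thesis by linarith
qed

lemma locally_bounded_borelD:
  assumes "locally_bounded_borel g"
  shows "g \<in> borel_measurable borel" "\<exists>B. \<forall>z. \<bar>z\<bar> \<le> R \<longrightarrow> \<bar>g z\<bar> \<le> B"
  using assms by (auto simp: locally_bounded_borel_def)

lemma continuous_locally_bounded_borel:
  assumes "continuous_on UNIV g"
  shows "locally_bounded_borel g"
  unfolding locally_bounded_borel_def
proof (intro conjI allI)
  show "g \<in> borel_measurable borel" using assms by (rule borel_measurable_continuous_onI)
  fix R :: real
  have "compact (g ` {-R..R})"
    by (rule compact_continuous_image[OF continuous_on_subset[OF assms]]) simp_all
  then have "bounded (g ` {-R..R})" by (rule compact_imp_bounded)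
  then obtain B where "\<forall>y \<in> g ` {-R..R}. norm y \<le> B" unfolding bounded_iff ..
  then show "\<exists>B. \<forall>z. \<bar>z\<bar> \<le> R \<longrightarrow> \<bar>g z\<bar> \<le> B" by (intro exI[of _ B]) (auto simp: abs_le_iff)
qed

lemma third_side_in_ball:
  assumes "c \<in> {-1<..<1}"
  shows "\<bar>third_side x y c\<bar> \<le> \<bar>x\<bar> + \<bar>y\<bar>" "\<bar>- third_side x y c\<bar> \<le> \<bar>x\<bar> + \<bar>y\<bar>"
proof -
  have c: "\<bar>c\<bar> \<le> 1" using assms by auto
  show "\<bar>third_side x y c\<bar> \<le> \<bar>x\<bar> + \<bar>y\<bar>" "\<bar>- third_side x y c\<bar> \<le> \<bar>x\<bar> + \<bar>y\<bar>"
    using third_side_le[OF c, of x y] third_side_nonneg[OF c, of x y] by auto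
qed

lemma integrable_angular_integrand:
  assumes mu: "\<mu> > -1/2" and g: "locally_bounded_borel g"
  shows "integrable (angle_measure \<mu>) (angular_integrand x g y)"
proof -
  obtain B where B: "\<And>z. \<bar>z\<bar> \<le> \<bar>x\<bar> + \<bar>y\<bar> \<Longrightarrow> \<bar>g z\<bar> \<le> B"
    using locally_bounded_borelD(2)[OF g] by blast
  show ?thesis
  proof (rule integrable_angle_measure[OF mu])
    show "angular_integrand x g y \<in> borel_measurable borel"
      by (rule angular_integrand_measurable_angle[OF locally_bounded_borelD(1)[OF g]])
    show "\<bar>angular_integrand x g y c\<bar> \<le> 4 * B" if "c \<in> {-1<..<1}" for c
      using third_side_in_ball[OF that] by (intro angular_integrand_bound[OF that] B)
  qed
qed

lemma angular_translation_bound: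
  assumes mu: "\<mu> > -1/2" and g: "g \<in> borel_measurable borel"
    and B: "\<And>z. \<bar>z\<bar> \<le> \<bar>x\<bar> + \<bar>y\<bar> \<Longrightarrow> \<bar>g z\<bar> \<le> B"
  shows "\<bar>angular_translation \<mu> x g y\<bar> \<le> 4 * B"
proof -
  interpret prob_space "angle_measure \<mu>" by (rule angle_measure_prob_space[OF mu])
  have AE: "AE c in angle_measure \<mu>. norm (angular_integrand x g y c) \<le> 4 * B"
    using AE_angle_measure
  proof (rule eventually_mono)
    fix c assume c: "c \<in> {-1<..<1::real}"
    show "norm (angular_integrand x g y c) \<le> 4 * B"
      unfolding real_norm_def using third_side_in_ball[OF c] by (intro angular_integrand_bound[OF c] B)
  qed
  have "B \<ge> 0" using B[of 0] by auto
  have "integrable (angle_measure \<mu>) (angular_integrand x g y)"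
    using AE by (rule integrable_const_bound)
      (use angular_integrand_measurable_angle[OF g] in \<open>simp cong: measurable_cong_sets\<close>)
  then have "(\<integral>c. norm (angular_integrand x g y c) \<partial>angle_measure \<mu>) \<le> (\<integral>c. 4 * B \<partial>angle_measure \<mu>)"
    using AE by (intro integral_mono_AE) auto
  also have "\<dots> = 4 * B"
    using prob_space by simp
  finally show ?thesis
    using integral_norm_bound[of "angle_measure \<mu>" "angular_integrand x g y"]
    unfolding angular_translation_def real_norm_def by linarith
qed

lemma angular_translation_measurable:
  assumes mu: "\<mu> > -1/2" and [measurable]: "g \<in> borel_measurable borel"
  shows "angular_translation \<mu> x g \<in> borel_measurable borel"
proof -
  interpret prob_space "angle_measure \<mu>" by (rule angle_measure_prob_space[OF mu])
  have "(\<lambda>(y, c). angular_integrand x g y c) \<in> borel_measurable (borel \<Otimes>\<^sub>M angle_measure \<mu>)"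
    unfolding case_prod_beta by (intro angular_integrand_measurable) auto
  then have "(\<lambda>y. \<integral>c. angular_integrand x g y c \<partial>angle_measure \<mu>) \<in> borel_measurable borel"
    by (rule borel_measurable_lebesgue_integral)
  then show ?thesis
    by (simp add: angular_translation_def[abs_def])
qed

lemma angular_translation_locally_bounded:
  assumes mu: "\<mu> > -1/2" and g: "locally_bounded_borel g"
  shows "locally_bounded_borel (angular_translation \<mu> x g)"
  unfolding locally_bounded_borel_def
proof (intro conjI allI)
  note m = locally_bounded_borelD(1)[OF g]
  show "angular_translation \<mu> x g \<in> borel_measurable borel"
    by (rule angular_translation_measurable[OF mu m])
  fix R :: real
  obtain B where B: "\<forall>z. \<bar>z\<bar> \<le> \<bar>x\<bar> + R \<longrightarrow> \<bar>g z\<bar> \<le> B"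
    using locally_bounded_borelD(2)[OF g] by blast
  have "\<bar>angular_translation \<mu> x g y\<bar> \<le> 4 * B" if "\<bar>y\<bar> \<le> R" for y
    by (rule angular_translation_bound[OF mu m]) (use B that in auto)
  then show "\<exists>B. \<forall>y. \<bar>y\<bar> \<le> R \<longrightarrow> \<bar>angular_translation \<mu> x g y\<bar> \<le> B" by blast
qed

lemma angular_translation_sum:
  assumes mu: "\<mu> > -1/2" and "\<And>i. i \<in> I \<Longrightarrow> locally_bounded_borel (g i)"
  shows "angular_translation \<mu> x (\<lambda>z. \<Sum>i\<in>I. a i * g i z) y = (\<Sum>i\<in>I. a i * angular_translation \<mu> x (g i) y)"
proof -
  have e: "even_part (\<lambda>z. \<Sum>i\<in>I. a i * g i z) w = (\<Sum>i\<in>I. a i * even_part (g i) w)" for w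
    unfolding even_part_def sum_divide_distrib sum.distrib[symmetric]
    by (rule sum.cong) (simp_all add: distrib_left)
  have o: "odd_quotient (\<lambda>z. \<Sum>i\<in>I. a i * g i z) w = (\<Sum>i\<in>I. a i * odd_quotient (g i) w)" for w
    unfolding odd_quotient_def sum_divide_distrib sum_subtractf[symmetric]
    by (rule sum.cong) (simp_all add: right_diff_distrib)
  have "angular_integrand x (\<lambda>z. \<Sum>i\<in>I. a i * g i z) y = (\<lambda>c. \<Sum>i\<in>I. a i * angular_integrand x (g i) y c)"
    unfolding angular_integrand_def e o sum_distrib_left sum.distrib[symmetric]
    by (rule ext, rule sum.cong) (simp_all add: distrib_left mult.left_commute)
  then show ?thesis
    unfolding angular_translation_def
    by (simp add: Bochner_Integration.integral_sum integrable_angular_integrand[OF mu assms(2)])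
qed

lemma angular_translation_diff:
  assumes mu: "\<mu> > -1/2" and "locally_bounded_borel f" "locally_bounded_borel g"
  shows "angular_translation \<mu> x (\<lambda>z. f z - g z) y = angular_translation \<mu> x f y - angular_translation \<mu> x g y"
proof -
  have "angular_integrand x (\<lambda>z. f z - g z) y = (\<lambda>c. angular_integrand x f y c - angular_integrand x g y c)"
    by (rule ext) (simp add: angular_integrand_def even_part_def odd_quotient_def diff_divide_distrib add_divide_distrib algebra_simps)
  then show ?thesis
    unfolding angular_translation_def
    by (simp add: Bochner_Integration.integral_diff integrable_angular_integrand[OF mu] assms)
qed

text \<open>
  The three cosines of the kernel are those of the angles of the triangle, expressed by \<open>c\<close> and \<open>z\<close>.
\<close>

lemma dunkl_W_third_side:
  assumes xy: "x \<noteq> 0" "y \<noteq> 0" and z: "z \<noteq> 0" "z\<^sup>2 = x\<^sup>2 + y\<^sup>2 + 2 * x * y * c"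
  shows "1/2 * (1 - dunkl_sigma x y z + dunkl_sigma z x y + dunkl_sigma z y x) = 1/2 * (1 + c) * (1 + (x + y) / z)"
proof -
  have "x\<^sup>2 + y\<^sup>2 - z\<^sup>2 = (2 * x * y) * (- c)" "z\<^sup>2 + x\<^sup>2 - y\<^sup>2 = (2 * x) * (x + y * c)" "z\<^sup>2 + y\<^sup>2 - x\<^sup>2 = (2 * y) * (y + x * c)"
    unfolding z(2) by (simp_all add: power2_eq_square algebra_simps)
  then have "dunkl_sigma x y z = - c" "dunkl_sigma z x y = (x + y * c) / z" "dunkl_sigma z y x = (y + x * c) / z"
    unfolding dunkl_sigma_def using xy z(1) by (simp_all add: divide_simps del: mult_minus_right)
  moreover have "(x + y * c) / z + (y + x * c) / z = (1 + c) * ((x + y) / z)"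
    by (simp add: algebra_simps flip: add_divide_distrib)
  ultimately have "1 - dunkl_sigma x y z + dunkl_sigma z x y + dunkl_sigma z y x = (1 + c) + (1 + c) * ((x + y) / z)"
    by linarith
  then show ?thesis by (simp add: algebra_simps)
qed

lemma dunkl_W_measurable [measurable (raw)]:
  assumes [measurable]: "f \<in> borel_measurable M" "g \<in> borel_measurable M" "h \<in> borel_measurable M"
  shows "(\<lambda>\<omega>. dunkl_W \<mu> (f \<omega>) (g \<omega>) (h \<omega>)) \<in> borel_measurable M"
  unfolding dunkl_W_def dunkl_sigma_def by measurable

text \<open>
  The projections of the sides bound the signed factor of the kernel by 2 on the triangle, so the
  law of the third side carries the kernel integral over to an expectation.  The third claim, with a crude
  constant, supplies the absolute convergence which Fubini's theorem needs.
\<close>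

lemma integral_dunkl_W:
  assumes mu: "\<mu> > -1/2" and xy: "x \<noteq> 0" "y \<noteq> 0" and g [measurable]: "g \<in> borel_measurable borel"
    and B: "\<And>z. \<bar>z\<bar> \<le> \<bar>x\<bar> + \<bar>y\<bar> \<Longrightarrow> \<bar>g z\<bar> \<le> B"
  shows "integrable (dunkl_borel \<mu>) (\<lambda>z. g z * dunkl_W \<mu> x y z)"
    and "(\<integral>z. g z * dunkl_W \<mu> x y z \<partial>dunkl_borel \<mu>) = angular_translation \<mu> x g y"
    and "(\<integral>z. \<bar>g z * dunkl_W \<mu> x y z\<bar> \<partial>dunkl_borel \<mu>) \<le> 8 * B"
proof -
  interpret prob_space "angle_measure \<mu>" by (rule angle_measure_prob_space[OF mu])
  define A where "A = (\<lambda>z. 1/2 * (1 - dunkl_sigma x y z + dunkl_sigma z x y + dunkl_sigma z y x))"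
  have [measurable]: "A \<in> borel_measurable borel" unfolding A_def dunkl_sigma_def by measurable
  let ?w = "third_side x y"
  have Aw: "A (?w c) = 1/2 * (1 + c) * (1 + (x + y) / ?w c)" "A (- ?w c) = 1/2 * (1 + c) * (1 - (x + y) / ?w c)"
    and w0: "?w c > 0" if "c \<in> {-1<..<1}" for c
  proof -
    have c: "\<bar>c\<bar> < 1" "\<bar>c\<bar> \<le> 1" using that by auto
    show "?w c > 0" using third_side_pos[OF xy(1) c(1)] .
    then show "A (?w c) = 1/2 * (1 + c) * (1 + (x + y) / ?w c)" "A (- ?w c) = 1/2 * (1 + c) * (1 - (x + y) / ?w c)"
      using dunkl_W_third_side[OF xy, of "?w c" c] dunkl_W_third_side[OF xy, of "- ?w c" c] third_side_square[OF c(2), of x y]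
      by (simp_all add: A_def)
  qed
  have A2: "\<bar>A (?w c)\<bar> \<le> 2 \<and> \<bar>A (- ?w c)\<bar> \<le> 2" if c: "c \<in> {-1<..<1}" for c
  proof -
    have c': "\<bar>c\<bar> \<le> 1" using c by auto
    have expand: "1/2 * (1 + c) * (1 + q) = 1/2 * ((1 + c) + (1 + c) * q)" "1/2 * (1 + c) * (1 - q) = 1/2 * ((1 + c) - (1 + c) * q)" for q
      by (simp_all add: field_simps)
    have "(1 + c) * ((x + y) / ?w c) = (y + x * c) / ?w c + (x + y * c) / ?w c"
      by (simp add: algebra_simps flip: add_divide_distrib)
    moreover have "\<bar>(y + x * c) / ?w c\<bar> \<le> 1" "\<bar>(x + y * c) / ?w c\<bar> \<le> 1"
      using third_side_ge[OF c', of y x] third_side_ge[OF c', of x y] w0[OF c] by (simp_all add: abs_divide divide_le_eq_1 mult.commute)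
    moreover have "A (?w c) = 1/2 * ((1 + c) + (1 + c) * ((x + y) / ?w c))"
      "A (- ?w c) = 1/2 * ((1 + c) - (1 + c) * ((x + y) / ?w c))"
      unfolding Aw[OF c] by (simp_all only: expand)
    moreover have "\<bar>1/2 * ((1 + c) + q)\<bar> \<le> 2 \<and> \<bar>1/2 * ((1 + c) - q)\<bar> \<le> 2"
      if "q = u + v" "\<bar>u\<bar> \<le> 1" "\<bar>v\<bar> \<le> 1" for q u v :: real
      using c that by (auto simp: abs_le_iff)
    ultimately show ?thesis by (simp only:)
  qed
  have W: "dunkl_W \<mu> x y z = A z * dunkl_k \<mu> \<bar>x\<bar> \<bar>y\<bar> \<bar>z\<bar>" for z
    by (simp add: dunkl_W_def A_def)
  have "B \<ge> 0" using B[of 0] by auto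
  have bd: "\<bar>g (?w c) * A (?w c)\<bar> \<le> B * 2" "\<bar>g (- ?w c) * A (- ?w c)\<bar> \<le> B * 2" if c: "c \<in> {-1<..<1}" for c
    unfolding abs_mult using A2[OF c] B[OF third_side_in_ball(1)[OF c]] B[OF third_side_in_ball(2)[OF c]] \<open>B \<ge> 0\<close>
    by (auto intro!: mult_mono)
  have "integrable (dunkl_borel \<mu>) (\<lambda>z. (g z * A z) * dunkl_k \<mu> \<bar>x\<bar> \<bar>y\<bar> \<bar>z\<bar>)"
    by (rule integral_dunkl_k(1)[OF mu xy, where B = "B * 2"]) (use bd in auto)
  then show "integrable (dunkl_borel \<mu>) (\<lambda>z. g z * dunkl_W \<mu> x y z)"
    by (simp add: W mult.assoc)
  have "(\<integral>z. (g z * A z) * dunkl_k \<mu> \<bar>x\<bar> \<bar>y\<bar> \<bar>z\<bar> \<partial>dunkl_borel \<mu>)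
    = (\<integral>c. g (?w c) * A (?w c) + g (- ?w c) * A (- ?w c) \<partial>angle_measure \<mu>)"
    by (rule integral_dunkl_k(2)[OF mu xy, where B = "B * 2"]) (use bd in auto)
  also have "\<dots> = (\<integral>c. angular_integrand x g y c \<partial>angle_measure \<mu>)"
  proof (rule integral_cong_AE)
    show "AE c in angle_measure \<mu>. g (?w c) * A (?w c) + g (- ?w c) * A (- ?w c) = angular_integrand x g y c"
      using AE_angle_measure
    proof (rule eventually_mono)
      fix c assume c: "c \<in> {-1<..<1::real}"
      show "g (?w c) * A (?w c) + g (- ?w c) * A (- ?w c) = angular_integrand x g y c"
        unfolding Aw[OF c] using w0[OF c]
        by (simp add: angular_integrand_def even_part_def odd_quotient_def field_simps)
    qed
  qed auto
  finally show "(\<integral>z. g z * dunkl_W \<mu> x y z \<partial>dunkl_borel \<mu>) = angular_translation \<mu> x g y"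
    by (simp add: W mult.assoc angular_translation_def)
  have "(\<integral>z. \<bar>g z * A z\<bar> * dunkl_k \<mu> \<bar>x\<bar> \<bar>y\<bar> \<bar>z\<bar> \<partial>dunkl_borel \<mu>)
    = (\<integral>c. \<bar>g (?w c) * A (?w c)\<bar> + \<bar>g (- ?w c) * A (- ?w c)\<bar> \<partial>angle_measure \<mu>)"
    by (rule integral_dunkl_k(2)[OF mu xy, where B = "B * 2"]) (use bd in auto)
  also have "\<dots> \<le> (\<integral>c. 4 * B \<partial>angle_measure \<mu>)"
  proof (rule integral_mono_AE)
    show "AE c in angle_measure \<mu>. \<bar>g (?w c) * A (?w c)\<bar> + \<bar>g (- ?w c) * A (- ?w c)\<bar> \<le> 4 * B"
      using AE_angle_measure
    proof (rule eventually_mono)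
      fix c assume c: "c \<in> {-1<..<1::real}"
      show "\<bar>g (?w c) * A (?w c)\<bar> + \<bar>g (- ?w c) * A (- ?w c)\<bar> \<le> 4 * B" using bd[OF c] by linarith
    qed
    show "integrable (angle_measure \<mu>) (\<lambda>c. \<bar>g (?w c) * A (?w c)\<bar> + \<bar>g (- ?w c) * A (- ?w c)\<bar>)"
      by (intro Bochner_Integration.integrable_add integrable_abs integrable_angle_measure[OF mu, where B = "B * 2"])
        (use bd in auto)
  qed simp
  also have "\<dots> \<le> 8 * B" using \<open>B \<ge> 0\<close> prob_space by simp
  finally show "(\<integral>z. \<bar>g z * dunkl_W \<mu> x y z\<bar> \<partial>dunkl_borel \<mu>) \<le> 8 * B"
    using dunkl_k_nonneg[OF mu, of "\<bar>x\<bar>" "\<bar>y\<bar>"] by (simp add: W mult.assoc abs_mult)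
qed

section \<open>A Bessel inequality for the two reflections\<close>

text \<open>
  Bessel's inequality for two functions which need not be orthonormal: it suffices that their
  Gram matrix is dominated by the identity, and only in the direction of the coefficients.
  The proof expands the square of \<open>f - (p * a + q * b)\<close>.
\<close>

lemma bessel_inequality_pair:
  fixes M :: "'a measure" and f a b :: "'a \<Rightarrow> real"
  defines "p \<equiv> (\<integral>\<omega>. f \<omega> * a \<omega> \<partial>M)" and "q \<equiv> (\<integral>\<omega>. f \<omega> * b \<omega> \<partial>M)"
  assumes int: "integrable M (\<lambda>\<omega>. (f \<omega>)\<^sup>2)" "integrable M (\<lambda>\<omega>. f \<omega> * a \<omega>)" "integrable M (\<lambda>\<omega>. f \<omega> * b \<omega>)"
    "integrable M (\<lambda>\<omega>. (p * a \<omega> + q * b \<omega>)\<^sup>2)"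
    and gram: "(\<integral>\<omega>. (p * a \<omega> + q * b \<omega>)\<^sup>2 \<partial>M) \<le> p\<^sup>2 + q\<^sup>2"
  shows "p\<^sup>2 + q\<^sup>2 \<le> (\<integral>\<omega>. (f \<omega>)\<^sup>2 \<partial>M)"
proof -
  have "0 \<le> (\<integral>\<omega>. (f \<omega> - (p * a \<omega> + q * b \<omega>))\<^sup>2 \<partial>M)"
    by (rule integral_nonneg_AE) simp
  also have "(\<lambda>\<omega>. (f \<omega> - (p * a \<omega> + q * b \<omega>))\<^sup>2)
      = (\<lambda>\<omega>. (f \<omega>)\<^sup>2 - 2 * p * (f \<omega> * a \<omega>) - 2 * q * (f \<omega> * b \<omega>) + (p * a \<omega> + q * b \<omega>)\<^sup>2)"
    by (rule ext) (simp add: power2_eq_square algebra_simps)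
  also have "(\<integral>\<omega>. (f \<omega>)\<^sup>2 - 2 * p * (f \<omega> * a \<omega>) - 2 * q * (f \<omega> * b \<omega>) + (p * a \<omega> + q * b \<omega>)\<^sup>2 \<partial>M)
      = (\<integral>\<omega>. (f \<omega>)\<^sup>2 \<partial>M) - 2 * p * p - 2 * q * q + (\<integral>\<omega>. (p * a \<omega> + q * b \<omega>)\<^sup>2 \<partial>M)"
    using int by (simp add: p_def q_def)
  finally show ?thesis using gram by (simp add: power2_eq_square)
qed

text \<open>
  Reflecting \<open>x\<close> and \<open>y\<close> permutes four combinations of the expectations of \<open>G\<close>, \<open>G c\<close>, \<open>Q a\<close>, \<open>Q b\<close>,
  where \<open>G\<close> and \<open>Q\<close> are the even and odd part of \<open>g\<close> at the third side and \<open>a\<close>, \<open>b\<close> are the cosines of the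
  two angles adjacent to it.  The four squares add up to four times the sum of the squared
  expectations.  The pair \<open>(1, c)\<close> is orthogonal with norms at most 1.  For the pair \<open>(a, b)\<close> the
  Gram matrix is the identity minus a positive multiple of the rank-one matrix of \<open>(x, - y)\<close>, because
  the expectation of \<open>c\<close> is 0.  Hence Bessel's inequality applies to both pairs.
\<close>

lemma angular_translation_four_reflections:
  assumes mu: "\<mu> > -1/2" and x: "x \<noteq> 0" and g: "locally_bounded_borel g"
  shows "(angular_translation \<mu> x g y)\<^sup>2 + (angular_translation \<mu> (- x) g y)\<^sup>2
      + (angular_translation \<mu> x g (- y))\<^sup>2 + (angular_translation \<mu> (- x) g (- y))\<^sup>2
    \<le> 2 * (\<integral>c. (g (third_side x y c))\<^sup>2 + (g (- third_side x y c))\<^sup>2 \<partial>angle_measure \<mu>)"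
proof -
  interpret prob_space "angle_measure \<mu>" by (rule angle_measure_prob_space[OF mu])
  note gm [measurable] = locally_bounded_borelD(1)[OF g]
  obtain B where B: "\<And>z. \<bar>z\<bar> \<le> \<bar>x\<bar> + \<bar>y\<bar> \<Longrightarrow> \<bar>g z\<bar> \<le> B"
    using locally_bounded_borelD(2)[OF g] by blast
  have B0: "B \<ge> 0" using B[of 0] by auto
  define w where "w = third_side x y"
  define G where "G = (\<lambda>c. (g (w c) + g (- w c)) / 2)"
  define Q where "Q = (\<lambda>c. (g (w c) - g (- w c)) / 2)"
  define a where "a = (\<lambda>c. (y + x * c) / w c)"
  define b where "b = (\<lambda>c. (x + y * c) / w c)"
  have [measurable]: "w \<in> borel_measurable borel" unfolding w_def by measurable
  have [measurable]: "G \<in> borel_measurable borel" "Q \<in> borel_measurable borel" "a \<in> borel_measurable borel" "b \<in> borel_measurable borel"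
    unfolding G_def Q_def a_def b_def by measurable
  have w0: "w c > 0" if "c \<in> {-1<..<1}" for c
    using third_side_pos[OF x, of c y] that by (auto simp: w_def)
  have gB: "\<bar>g (w c)\<bar> \<le> B" "\<bar>g (- w c)\<bar> \<le> B" if "c \<in> {-1<..<1}" for c
    unfolding w_def using third_side_in_ball[OF that] by (auto intro: B simp del: abs_minus_cancel)
  have GQ: "\<bar>G c\<bar> \<le> B" "\<bar>Q c\<bar> \<le> B" if "c \<in> {-1<..<1}" for c
    using gB[OF that] by (auto simp: G_def Q_def abs_le_iff)
  have ab: "\<bar>a c\<bar> \<le> 1" "\<bar>b c\<bar> \<le> 1" if "c \<in> {-1<..<1}" for c
  proof -
    have "\<bar>c\<bar> \<le> 1" using that by auto
    from third_side_ge[OF this, of y x] third_side_ge[OF this, of x y] show "\<bar>a c\<bar> \<le> 1" "\<bar>b c\<bar> \<le> 1"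
      using w0[OF that] by (simp_all add: a_def b_def w_def abs_divide)
  qed
  have prod: "\<bar>f c * h c\<bar> \<le> C * D" if "\<bar>f c\<bar> \<le> C" "\<bar>h c\<bar> \<le> D" for f h :: "real \<Rightarrow> real" and c C D
    unfolding abs_mult using that by (intro mult_mono) auto
  have int: "integrable (angle_measure \<mu>) f"
    if "f \<in> borel_measurable borel" "\<And>c. c \<in> {-1<..<1} \<Longrightarrow> \<bar>f c\<bar> \<le> bnd" for f :: "real \<Rightarrow> real" and bnd
    by (rule integrable_angle_measure[OF mu that])
  have intprod: "integrable (angle_measure \<mu>) (\<lambda>c. f c * h c)"
    if "f \<in> borel_measurable borel" "h \<in> borel_measurable borel"
      "\<And>c. c \<in> {-1<..<1} \<Longrightarrow> \<bar>f c\<bar> \<le> C" "\<And>c. c \<in> {-1<..<1} \<Longrightarrow> \<bar>h c\<bar> \<le> D" for f h :: "real \<Rightarrow> real" and C D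
    by (rule integrable_angle_measure[OF mu, where B = "C * D"]) (use that in \<open>auto intro!: prod borel_measurable_times\<close>)
  have c1: "\<bar>c\<bar> \<le> 1" if "c \<in> {-1<..<1}" for c :: real
    using that by auto
  have iG: "integrable (angle_measure \<mu>) G" and iQa: "integrable (angle_measure \<mu>) (\<lambda>c. Q c * a c)"
    and iQb: "integrable (angle_measure \<mu>) (\<lambda>c. Q c * b c)"
    and iGc: "integrable (angle_measure \<mu>) (\<lambda>c. G c * c)"
    and iG2: "integrable (angle_measure \<mu>) (\<lambda>c. (G c)\<^sup>2)" and iQ2: "integrable (angle_measure \<mu>) (\<lambda>c. (Q c)\<^sup>2)"
    and ic: "integrable (angle_measure \<mu>) (\<lambda>c. c)"
    unfolding power2_eq_square
    by (rule intprod[OF _ _ GQ(2) ab(1)] intprod[OF _ _ GQ(2) ab(2)] intprod[OF _ _ GQ(1) c1] intprod[OF _ _ GQ(1) GQ(1)]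
        intprod[OF _ _ GQ(2) GQ(2)] int[OF _ GQ(1)] int[OF _ c1]; simp)+
  define \<alpha> where "\<alpha> = (\<integral>c. G c * 1 \<partial>angle_measure \<mu>)"
  define \<gamma> where "\<gamma> = (\<integral>c. G c * c \<partial>angle_measure \<mu>)"
  define \<beta> where "\<beta> = (\<integral>c. Q c * a c \<partial>angle_measure \<mu>)"
  define \<delta> where "\<delta> = (\<integral>c. Q c * b c \<partial>angle_measure \<mu>)"
  have combine: "(\<integral>c. G c * 1 + s * (G c * c) + t * (Q c * a c) + u * (Q c * b c) \<partial>angle_measure \<mu>) = \<alpha> + s * \<gamma> + t * \<beta> + u * \<delta>" for s t u
    using iG iQa iQb iGc by (simp add: \<alpha>_def \<beta>_def \<gamma>_def \<delta>_def)
  \<comment> \<open>The sign \<open>s\<close> records whether reflecting the arguments turns \<open>c\<close> into \<open>- c\<close>.\<close>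
  have eqT: "angular_translation \<mu> x' g y' = \<alpha> + s * \<gamma> + t * \<beta> + u * \<delta>"
    if "\<And>c. c \<in> {-1<..<1} \<Longrightarrow> third_side x' y' (s * c) = w c"
      and "\<And>c. (1 + s * c) * (x' + y') = t * (y + x * c) + u * (x + y * c)"
      and s: "s = 1 \<or> s = -1" for x' y' s t u
  proof -
    have "angular_translation \<mu> x' g y' = (\<integral>c. angular_integrand x' g y' (s * c) \<partial>angle_measure \<mu>)"
      unfolding angular_translation_def using s
      by (auto simp: integral_angle_measure_uminus[OF angular_integrand_measurable_angle[OF gm]])
    also have "\<dots> = (\<integral>c. G c * 1 + s * (G c * c) + t * (Q c * a c) + u * (Q c * b c) \<partial>angle_measure \<mu>)"
    proof (rule integral_cong_AE)
      show "AE c in angle_measure \<mu>. angular_integrand x' g y' (s * c) = G c * 1 + s * (G c * c) + t * (Q c * a c) + u * (Q c * b c)"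
        using AE_angle_measure
      proof (rule eventually_mono)
        fix c assume c: "c \<in> {-1<..<1::real}"
        have "angular_integrand x' g y' (s * c) = (1 + s * c) * G c + ((1 + s * c) * (x' + y')) * (Q c / w c)"
          unfolding angular_integrand_def that(1)[OF c] by (simp add: even_part_def odd_quotient_def G_def Q_def algebra_simps)
        moreover have "(t * A + u * B) * (q / d) = t * (q * (A / d)) + u * (q * (B / d))" for A B q d :: real
          by (cases "d = 0") (simp_all add: field_simps)
        ultimately have "angular_integrand x' g y' (s * c) = (1 + s * c) * G c + (t * (Q c * a c) + u * (Q c * b c))"
          unfolding that(2) a_def b_def by simp
        then show "angular_integrand x' g y' (s * c) = G c * 1 + s * (G c * c) + t * (Q c * a c) + u * (Q c * b c)"
          by (simp add: algebra_simps)
      qed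
    qed (use measurable_compose[OF _ angular_integrand_measurable_angle[OF gm], of "\<lambda>c. s * c"] in simp_all)
    finally show ?thesis unfolding combine .
  qed
  have T: "angular_translation \<mu> x g y = \<alpha> + \<gamma> + \<beta> + \<delta>"
    "angular_translation \<mu> (- x) g (- y) = \<alpha> + \<gamma> - \<beta> - \<delta>"
    "angular_translation \<mu> x g (- y) = \<alpha> - \<gamma> - \<beta> + \<delta>"
    "angular_translation \<mu> (- x) g y = \<alpha> - \<gamma> + \<beta> - \<delta>"
    using eqT[of x y 1 1 1] eqT[of "- x" "- y" 1 "-1" "-1"] eqT[of x "- y" "-1" "-1" 1] eqT[of "- x" y "-1" 1 "-1"]
    by (simp_all add: third_side_minus w_def algebra_simps)
  have Ec: "(\<integral>c. c \<partial>angle_measure \<mu>) = 0"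
    using integral_angle_measure_uminus[of "\<lambda>c. c" \<mu>] by simp
  have "\<alpha>\<^sup>2 + \<gamma>\<^sup>2 \<le> (\<integral>c. (G c)\<^sup>2 \<partial>angle_measure \<mu>)"
    unfolding \<alpha>_def \<gamma>_def
  proof (rule bessel_inequality_pair)
    fix p q :: real
    have i: "integrable (angle_measure \<mu>) (\<lambda>c. c\<^sup>2)"
      by (rule integrable_angle_measure[OF mu, where B = 1]) (auto simp: abs_square_le_1)
    have e: "(p * 1 + q * c)\<^sup>2 = p\<^sup>2 + (2 * p * q) * c + q\<^sup>2 * c\<^sup>2" for c
      by (simp add: power2_eq_square algebra_simps)
    show "integrable (angle_measure \<mu>) (\<lambda>c. (p * 1 + q * c)\<^sup>2)"
      unfolding e using i ic by simp
    have "(\<integral>c. c\<^sup>2 \<partial>angle_measure \<mu>) \<le> (\<integral>c. 1 \<partial>angle_measure \<mu>)"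
      by (intro integral_mono_AE i eventually_mono[OF AE_angle_measure]) (auto simp: abs_square_le_1)
    then have "(\<integral>c. c\<^sup>2 \<partial>angle_measure \<mu>) \<le> 1" using prob_space by simp
    moreover have "(\<integral>c. (p * 1 + q * c)\<^sup>2 \<partial>angle_measure \<mu>) = p\<^sup>2 + q\<^sup>2 * (\<integral>c. c\<^sup>2 \<partial>angle_measure \<mu>)"
      unfolding e using i ic Ec prob_space by simp
    ultimately show "(\<integral>c. (p * 1 + q * c)\<^sup>2 \<partial>angle_measure \<mu>) \<le> p\<^sup>2 + q\<^sup>2"
      by (simp add: mult_left_le)
  qed (use iG2 iG iGc in simp_all)
  moreover have "\<beta>\<^sup>2 + \<delta>\<^sup>2 \<le> (\<integral>c. (Q c)\<^sup>2 \<partial>angle_measure \<mu>)"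
    unfolding \<beta>_def \<delta>_def
  proof (rule bessel_inequality_pair)
    fix p q :: real
    have bd: "\<bar>p * a c + q * b c\<bar> \<le> \<bar>p\<bar> + \<bar>q\<bar>" if "c \<in> {-1<..<1}" for c
    proof -
      have "\<bar>p * a c\<bar> \<le> \<bar>p\<bar>" "\<bar>q * b c\<bar> \<le> \<bar>q\<bar>"
        using ab[OF that] by (simp_all add: abs_mult mult_left_le)
      then show ?thesis by linarith
    qed
    show i: "integrable (angle_measure \<mu>) (\<lambda>c. (p * a c + q * b c)\<^sup>2)"
      unfolding power2_eq_square by (rule intprod[OF _ _ bd bd]) measurable
    have "(\<integral>c. (p * a c + q * b c)\<^sup>2 \<partial>angle_measure \<mu>) \<le> (\<integral>c. p\<^sup>2 + q\<^sup>2 + 2 * p * q * c \<partial>angle_measure \<mu>)"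
    proof (rule integral_mono_AE[OF i])
      show "AE c in angle_measure \<mu>. (p * a c + q * b c)\<^sup>2 \<le> p\<^sup>2 + q\<^sup>2 + 2 * p * q * c"
        using AE_angle_measure
      proof (rule eventually_mono)
        fix c assume c: "c \<in> {-1<..<1::real}"
        have c1: "\<bar>c\<bar> \<le> 1" using c by auto
        have w2: "(w c)\<^sup>2 = x\<^sup>2 + y\<^sup>2 + 2 * x * y * c" unfolding w_def by (rule third_side_square[OF c1])
        have "(p * a c + q * b c)\<^sup>2 = (p * (y + x * c) + q * (x + y * c))\<^sup>2 / (w c)\<^sup>2"
          by (simp add: a_def b_def power_divide[symmetric] add_divide_distrib[of "p * (y + x * c)"])
        \<comment> \<open>The subtracted square is the rank-one defect of the Gram matrix.\<close>
        also have "(p * (y + x * c) + q * (x + y * c))\<^sup>2 = (p\<^sup>2 + q\<^sup>2 + 2 * p * q * c) * (w c)\<^sup>2 - (1 - c\<^sup>2) * (p * x - q * y)\<^sup>2"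
          unfolding w2 by (simp add: power2_eq_square algebra_simps)
        also have "\<dots> / (w c)\<^sup>2 \<le> ((p\<^sup>2 + q\<^sup>2 + 2 * p * q * c) * (w c)\<^sup>2) / (w c)\<^sup>2"
          using c1 by (intro divide_right_mono) (auto simp: abs_square_le_1)
        also have "\<dots> = p\<^sup>2 + q\<^sup>2 + 2 * p * q * c" using w0[OF c] by simp
        finally show "(p * a c + q * b c)\<^sup>2 \<le> p\<^sup>2 + q\<^sup>2 + 2 * p * q * c" .
      qed
    qed (use ic in simp)
    also have "\<dots> = p\<^sup>2 + q\<^sup>2" using ic Ec prob_space by simp
    finally show "(\<integral>c. (p * a c + q * b c)\<^sup>2 \<partial>angle_measure \<mu>) \<le> p\<^sup>2 + q\<^sup>2" .
  qed (use iQ2 iQa iQb in simp_all)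
  ultimately have "4 * (\<alpha>\<^sup>2 + \<gamma>\<^sup>2 + \<beta>\<^sup>2 + \<delta>\<^sup>2) \<le> 4 * ((\<integral>c. (G c)\<^sup>2 \<partial>angle_measure \<mu>) + (\<integral>c. (Q c)\<^sup>2 \<partial>angle_measure \<mu>))"
    by simp
  also have "\<dots> = (\<integral>c. 4 * ((G c)\<^sup>2 + (Q c)\<^sup>2) \<partial>angle_measure \<mu>)"
    using iG2 iQ2 by simp
  also have "(\<lambda>c. 4 * ((G c)\<^sup>2 + (Q c)\<^sup>2)) = (\<lambda>c. 2 * ((g (w c))\<^sup>2 + (g (- w c))\<^sup>2))"
    by (rule ext) (simp add: G_def Q_def power2_eq_square field_simps)
  also have "(\<integral>c. 2 * ((g (w c))\<^sup>2 + (g (- w c))\<^sup>2) \<partial>angle_measure \<mu>) = 2 * (\<integral>c. (g (w c))\<^sup>2 + (g (- w c))\<^sup>2 \<partial>angle_measure \<mu>)"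
    by (rule integral_mult_right_zero)
  also have "4 * (\<alpha>\<^sup>2 + \<gamma>\<^sup>2 + \<beta>\<^sup>2 + \<delta>\<^sup>2) = (\<alpha> + \<gamma> + \<beta> + \<delta>)\<^sup>2 + (\<alpha> - \<gamma> + \<beta> - \<delta>)\<^sup>2
      + (\<alpha> - \<gamma> - \<beta> + \<delta>)\<^sup>2 + (\<alpha> + \<gamma> - \<beta> - \<delta>)\<^sup>2"
    by (simp add: power2_eq_square algebra_simps)
  finally show ?thesis
    unfolding T w_def[symmetric] .
qed

section \<open>The Dunkl operator and the addition formula\<close>

text \<open>
  The Dunkl operator maps \<open>y ^ n\<close> to \<open>dunkl_weight \<mu> n * y ^ (n - 1)\<close>.
\<close>

definition dunkl_weight :: "real \<Rightarrow> nat \<Rightarrow> real" where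
  "dunkl_weight \<mu> n = real n + (if odd n then 2 * \<mu> + 1 else 0)"

text \<open>
  The Dunkl analogue of \<open>y ^ n / fact n\<close>: the Dunkl operator lowers the index by one.
\<close>

fun dunkl_power :: "real \<Rightarrow> nat \<Rightarrow> real \<Rightarrow> real" where
  "dunkl_power \<mu> 0 y = 1"
| "dunkl_power \<mu> (Suc n) y = y * dunkl_power \<mu> n y / dunkl_weight \<mu> (Suc n)"

text \<open>
  The Dunkl operator is \<open>F' y + (2 * \<mu> + 1) / y\<close> times the odd part of \<open>F\<close>.  The equation is multiplied by \<open>y\<close>
  so that it makes sense at 0 as well.
\<close>

definition has_dunkl_derivative :: "real \<Rightarrow> (real \<Rightarrow> real) \<Rightarrow> (real \<Rightarrow> real) \<Rightarrow> bool" where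
  "has_dunkl_derivative \<mu> F G \<longleftrightarrow>
    (\<forall>y. \<exists>D. (F has_real_derivative D) (at y) \<and> y * D + (2 * \<mu> + 1) * ((F y - F (- y)) / 2) = y * G y)"

lemma has_dunkl_derivativeI:
  assumes "\<And>y. (F has_real_derivative D y) (at y)"
    and "\<And>y. y * D y + (2 * \<mu> + 1) * ((F y - F (- y)) / 2) = y * G y"
  shows "has_dunkl_derivative \<mu> F G"
  using assms unfolding has_dunkl_derivative_def by blast

lemma has_dunkl_derivative_cmult:
  assumes "has_dunkl_derivative \<mu> F G"
  shows "has_dunkl_derivative \<mu> (\<lambda>y. a * F y) (\<lambda>y. a * G y)"
proof -
  obtain D where D: "\<And>y. (F has_real_derivative D y) (at y)" "\<And>y. y * D y + (2 * \<mu> + 1) * ((F y - F (- y)) / 2) = y * G y"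
    using assms unfolding has_dunkl_derivative_def by metis
  show ?thesis
  proof (rule has_dunkl_derivativeI)
    show "((\<lambda>y. a * F y) has_real_derivative a * D y) (at y)" for y
      by (rule DERIV_cmult[OF D(1)])
    show "y * (a * D y) + (2 * \<mu> + 1) * ((a * F y - a * F (- y)) / 2) = y * (a * G y)" for y
      using arg_cong[OF D(2)[of y], of "\<lambda>t. a * t"] by (simp add: algebra_simps)
  qed
qed

lemma has_dunkl_derivative_add:
  assumes "has_dunkl_derivative \<mu> F G" "has_dunkl_derivative \<mu> F' G'"
  shows "has_dunkl_derivative \<mu> (\<lambda>y. F y + F' y) (\<lambda>y. G y + G' y)"
proof -
  obtain D where D: "\<And>y. (F has_real_derivative D y) (at y)" "\<And>y. y * D y + (2 * \<mu> + 1) * ((F y - F (- y)) / 2) = y * G y"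
    using assms(1) unfolding has_dunkl_derivative_def by metis
  obtain D' where D': "\<And>y. (F' has_real_derivative D' y) (at y)" "\<And>y. y * D' y + (2 * \<mu> + 1) * ((F' y - F' (- y)) / 2) = y * G' y"
    using assms(2) unfolding has_dunkl_derivative_def by metis
  show ?thesis
  proof (rule has_dunkl_derivativeI)
    show "((\<lambda>y. F y + F' y) has_real_derivative D y + D' y) (at y)" for y
      by (rule DERIV_add[OF D(1) D'(1)])
    show "y * (D y + D' y) + (2 * \<mu> + 1) * ((F y + F' y - (F (- y) + F' (- y))) / 2) = y * (G y + G' y)" for y
      using D(2)[of y] D'(2)[of y] by (simp add: algebra_simps add_divide_distrib diff_divide_distrib)
  qed
qed

lemma has_dunkl_derivative_const: "has_dunkl_derivative \<mu> (\<lambda>y. a) (\<lambda>y. 0)"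
  by (rule has_dunkl_derivativeI[of _ "\<lambda>_. 0"]) auto

lemma has_dunkl_derivative_sum:
  assumes "\<And>i. i \<in> I \<Longrightarrow> has_dunkl_derivative \<mu> (F i) (G i)"
  shows "has_dunkl_derivative \<mu> (\<lambda>y. \<Sum>i\<in>I. F i y) (\<lambda>y. \<Sum>i\<in>I. G i y)"
  using assms
proof (induction I rule: infinite_finite_induct)
  case (insert i I)
  then show ?case
    using has_dunkl_derivative_add[of \<mu> "F i" "G i" "\<lambda>y. \<Sum>i\<in>I. F i y" "\<lambda>y. \<Sum>i\<in>I. G i y"] by simp
qed (auto intro: has_dunkl_derivative_const)

lemma dunkl_weight_pos: "\<mu> > -1/2 \<Longrightarrow> n > 0 \<Longrightarrow> dunkl_weight \<mu> n > 0"
  by (auto simp: dunkl_weight_def intro: add_pos_nonneg)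

lemma has_dunkl_derivative_power:
  "has_dunkl_derivative \<mu> (\<lambda>y. y ^ n) (\<lambda>y. dunkl_weight \<mu> n * y ^ (n - 1))"
proof (rule has_dunkl_derivativeI)
  show "((\<lambda>y. y ^ n) has_real_derivative real n * y ^ (n - 1)) (at y)" for y :: real
    by (auto intro!: derivative_eq_intros)
  show "y * (real n * y ^ (n - 1)) + (2 * \<mu> + 1) * ((y ^ n - (- y) ^ n) / 2) = y * (dunkl_weight \<mu> n * y ^ (n - 1))" for y
    by (cases n) (auto simp: dunkl_weight_def algebra_simps power_minus_odd power_minus_even)
qed

lemma dunkl_power_eq: "\<exists>a. a \<noteq> 0 \<and> dunkl_power \<mu> n = (\<lambda>y. a * y ^ n)" if mu: "\<mu> > -1/2"
proof (induction n)
  case (Suc n)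
  then obtain a where "a \<noteq> 0" "dunkl_power \<mu> n = (\<lambda>y. a * y ^ n)" by blast
  then show ?case
    using dunkl_weight_pos[OF mu, of "Suc n"] by (intro exI[of _ "a / dunkl_weight \<mu> (Suc n)"]) auto
qed (auto intro!: exI[of _ 1])

text \<open>
  Splitting into parities, the even part of \<open>F\<close> has derivative 0 away from 0.  The odd part \<open>O\<close> satisfies
  \<open>t * O' t = - (2 * \<mu> + 1) * O t\<close>, so \<open>O\<^sup>2\<close> decreases on the positive half-line from its value 0 at 0.
\<close>

lemma has_dunkl_derivative_unique:
  assumes mu: "\<mu> > -1/2" and F: "has_dunkl_derivative \<mu> F (\<lambda>y. 0)" and F0: "F 0 = 0"
  shows "F y = 0"
proof -
  obtain D where D: "\<And>y. (F has_real_derivative D y) (at y)" "\<And>y. y * D y + (2 * \<mu> + 1) * ((F y - F (- y)) / 2) = 0"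
    using F unfolding has_dunkl_derivative_def by (metis mult_zero_right)
  have Dm: "((\<lambda>y. F (- y)) has_real_derivative - D (- y)) (at y)" for y
  proof -
    have "(uminus has_real_derivative - 1) (at y)"
      by (rule DERIV_minus[OF DERIV_ident])
    from DERIV_chain2[where f = F and g = uminus, OF D(1) this] show ?thesis by simp
  qed
  have pos: "F y = 0 \<and> F (- y) = 0" if y: "y > 0" for y
  proof -
    have DE: "((\<lambda>y. F y + F (- y)) has_real_derivative 0) (at t)" if "t > 0" for t
    proof -
      have "t * (D t - D (- t)) = 0"
        using D(2)[of t] D(2)[of "- t"] by (simp add: algebra_simps add_divide_distrib diff_divide_distrib)
      then have "D t + - D (- t) = 0" using that by simp
      then show ?thesis using DERIV_add[OF D(1) Dm, of t] by simp
    qed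
    have "continuous_on {0..y} (\<lambda>y. F y + F (- y))"
      by (rule continuous_at_imp_continuous_on, rule ballI, rule DERIV_isCont, rule DERIV_add[OF D(1) Dm])
    then have "F y + F (- y) = F 0 + F (- 0)"
      using DERIV_isconst2[of 0 y "\<lambda>y. F y + F (- y)" y] y DE by simp
    then have even: "F y + F (- y) = 0" using F0 by simp
    let ?O = "\<lambda>y. F y - F (- y)"
    have DO: "((\<lambda>y. (?O y)\<^sup>2) has_real_derivative 2 * ?O t * (D t + D (- t))) (at t)" for t
      using DERIV_power[OF DERIV_diff[OF D(1) Dm, of t], of 2] by (simp add: algebra_simps)
    have "(?O y)\<^sup>2 \<le> (?O 0)\<^sup>2"
    proof (rule DERIV_nonpos_imp_nonincreasing[where f = "\<lambda>y. (?O y)\<^sup>2"])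
      fix t assume t: "0 \<le> t" "t \<le> y"
      have "2 * ?O t * (D t + D (- t)) \<le> 0"
      proof (cases "t = 0")
        case False
        have "t * D (- t) + (2 * \<mu> + 1) * (?O t / 2) = - (- t * D (- t) + (2 * \<mu> + 1) * ((F (- t) - F (- (- t))) / 2))"
          by (simp add: field_simps)
        also have "\<dots> = 0" using D(2)[of "- t"] by simp
        finally have tS: "t * (D t + D (- t)) = - (2 * \<mu> + 1) * ?O t"
          using D(2)[of t] unfolding distrib_left by linarith
        have "t * (2 * ?O t * (D t + D (- t))) = 2 * ?O t * (t * (D t + D (- t)))"
          by (rule mult.left_commute)
        also have "\<dots> = 2 * ?O t * (- (2 * \<mu> + 1) * ?O t)"
          by (simp only: tS)
        also have "\<dots> = - (2 * (2 * \<mu> + 1)) * (?O t)\<^sup>2"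
          by (simp add: power2_eq_square algebra_simps)
        also have "\<dots> \<le> 0" using mu by (intro mult_nonpos_nonneg) auto
        finally show ?thesis using t False by (simp add: mult_le_0_iff)
      qed simp
      then show "\<exists>y. ((\<lambda>y. (?O y)\<^sup>2) has_real_derivative y) (at t) \<and> y \<le> 0"
        using DO by blast
    qed (use y in simp)
    then show ?thesis using even by simp
  qed
  show ?thesis
    using pos[of y] pos[of "- y"] F0 by (cases y "0 :: real" rule: linorder_cases) auto
qed

text \<open>
  Differentiation under the integral without a dominated convergence argument: expanding one factor
  of the power reduces the claim to a smaller exponent, at the price of replacing \<open>q\<close> by \<open>q c * c\<close>.
\<close>

lemma has_real_derivative_angle_power:
  assumes mu: "\<mu> > -1/2" and q: "continuous_on UNIV q"
  shows "((\<lambda>y. \<integral>c. q c * (x\<^sup>2 + y\<^sup>2 + 2 * x * y * c) ^ n \<partial>angle_measure \<mu>) has_real_derivative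
    (\<integral>c. q c * (real n * (x\<^sup>2 + y\<^sup>2 + 2 * x * y * c) ^ (n - 1) * (2 * y + 2 * x * c)) \<partial>angle_measure \<mu>)) (at y)"
  using q
proof (induction n arbitrary: q)
  case (Suc n)
  let ?u = "\<lambda>y c. x\<^sup>2 + y\<^sup>2 + 2 * x * y * c"
  have int: "integrable (angle_measure \<mu>) f" if "continuous_on UNIV f" for f :: "real \<Rightarrow> real"
    using that by (rule integrable_angle_measure_continuous[OF mu])
  let ?E = "\<lambda>q y. \<integral>c. q c * ?u y c ^ n \<partial>angle_measure \<mu>"
  let ?D = "\<lambda>q. \<integral>c. q c * (real n * ?u y c ^ (n - 1) * (2 * y + 2 * x * c)) \<partial>angle_measure \<mu>"
  have cq: "continuous_on UNIV (\<lambda>c. q c * c)" using Suc.prems by (intro continuous_intros)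
  have eq: "(\<integral>c. q c * ?u y c ^ Suc n \<partial>angle_measure \<mu>) = (x\<^sup>2 + y\<^sup>2) * ?E q y + (2 * x * y) * ?E (\<lambda>c. q c * c) y" for y
  proof -
    have "(\<lambda>c. q c * ?u y c ^ Suc n) = (\<lambda>c. (x\<^sup>2 + y\<^sup>2) * (q c * ?u y c ^ n) + (2 * x * y) * (q c * c * ?u y c ^ n))"
      by (simp add: fun_eq_iff algebra_simps)
    then show ?thesis
      using int[of "\<lambda>c. q c * ?u y c ^ n"] int[of "\<lambda>c. q c * c * ?u y c ^ n"] Suc.prems
      by (simp add: continuous_intros)
  qed
  have "((\<lambda>y. (x\<^sup>2 + y\<^sup>2) * ?E q y + (2 * x * y) * ?E (\<lambda>c. q c * c) y) has_real_derivative
     (2 * y * ?E q y + ?D q * (x\<^sup>2 + y\<^sup>2)) + (2 * x * ?E (\<lambda>c. q c * c) y + ?D (\<lambda>c. q c * c) * (2 * x * y))) (at y)"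
    by (intro DERIV_add DERIV_mult Suc.IH Suc.prems cq) (auto intro!: derivative_eq_intros)
  moreover have "(2 * y * ?E q y + ?D q * (x\<^sup>2 + y\<^sup>2)) + (2 * x * ?E (\<lambda>c. q c * c) y + ?D (\<lambda>c. q c * c) * (2 * x * y))
    = (\<integral>c. q c * (real (Suc n) * ?u y c ^ n * (2 * y + 2 * x * c)) \<partial>angle_measure \<mu>)"
  proof -
    have "(\<lambda>c. q c * (real (Suc n) * ?u y c ^ n * (2 * y + 2 * x * c)))
      = (\<lambda>c. (2 * y * (q c * ?u y c ^ n) + (q c * (real n * ?u y c ^ (n - 1) * (2 * y + 2 * x * c))) * (x\<^sup>2 + y\<^sup>2))
         + (2 * x * (q c * c * ?u y c ^ n) + (q c * c * (real n * ?u y c ^ (n - 1) * (2 * y + 2 * x * c))) * (2 * x * y)))"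
    proof
      fix c
      have "real n * ?u y c ^ n = real n * ?u y c ^ (n - 1) * ?u y c" by (cases n) auto
      then have "q c * (real (Suc n) * ?u y c ^ n * (2 * y + 2 * x * c)) = q c * ((?u y c ^ n + real n * ?u y c ^ (n - 1) * ?u y c) * (2 * y + 2 * x * c))"
        by (simp add: distrib_right)
      also have "\<dots> = (2 * y * (q c * ?u y c ^ n) + (q c * (real n * ?u y c ^ (n - 1) * (2 * y + 2 * x * c))) * (x\<^sup>2 + y\<^sup>2))
         + (2 * x * (q c * c * ?u y c ^ n) + (q c * c * (real n * ?u y c ^ (n - 1) * (2 * y + 2 * x * c))) * (2 * x * y))"
      proof -
        have "q c * ((A + N * ?u y c) * (2 * y + 2 * x * c)) = (2 * y * (q c * A) + (q c * (N * (2 * y + 2 * x * c))) * (x\<^sup>2 + y\<^sup>2))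
         + (2 * x * (q c * c * A) + (q c * c * (N * (2 * y + 2 * x * c))) * (2 * x * y))" for A N
          by (simp add: algebra_simps)
        then show ?thesis .
      qed
      finally show "q c * (real (Suc n) * ?u y c ^ n * (2 * y + 2 * x * c)) = \<dots>" .
    qed
    moreover have "integrable (angle_measure \<mu>) (\<lambda>c. q c * ?u y c ^ n)" "integrable (angle_measure \<mu>) (\<lambda>c. q c * c * ?u y c ^ n)"
      "integrable (angle_measure \<mu>) (\<lambda>c. q c * (real n * ?u y c ^ (n - 1) * (2 * y + 2 * x * c)))"
      "integrable (angle_measure \<mu>) (\<lambda>c. q c * c * (real n * ?u y c ^ (n - 1) * (2 * y + 2 * x * c)))"
      by (intro int continuous_intros Suc.prems)+
    ultimately show ?thesis by simp
  qed
  ultimately show ?case unfolding eq by simp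
qed simp

text \<open>
  The translate of the even monomial \<open>z ^ (2 * k)\<close>.
\<close>

definition angle_power :: "real \<Rightarrow> nat \<Rightarrow> real \<Rightarrow> real \<Rightarrow> real" where
  "angle_power \<mu> k x y = (\<integral>c. (1 + c) * (x\<^sup>2 + y\<^sup>2 + 2 * x * y * c) ^ k \<partial>angle_measure \<mu>)"

lemma angular_translation_monomial:
  assumes mu: "\<mu> > -1/2" and x: "x \<noteq> 0"
  shows "angular_translation \<mu> x (\<lambda>z. z ^ n) y = (if even n then 1 else x + y) * angle_power \<mu> (n div 2) x y"
proof -
  let ?u = "\<lambda>c. x\<^sup>2 + y\<^sup>2 + 2 * x * y * c"
  have "angular_translation \<mu> x (\<lambda>z. z ^ n) y
    = (\<integral>c. (if even n then 1 else x + y) * ((1 + c) * ?u c ^ (n div 2)) \<partial>angle_measure \<mu>)"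
    unfolding angular_translation_def
  proof (rule integral_cong_AE)
    show "AE c in angle_measure \<mu>. angular_integrand x (\<lambda>z. z ^ n) y c = (if even n then 1 else x + y) * ((1 + c) * ?u c ^ (n div 2))"
      using AE_angle_measure
    proof (rule eventually_mono)
      fix c assume c: "c \<in> {-1<..<1::real}"
      then have c1: "\<bar>c\<bar> < 1" "\<bar>c\<bar> \<le> 1" by auto
      let ?w = "third_side x y c"
      have w: "?w > 0" "?w\<^sup>2 = ?u c" using third_side_pos[OF x c1(1)] third_side_square[OF c1(2)] by auto
      have u: "?u c ^ k = ?w ^ (2 * k)" for k by (simp only: w(2)[symmetric] power_mult)
      show "angular_integrand x (\<lambda>z. z ^ n) y c = (if even n then 1 else x + y) * ((1 + c) * ?u c ^ (n div 2))"
      proof (cases "even n")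
        case True
        then obtain k where "n = 2 * k" by (elim evenE)
        then show ?thesis by (simp add: angular_integrand_def even_part_def odd_quotient_def u)
      next
        case False
        then obtain k where "n = 2 * k + 1" by (elim oddE)
        then show ?thesis using w(1) by (simp add: angular_integrand_def even_part_def odd_quotient_def u)
      qed
    qed
  qed (auto intro!: angular_integrand_measurable_angle)
  then show ?thesis by (simp add: angle_power_def)
qed

lemma angle_power_zero: "\<mu> > -1/2 \<Longrightarrow> angle_power \<mu> k x 0 = x ^ (2 * k)"
proof -
  assume mu: "\<mu> > -1/2"
  interpret prob_space "angle_measure \<mu>" by (rule angle_measure_prob_space[OF mu])
  have "(\<integral>c. c \<partial>angle_measure \<mu>) = 0"
    using integral_angle_measure_uminus[of "\<lambda>c. c" \<mu>] by simp
  moreover have "integrable (angle_measure \<mu>) (\<lambda>c. c)"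
    by (intro integrable_angle_measure_continuous[OF mu] continuous_intros)
  ultimately have "(\<integral>c. 1 + c \<partial>angle_measure \<mu>) = 1"
    using prob_space by simp
  then show ?thesis by (simp add: angle_power_def power_mult)
qed

text \<open>
  The Dunkl operator commutes with the translation on monomials.  Here \<open>P\<close> and \<open>R\<close> are the even and
  odd part in \<open>y\<close> of \<open>angle_power\<close>; integration by parts rewrites the reflection term
  \<open>(2 * \<mu> + 1) * R y\<close> as an expectation, after which both sides agree under the integral sign.
\<close>

lemma angle_power_has_dunkl_derivative:
  assumes mu: "\<mu> > -1/2" and n: "n > 0"
  shows "has_dunkl_derivative \<mu>
    (\<lambda>y. (if even n then 1 else x + y) * angle_power \<mu> (n div 2) x y)
    (\<lambda>y. dunkl_weight \<mu> n * ((if even (n - 1) then 1 else x + y) * angle_power \<mu> ((n - 1) div 2) x y))"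
proof -
  define u where "u = (\<lambda>y c. x\<^sup>2 + y\<^sup>2 + 2 * x * y * c)"
  define k where "k = n div 2"
  define E where "E = (\<lambda>f :: real \<Rightarrow> real. \<integral>c. f c \<partial>angle_measure \<mu>)"
  define P where "P = (\<lambda>y. E (\<lambda>c. u y c ^ k))"
  define R where "R = (\<lambda>y. E (\<lambda>c. c * u y c ^ k))"
  define S' where "S' = (\<lambda>y. E (\<lambda>c. (1 + c) * (real k * u y c ^ (k - 1) * (2 * y + 2 * x * c))))"
  have ucont: "continuous_on UNIV (u y)" for y unfolding u_def by (intro continuous_intros)
  have int: "integrable (angle_measure \<mu>) f" if "continuous_on UNIV f" for f :: "real \<Rightarrow> real"
    using that by (rule integrable_angle_measure_continuous[OF mu])
  have Eadd: "a * E f + b * E g = E (\<lambda>c. a * f c + b * g c)"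
    if "continuous_on UNIV f" "continuous_on UNIV g" for a b f g
    unfolding E_def using int[OF that(1)] int[OF that(2)] by simp
  have Ecmult: "a * E f = E (\<lambda>c. a * f c)" for a f
    unfolding E_def by simp
  have S: "angle_power \<mu> k x y = P y + R y" for y
    using Eadd[of "\<lambda>c. u y c ^ k" "\<lambda>c. c * u y c ^ k" 1 1] ucont[of y]
    by (simp add: angle_power_def E_def u_def P_def R_def continuous_intros distrib_right)
  have DS: "((\<lambda>y. angle_power \<mu> k x y) has_real_derivative S' y) (at y)" for y
    unfolding angle_power_def E_def u_def S'_def
    by (rule has_real_derivative_angle_power[OF mu]) (intro continuous_intros)
  have minus: "E (\<lambda>c. f (- c)) = E f" if "continuous_on UNIV f" for f
    unfolding E_def using that by (intro integral_angle_measure_uminus borel_measurable_continuous_onI)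
  have um: "u (- y) (- c) = u y c" for y c by (simp add: u_def)
  have P: "P (- y) = P y" for y
    unfolding P_def using minus[of "\<lambda>c. u (- y) c ^ k"] ucont by (simp add: um continuous_intros)
  have R: "R (- y) = - R y" for y
  proof -
    have "R (- y) = E (\<lambda>c. - c * u y c ^ k)"
      unfolding R_def using minus[of "\<lambda>c. c * u (- y) c ^ k"] ucont by (simp add: um continuous_intros)
    then show ?thesis by (simp add: R_def E_def)
  qed
  have parts: "(2 * \<mu> + 1) * R y = E (\<lambda>c. (1 - c\<^sup>2) * (real k * u y c ^ (k - 1) * (2 * x * y)))" for y
    unfolding E_def R_def
  proof (rule angle_measure_by_parts[OF mu])
    show "((\<lambda>c. u y c ^ k) has_real_derivative real k * u y c ^ (k - 1) * (2 * x * y)) (at c)" for c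
      unfolding u_def by (auto intro!: derivative_eq_intros)
  qed (intro continuous_intros ucont)
  show ?thesis
  proof (cases "even n")
    case True
    then have nk: "n = 2 * k" "even n" "odd (n - 1)" and k1: "(n - 1) div 2 = k - 1" using n by (auto simp: k_def)
    have key: "y * S' y + (2 * \<mu> + 1) * R y = y * (real n * ((x + y) * angle_power \<mu> (k - 1) x y))" for y
    proof -
      have "y * S' y + 1 * ((2 * \<mu> + 1) * R y) = E (\<lambda>c. y * ((1 + c) * (real k * u y c ^ (k - 1) * (2 * y + 2 * x * c)))
          + 1 * ((1 - c\<^sup>2) * (real k * u y c ^ (k - 1) * (2 * x * y))))"
        unfolding parts S'_def by (rule Eadd; intro continuous_intros ucont)
      also have "\<dots> = E (\<lambda>c. (2 * real k * y * (x + y)) * ((1 + c) * u y c ^ (k - 1)))"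
        by (rule arg_cong[of _ _ E], rule ext) (simp add: power2_eq_square algebra_simps)
      also have "\<dots> = (2 * real k * y * (x + y)) * angle_power \<mu> (k - 1) x y"
        unfolding Ecmult[symmetric] by (simp add: angle_power_def E_def u_def)
      finally show ?thesis by (simp add: nk(1))
    qed
    have "has_dunkl_derivative \<mu> (\<lambda>y. angle_power \<mu> k x y) (\<lambda>y. real n * ((x + y) * angle_power \<mu> (k - 1) x y))"
      by (rule has_dunkl_derivativeI[OF DS]) (simp add: S P R key)
    then show ?thesis
      using nk(2,3) by (simp add: dunkl_weight_def k1[unfolded One_nat_def] k_def[symmetric])
  next
    case False
    then have nk: "n = 2 * k + 1" "odd n" "even (n - 1)" and k1: "(n - 1) div 2 = k" by (auto simp: k_def elim: oddE)
    have key: "y * ((x + y) * S' y) + (x - y) * ((2 * \<mu> + 1) * R y) = 2 * real k * y * (P y + R y)" for y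
    proof -
      have "(y * (x + y)) * S' y + (x - y) * ((2 * \<mu> + 1) * R y) = E (\<lambda>c. (y * (x + y)) * ((1 + c) * (real k * u y c ^ (k - 1) * (2 * y + 2 * x * c)))
          + (x - y) * ((1 - c\<^sup>2) * (real k * u y c ^ (k - 1) * (2 * x * y))))"
        unfolding parts S'_def by (rule Eadd; intro continuous_intros ucont)
      also have "\<dots> = E (\<lambda>c. (2 * real k * y) * ((1 + c) * u y c ^ k))"
      proof (rule arg_cong[of _ _ E], rule ext)
        fix c
        have kk: "real k * u y c ^ k = real k * u y c ^ (k - 1) * u y c" by (cases k) auto
        have "(y * (x + y)) * ((1 + c) * (N * (2 * y + 2 * x * c))) + (x - y) * ((1 - c\<^sup>2) * (N * (2 * x * y)))
            = 2 * y * (1 + c) * (N * u y c)" for N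
          by (simp add: u_def power2_eq_square algebra_simps)
        from this[of "real k * u y c ^ (k - 1)"]
        show "(y * (x + y)) * ((1 + c) * (real k * u y c ^ (k - 1) * (2 * y + 2 * x * c)))
            + (x - y) * ((1 - c\<^sup>2) * (real k * u y c ^ (k - 1) * (2 * x * y))) = (2 * real k * y) * ((1 + c) * u y c ^ k)"
          unfolding kk[symmetric] by (simp only: mult_ac)
      qed
      also have "\<dots> = (2 * real k * y) * angle_power \<mu> k x y"
        unfolding Ecmult[symmetric] by (simp add: angle_power_def E_def u_def)
      finally show ?thesis by (simp add: S mult.assoc)
    qed
    have "has_dunkl_derivative \<mu> (\<lambda>y. (x + y) * angle_power \<mu> k x y) (\<lambda>y. (real n + 2 * \<mu> + 1) * angle_power \<mu> k x y)"
    proof (rule has_dunkl_derivativeI)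
      show "((\<lambda>y. (x + y) * angle_power \<mu> k x y) has_real_derivative 1 * angle_power \<mu> k x y + S' y * (x + y)) (at y)" for y
        by (intro DERIV_mult DS) (auto intro!: derivative_eq_intros)
      show "y * (1 * angle_power \<mu> k x y + S' y * (x + y)) + (2 * \<mu> + 1) * (((x + y) * angle_power \<mu> k x y - (x + - y) * angle_power \<mu> k x (- y)) / 2)
        = y * ((real n + 2 * \<mu> + 1) * angle_power \<mu> k x y)" for y
        using key[of y] unfolding S P R nk(1) by (simp add: field_simps)
    qed
    then show ?thesis
      using nk(2,3) by (simp add: dunkl_weight_def k1[unfolded One_nat_def] k_def[symmetric] add.assoc)
  qed
qed

lemma dunkl_power_zero: "dunkl_power \<mu> n 0 = (if n = 0 then 1 else 0)"
  by (cases n) auto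

lemma continuous_dunkl_power: "continuous_on A (dunkl_power \<mu> n)"
  by (induction n) (auto simp: divide_inverse intro!: continuous_intros)

lemma has_dunkl_derivative_dunkl_power:
  assumes mu: "\<mu> > -1/2"
  shows "has_dunkl_derivative \<mu> (dunkl_power \<mu> (Suc n)) (dunkl_power \<mu> n)"
proof -
  obtain a where a: "dunkl_power \<mu> n = (\<lambda>y. a * y ^ n)" using dunkl_power_eq[OF mu] by blast
  have w: "dunkl_weight \<mu> (Suc n) \<noteq> 0" using dunkl_weight_pos[OF mu, of "Suc n"] by simp
  have "dunkl_power \<mu> (Suc n) = (\<lambda>y. (a / dunkl_weight \<mu> (Suc n)) * y ^ Suc n)" "dunkl_power \<mu> n = (\<lambda>y. (a / dunkl_weight \<mu> (Suc n)) * (dunkl_weight \<mu> (Suc n) * y ^ (Suc n - 1)))"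
    using w by (simp_all add: fun_eq_iff a)
  then show ?thesis
    using has_dunkl_derivative_cmult[OF has_dunkl_derivative_power[of \<mu> "Suc n"], of "a / dunkl_weight \<mu> (Suc n)"] by simp
qed

lemma angular_translation_cmult:
  assumes mu: "\<mu> > -1/2" and "locally_bounded_borel g"
  shows "angular_translation \<mu> x (\<lambda>z. a * g z) y = a * angular_translation \<mu> x g y"
  using angular_translation_sum[OF mu, of "{()}" "\<lambda>_. g" x "\<lambda>_. a" y] assms(2) by simp

lemma has_dunkl_derivative_translation_dunkl_power:
  assumes mu: "\<mu> > -1/2" and x: "x \<noteq> 0"
  shows "has_dunkl_derivative \<mu> (angular_translation \<mu> x (dunkl_power \<mu> (Suc n))) (angular_translation \<mu> x (dunkl_power \<mu> n))"
proof -
  obtain a where a: "dunkl_power \<mu> n = (\<lambda>y. a * y ^ n)" using dunkl_power_eq[OF mu] by blast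
  let ?w = "dunkl_weight \<mu> (Suc n)"
  have w: "?w \<noteq> 0" using dunkl_weight_pos[OF mu, of "Suc n"] by simp
  have lb: "locally_bounded_borel (\<lambda>z. z ^ m)" for m
    by (intro continuous_locally_bounded_borel continuous_intros)
  have e: "dunkl_power \<mu> (Suc n) = (\<lambda>y. (a / ?w) * y ^ Suc n)"
    by (simp add: fun_eq_iff a)
  have 1: "angular_translation \<mu> x (dunkl_power \<mu> (Suc n))
     = (\<lambda>y. (a / ?w) * ((if even (Suc n) then 1 else x + y) * angle_power \<mu> (Suc n div 2) x y))"
    unfolding e angular_translation_cmult[OF mu lb] angular_translation_monomial[OF mu x]
    by (rule ext) (simp only: angular_translation_cmult[OF mu lb] angular_translation_monomial[OF mu x])
  have 2: "angular_translation \<mu> x (dunkl_power \<mu> n)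
     = (\<lambda>y. (a / ?w) * (?w * ((if even (Suc n - 1) then 1 else x + y) * angle_power \<mu> ((Suc n - 1) div 2) x y)))"
    unfolding a using w
    by (intro ext) (simp add: angular_translation_cmult[OF mu lb] angular_translation_monomial[OF mu x])
  show ?thesis
    unfolding 1 2 by (intro has_dunkl_derivative_cmult angle_power_has_dunkl_derivative[OF mu]) simp
qed

text \<open>
  The Dunkl binomial formula.  By induction on \<open>n\<close>, both sides have the same Dunkl derivative, and
  they agree at \<open>y = 0\<close>, where the translation evaluates the function at \<open>x\<close>.
\<close>

lemma angular_translation_dunkl_power:
  assumes mu: "\<mu> > -1/2" and x: "x \<noteq> 0"
  shows "angular_translation \<mu> x (dunkl_power \<mu> n) y = (\<Sum>k\<le>n. dunkl_power \<mu> k x * dunkl_power \<mu> (n - k) y)"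
proof (induction n arbitrary: y)
  case 0
  have "dunkl_power \<mu> 0 = (\<lambda>z. z ^ 0)" by (simp add: fun_eq_iff)
  then have "angular_translation \<mu> x (dunkl_power \<mu> 0) y = angle_power \<mu> 0 x y"
    using angular_translation_monomial[OF mu x, of 0 y] by simp
  also have "\<dots> = angle_power \<mu> 0 x 0" by (simp add: angle_power_def)
  finally have "angular_translation \<mu> x (dunkl_power \<mu> 0) y = 1"
    unfolding angle_power_zero[OF mu] power_0 mult_0_right .
  then show ?case by (subst \<open>_ = 1\<close>) simp
next
  case (Suc n)
  define F where "F = (\<lambda>y. angular_translation \<mu> x (dunkl_power \<mu> (Suc n)) y + (-1) * (\<Sum>k\<le>Suc n. dunkl_power \<mu> k x * dunkl_power \<mu> (Suc n - k) y))"
  have "has_dunkl_derivative \<mu> (\<lambda>y. dunkl_power \<mu> k x * dunkl_power \<mu> (Suc n - k) y)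
      (\<lambda>y. if k \<le> n then dunkl_power \<mu> k x * dunkl_power \<mu> (n - k) y else 0)" if "k \<le> Suc n" for k
  proof (cases "k \<le> n")
    case True
    then show ?thesis
      using has_dunkl_derivative_cmult[OF has_dunkl_derivative_dunkl_power[OF mu, of "n - k"]] by (simp add: Suc_diff_le del: dunkl_power.simps(2))
  next
    case False
    then show ?thesis using that has_dunkl_derivative_const by (simp add: not_le le_Suc_eq)
  qed
  then have "has_dunkl_derivative \<mu> (\<lambda>y. \<Sum>k\<le>Suc n. dunkl_power \<mu> k x * dunkl_power \<mu> (Suc n - k) y)
      (\<lambda>y. \<Sum>k\<le>Suc n. if k \<le> n then dunkl_power \<mu> k x * dunkl_power \<mu> (n - k) y else 0)"
    by (intro has_dunkl_derivative_sum) auto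
  moreover have "(\<Sum>k\<le>Suc n. if k \<le> n then dunkl_power \<mu> k x * dunkl_power \<mu> (n - k) y else 0)
      = angular_translation \<mu> x (dunkl_power \<mu> n) y" for y
    unfolding Suc.IH by simp
  ultimately have "has_dunkl_derivative \<mu> F (\<lambda>y. angular_translation \<mu> x (dunkl_power \<mu> n) y + (-1) * angular_translation \<mu> x (dunkl_power \<mu> n) y)"
    unfolding F_def
    by (intro has_dunkl_derivative_add has_dunkl_derivative_cmult has_dunkl_derivative_translation_dunkl_power[OF mu x]) simp
  then have "has_dunkl_derivative \<mu> F (\<lambda>y. 0)" by simp
  moreover have "F 0 = 0"
  proof -
    obtain a where a: "dunkl_power \<mu> (Suc n) = (\<lambda>y. a * y ^ Suc n)" using dunkl_power_eq[OF mu] by blast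
    have lb: "locally_bounded_borel (\<lambda>z. z ^ m)" for m
      by (intro continuous_locally_bounded_borel continuous_intros)
    have "angular_translation \<mu> x (dunkl_power \<mu> (Suc n)) 0 = a * x ^ Suc n"
      unfolding a angular_translation_cmult[OF mu lb] angular_translation_monomial[OF mu x] angle_power_zero[OF mu]
      by (cases "even n") (auto elim!: evenE oddE)
    also have "\<dots> = dunkl_power \<mu> (Suc n) x" by (simp only: a)
    finally have 1: "angular_translation \<mu> x (dunkl_power \<mu> (Suc n)) 0 = dunkl_power \<mu> (Suc n) x" .
    have "(\<Sum>k\<le>Suc n. dunkl_power \<mu> k x * dunkl_power \<mu> (Suc n - k) 0) = (\<Sum>k\<le>Suc n. if k = Suc n then dunkl_power \<mu> k x else 0)"
      by (rule sum.cong) (auto simp: dunkl_power_zero simp del: dunkl_power.simps)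
    also have "\<dots> = dunkl_power \<mu> (Suc n) x" by (simp del: dunkl_power.simps)
    finally show ?thesis unfolding F_def 1 by simp
  qed
  ultimately have "F y = 0" by (rule has_dunkl_derivative_unique[OF mu])
  then show ?case by (simp add: F_def del: dunkl_power.simps)
qed

section \<open>Translations commute\<close>

text \<open>
  Applying the binomial formula twice gives a trinomial formula, which is symmetric in the two shifts.
\<close>

lemma angular_translation_commute_polynomial:
  assumes mu: "\<mu> > -1/2" and x: "x \<noteq> 0" "x' \<noteq> 0" and p: "real_polynomial_function p"
  shows "angular_translation \<mu> x (angular_translation \<mu> x' p) y = angular_translation \<mu> x' (angular_translation \<mu> x p) y"
proof -
  have lb: "locally_bounded_borel (dunkl_power \<mu> m)" for m
    by (intro continuous_locally_bounded_borel continuous_dunkl_power)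
  obtain b N where "p = (\<lambda>z. \<Sum>i\<le>N. b i * z ^ i)"
    using p unfolding real_polynomial_function_iff_sum by blast
  moreover have "\<exists>d. \<forall>z. z ^ i = d * dunkl_power \<mu> i z" for i
    using dunkl_power_eq[OF mu, of i] by (metis mult.assoc mult_1 nonzero_eq_divide_eq divide_self_if times_divide_eq_left)
  then obtain d where "\<And>i z. z ^ i = d i * dunkl_power \<mu> i z" by metis
  ultimately have p: "p = (\<lambda>z. \<Sum>i\<le>N. (b i * d i) * dunkl_power \<mu> i z)"
    by (simp add: mult.assoc)
  have once: "angular_translation \<mu> t p = (\<lambda>z. \<Sum>i\<le>N. (b i * d i) * (\<Sum>k\<le>i. dunkl_power \<mu> k t * dunkl_power \<mu> (i - k) z))" if "t \<noteq> 0" for t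
    unfolding p by (rule ext) (simp only: angular_translation_sum[OF mu lb] angular_translation_dunkl_power[OF mu that])
  have lb2: "locally_bounded_borel (\<lambda>z. \<Sum>k\<le>i. dunkl_power \<mu> k t * dunkl_power \<mu> (i - k) z)" for i t
    by (intro continuous_locally_bounded_borel continuous_intros continuous_dunkl_power)
  have twice: "angular_translation \<mu> s (angular_translation \<mu> t p) y
     = (\<Sum>i\<le>N. (b i * d i) * (\<Sum>k\<le>i. dunkl_power \<mu> k t * (\<Sum>j\<le>i - k. dunkl_power \<mu> j s * dunkl_power \<mu> (i - k - j) y)))"
    if "s \<noteq> 0" "t \<noteq> 0" for s t
    unfolding once[OF that(2)] by (simp only: angular_translation_sum[OF mu lb2] angular_translation_sum[OF mu lb] angular_translation_dunkl_power[OF mu that(1)])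
  have swap: "(\<Sum>k\<le>i. f k * (\<Sum>j\<le>i - k. g j * h (i - k - j))) = (\<Sum>j\<le>i. g j * (\<Sum>k\<le>i - j. f k * h (i - j - k)))"
    for i :: nat and f g h :: "nat \<Rightarrow> real"
  proof -
    have "(\<Sum>k\<le>i. f k * (\<Sum>j\<le>i - k. g j * h (i - k - j))) = (\<Sum>(k, j)\<in>(SIGMA k:{..i}. {..i - k}). f k * (g j * h (i - k - j)))"
      by (simp add: sum_distrib_left sum.Sigma)
    also have "\<dots> = (\<Sum>(j, k)\<in>(SIGMA j:{..i}. {..i - j}). g j * (f k * h (i - j - k)))"
      by (rule sum.reindex_bij_witness[of _ "\<lambda>(a, b). (b, a)" "\<lambda>(a, b). (b, a)"]) (auto simp: add.commute)
    also have "\<dots> = (\<Sum>j\<le>i. g j * (\<Sum>k\<le>i - j. f k * h (i - j - k)))"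
      by (simp add: sum_distrib_left sum.Sigma)
    finally show ?thesis .
  qed
  show ?thesis
    unfolding twice[OF x] twice[OF x(2,1)] by (rule sum.cong[OF refl]) (subst swap, simp)
qed

text \<open>
  At a given point only the values of \<open>g\<close> on a compact interval matter, and each translation
  amplifies uniform errors by at most 4.  Hence the polynomial case and the Weierstrass theorem suffice.
\<close>

lemma angular_translation_commute:
  assumes mu: "\<mu> > -1/2" and x: "x \<noteq> 0" "x' \<noteq> 0" and g: "continuous_on UNIV g"
  shows "angular_translation \<mu> x (angular_translation \<mu> x' g) y = angular_translation \<mu> x' (angular_translation \<mu> x g) y"
proof -
  let ?T = "angular_translation \<mu>"
  define R where "R = \<bar>x\<bar> + \<bar>x'\<bar> + \<bar>y\<bar>"
  have lg: "locally_bounded_borel g" by (rule continuous_locally_bounded_borel[OF g])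
  have bound: "\<bar>?T s (?T t g) y - ?T s (?T t p) y\<bar> \<le> 16 * e"
    if p: "real_polynomial_function p" and e: "\<And>z. z \<in> {-R..R} \<Longrightarrow> \<bar>g z - p z\<bar> < e" and st: "\<bar>s\<bar> + \<bar>t\<bar> + \<bar>y\<bar> = R"
    for p e s t
  proof -
    have lp: "locally_bounded_borel p"
      by (intro continuous_locally_bounded_borel continuous_on_polymonial_function p[unfolded real_polynomial_function_eq])
    have gp: "(\<lambda>z. g z - p z) \<in> borel_measurable borel"
      using locally_bounded_borelD(1)[OF lg] locally_bounded_borelD(1)[OF lp] by simp
    have in1: "\<bar>?T t g z - ?T t p z\<bar> \<le> 4 * e" if "\<bar>z\<bar> \<le> \<bar>s\<bar> + \<bar>y\<bar>" for z
    proof -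
      have "\<bar>?T t (\<lambda>z. g z - p z) z\<bar> \<le> 4 * e"
      proof (rule angular_translation_bound[OF mu gp])
        fix v assume "\<bar>v\<bar> \<le> \<bar>t\<bar> + \<bar>z\<bar>"
        then have "\<bar>v\<bar> \<le> R" using that st by linarith
        then have "v \<in> {-R..R}" by (simp add: abs_le_iff)
        then show "\<bar>g v - p v\<bar> \<le> e" using e by (simp add: less_imp_le)
      qed
      then show ?thesis by (simp only: angular_translation_diff[OF mu lg lp])
    qed
    have lTg: "locally_bounded_borel (?T t g)" and lTp: "locally_bounded_borel (?T t p)"
      by (rule angular_translation_locally_bounded[OF mu lg], rule angular_translation_locally_bounded[OF mu lp])
    have "\<bar>?T s (\<lambda>z. ?T t g z - ?T t p z) y\<bar> \<le> 4 * (4 * e)"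
      using locally_bounded_borelD(1)[OF lTg] locally_bounded_borelD(1)[OF lTp] in1
      by (intro angular_translation_bound[OF mu]) auto
    then show ?thesis by (simp add: angular_translation_diff[OF mu lTg lTp])
  qed
  have "\<bar>?T x (?T x' g) y - ?T x' (?T x g) y\<bar> \<le> 0 + e" if "e > 0" for e
  proof -
    \<comment> \<open>Two translations amplify an error by 16, and two terms are replaced: 32 = 2 * 16.\<close>
    obtain p where p: "real_polynomial_function p" "\<And>z. z \<in> {-R..R} \<Longrightarrow> \<bar>g z - p z\<bar> < e / 32"
      using Stone_Weierstrass_real_polynomial_function[of "{-R..R}" g "e / 32"] continuous_on_subset[OF g] \<open>e > 0\<close> by auto
    have "\<bar>?T x (?T x' g) y - ?T x (?T x' p) y\<bar> \<le> 16 * (e / 32)" "\<bar>?T x' (?T x g) y - ?T x' (?T x p) y\<bar> \<le> 16 * (e / 32)"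
      by (rule bound[OF p]; simp add: R_def)+
    then show ?thesis
      using angular_translation_commute_polynomial[OF mu x p(1), of y] by linarith
  qed
  then have "\<bar>?T x (?T x' g) y - ?T x' (?T x g) y\<bar> \<le> 0" by (rule field_le_epsilon)
  then show ?thesis by simp
qed

section \<open>Adjoints\<close>

text \<open>
  The kernel depends on the sides of the triangle symmetrically, through its area and their product.
\<close>

lemma dunkl_k_commute: "dunkl_k \<mu> r s w = dunkl_k \<mu> r w s"
proof -
  have "(((r + s)\<^sup>2 - w\<^sup>2) * (w\<^sup>2 - (r - s)\<^sup>2)) = (((r + w)\<^sup>2 - s\<^sup>2) * (s\<^sup>2 - (r - w)\<^sup>2))"
    "(\<bar>r - s\<bar> < w \<and> w < r + s) = (\<bar>r - w\<bar> < s \<and> s < r + w)" "r * s * w = r * w * s"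
    by (simp add: power2_eq_square algebra_simps, auto)
  then show ?thesis by (simp only: dunkl_k_def)
qed

lemma dunkl_W_adjoint:
  "dunkl_W \<mu> x y z = dunkl_W \<mu> (- x) z y"
proof -
  have s: "dunkl_sigma (- x) z y = - dunkl_sigma z x y" "dunkl_sigma y (- x) z = - dunkl_sigma x y z"
    "dunkl_sigma y z (- x) = dunkl_sigma z y x"
    by (simp_all add: dunkl_sigma_def mult.commute mult.left_commute add.commute)
  have "1 - dunkl_sigma x y z + dunkl_sigma z x y + dunkl_sigma z y x = 1 - dunkl_sigma (- x) z y + dunkl_sigma y (- x) z + dunkl_sigma y z (- x)"
    unfolding s by simp
  moreover have "dunkl_k \<mu> \<bar>x\<bar> \<bar>y\<bar> \<bar>z\<bar> = dunkl_k \<mu> \<bar>- x\<bar> \<bar>z\<bar> \<bar>y\<bar>"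
    by (simp only: dunkl_k_commute[of \<mu> "\<bar>x\<bar>" "\<bar>y\<bar>"] abs_minus_cancel)
  ultimately show ?thesis by (simp only: dunkl_W_def)
qed

lemma AE_dunkl_borel_nonzero: "AE y in dunkl_borel \<mu>. y \<noteq> 0"
  unfolding dunkl_borel_def by (subst AE_density) auto

lemma sigma_finite_dunkl_borel: "sigma_finite_measure (dunkl_borel \<mu>)"
  unfolding dunkl_borel_def
  by (subst sigma_finite_measure.sigma_finite_iff_density_finite[OF sigma_finite_lborel]) auto

lemma integrable_dunkl_borel_compact:
  fixes h :: "real \<Rightarrow> real"
  assumes mu: "\<mu> > -1/2" and [measurable]: "h \<in> borel_measurable borel"
    and B: "\<And>y. \<bar>h y\<bar> \<le> B" and R: "\<And>y. \<bar>y\<bar> > R \<Longrightarrow> h y = 0"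
  shows "integrable (dunkl_borel \<mu>) h"
proof -
  have "integrable lborel (\<lambda>y. indicator {-R..R} y *\<^sub>R (\<bar>R\<bar> powr (2 * \<mu> + 1) * B))"
    by (rule integrable_real_indicator[THEN integrable_scaleR_left]) (auto simp: emeasure_lborel_Icc_eq)
  then have "integrable lborel (\<lambda>y. \<bar>y\<bar> powr (2 * \<mu> + 1) *\<^sub>R h y)"
  proof (rule Bochner_Integration.integrable_bound)
    show "AE y in lborel. norm (\<bar>y\<bar> powr (2 * \<mu> + 1) *\<^sub>R h y) \<le> norm (indicator {-R..R} y *\<^sub>R (\<bar>R\<bar> powr (2 * \<mu> + 1) * B))"
    proof (rule AE_I2)
      fix y
      have "B \<ge> 0" using B[of 0] by auto
      show "norm (\<bar>y\<bar> powr (2 * \<mu> + 1) *\<^sub>R h y) \<le> norm (indicator {-R..R} y *\<^sub>R (\<bar>R\<bar> powr (2 * \<mu> + 1) * B))"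
      proof (cases "\<bar>y\<bar> > R")
        case False
        then have "\<bar>y\<bar> powr (2 * \<mu> + 1) * \<bar>h y\<bar> \<le> \<bar>R\<bar> powr (2 * \<mu> + 1) * B"
          using mu B by (intro mult_mono powr_mono2) auto
        then show ?thesis using False \<open>B \<ge> 0\<close> by (auto simp: abs_mult indicator_def)
      qed (use R in simp)
    qed
  qed simp
  then show ?thesis
    unfolding dunkl_borel_def by (subst integrable_density) auto
qed

lemma angular_translation_support:
  assumes "\<And>z. \<bar>z\<bar> > R \<Longrightarrow> g z = 0" and "\<bar>y\<bar> > R + \<bar>x\<bar>"
  shows "angular_translation \<mu> x g y = 0"
proof -
  show ?thesis
    unfolding angular_translation_def
  proof (rule integral_eq_zero_AE)
    show "AE c in angle_measure \<mu>. angular_integrand x g y c = 0"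
      using AE_angle_measure
    proof (rule eventually_mono)
      fix c assume "c \<in> {-1<..<1::real}"
      then have c: "\<bar>c\<bar> \<le> 1" by auto
      have "\<bar>x * c\<bar> \<le> \<bar>x\<bar>" using c by (simp add: abs_mult mult_left_le)
      then have "R < \<bar>y + x * c\<bar>" using assms(2) by linarith
      then have "\<bar>third_side x y c\<bar> > R" using third_side_ge(1)[OF c, of y x] by linarith
      then show "angular_integrand x g y c = 0"
        using assms(1) by (simp add: angular_integrand_def even_part_def odd_quotient_def)
    qed
  qed
qed

text \<open>
  Fubini's theorem and the symmetry of the kernel; compact support of \<open>h\<close> provides absolute convergence.
\<close>

lemma angular_translation_adjoint:
  assumes mu: "\<mu> > -1/2" and x: "x \<noteq> 0" and f: "locally_bounded_borel f" and h: "locally_bounded_borel h"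
    and R: "\<And>z. \<bar>z\<bar> > R \<Longrightarrow> h z = 0"
  shows "(\<integral>y. angular_translation \<mu> x f y * h y \<partial>dunkl_borel \<mu>) = (\<integral>z. f z * angular_translation \<mu> (- x) h z \<partial>dunkl_borel \<mu>)"
proof -
  interpret sf: sigma_finite_measure "dunkl_borel \<mu>" by (rule sigma_finite_dunkl_borel)
  interpret pair_sigma_finite "dunkl_borel \<mu>" "dunkl_borel \<mu>" ..
  note [measurable] = locally_bounded_borelD(1)[OF f] locally_bounded_borelD(1)[OF h]
    angular_translation_measurable[OF mu locally_bounded_borelD(1)[OF f]]
    angular_translation_measurable[OF mu locally_bounded_borelD(1)[OF h]]
  obtain Bf where Bf: "\<forall>z. \<bar>z\<bar> \<le> \<bar>x\<bar> + R \<longrightarrow> \<bar>f z\<bar> \<le> Bf" using locally_bounded_borelD(2)[OF f] by blast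
  obtain Bh0 where Bh0: "\<forall>z. \<bar>z\<bar> \<le> R \<longrightarrow> \<bar>h z\<bar> \<le> Bh0" using locally_bounded_borelD(2)[OF h] by blast
  define Bh where "Bh = max 0 Bh0"
  have Bh: "\<bar>h z\<bar> \<le> Bh" for z
    using Bh0 R[of z] by (cases "\<bar>z\<bar> \<le> R") (auto simp: Bh_def max_def)
  let ?F = "\<lambda>y z. f z * dunkl_W \<mu> x y z * h y"
  have in_z: "integrable (dunkl_borel \<mu>) (\<lambda>z. f z * dunkl_W \<mu> x y z)" and out: "(\<integral>z. f z * dunkl_W \<mu> x y z \<partial>dunkl_borel \<mu>) = angular_translation \<mu> x f y"
    if "y \<noteq> 0" for y
  proof -
    obtain B where "\<forall>z. \<bar>z\<bar> \<le> \<bar>x\<bar> + \<bar>y\<bar> \<longrightarrow> \<bar>f z\<bar> \<le> B" using locally_bounded_borelD(2)[OF f] by blast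
    then show "integrable (dunkl_borel \<mu>) (\<lambda>z. f z * dunkl_W \<mu> x y z)" "(\<integral>z. f z * dunkl_W \<mu> x y z \<partial>dunkl_borel \<mu>) = angular_translation \<mu> x f y"
      using integral_dunkl_W[OF mu x that locally_bounded_borelD(1)[OF f], of B] by auto
  qed
  have int: "integrable (dunkl_borel \<mu> \<Otimes>\<^sub>M dunkl_borel \<mu>) (\<lambda>(y, z). ?F y z)"
  proof (rule Fubini_integrable)
    show "AE y in dunkl_borel \<mu>. integrable (dunkl_borel \<mu>) (\<lambda>z. case (y, z) of (y, z) \<Rightarrow> ?F y z)"
      using AE_dunkl_borel_nonzero by (rule eventually_mono) (use in_z in auto)
    have m: "(\<lambda>y. \<integral>z. norm (?F y z) \<partial>dunkl_borel \<mu>) \<in> borel_measurable borel"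
      by measurable
    have "integrable (dunkl_borel \<mu>) (\<lambda>y. indicator {-R..R} y * (8 * Bf * Bh))"
      by (rule integrable_dunkl_borel_compact[OF mu, where B = "\<bar>8 * Bf * Bh\<bar>" and R = R]) (auto simp: indicator_def)
    then show "integrable (dunkl_borel \<mu>) (\<lambda>y. \<integral>z. norm (case (y, z) of (y, z) \<Rightarrow> ?F y z) \<partial>dunkl_borel \<mu>)"
    proof (rule Bochner_Integration.integrable_bound)
      show "AE y in dunkl_borel \<mu>. norm (\<integral>z. norm (case (y, z) of (y, z) \<Rightarrow> ?F y z) \<partial>dunkl_borel \<mu>) \<le> norm (indicator {-R..R} y * (8 * Bf * Bh))"
        using AE_dunkl_borel_nonzero
      proof (rule eventually_mono)
        fix y :: real assume y: "y \<noteq> 0"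
        show "norm (\<integral>z. norm (case (y, z) of (y, z) \<Rightarrow> ?F y z) \<partial>dunkl_borel \<mu>) \<le> norm (indicator {-R..R} y * (8 * Bf * Bh))"
        proof (cases "\<bar>y\<bar> \<le> R")
          case True
          have Bf': "\<bar>f z\<bar> \<le> Bf" if "\<bar>z\<bar> \<le> \<bar>x\<bar> + \<bar>y\<bar>" for z using Bf that True by auto
          have b: "(\<integral>z. \<bar>f z * dunkl_W \<mu> x y z\<bar> \<partial>dunkl_borel \<mu>) \<le> 8 * Bf"
            by (rule integral_dunkl_W(3)[OF mu x y _ Bf']) simp_all
          have "(\<integral>z. norm (?F y z) \<partial>dunkl_borel \<mu>) = (\<integral>z. \<bar>f z * dunkl_W \<mu> x y z\<bar> \<partial>dunkl_borel \<mu>) * \<bar>h y\<bar>"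
            by (simp add: abs_mult)
          also have "\<dots> \<le> 8 * Bf * Bh"
            using b Bh[of y] Bf'[of 0] by (intro mult_mono) auto
          finally show ?thesis using True by (simp add: indicator_def abs_le_iff)
        qed (use R in simp)
      qed
    qed (use m in simp)
  qed simp
  have "(\<integral>y. angular_translation \<mu> x f y * h y \<partial>dunkl_borel \<mu>) = (\<integral>y. (\<integral>z. ?F y z \<partial>dunkl_borel \<mu>) \<partial>dunkl_borel \<mu>)"
    by (rule Bochner_Integration.integral_cong_AE) (auto intro: eventually_mono[OF AE_dunkl_borel_nonzero] simp: out)
  also have "\<dots> = (\<integral>z. (\<integral>y. ?F y z \<partial>dunkl_borel \<mu>) \<partial>dunkl_borel \<mu>)"
    using Fubini_integral[OF int] by simp
  also have "\<dots> = (\<integral>z. f z * angular_translation \<mu> (- x) h z \<partial>dunkl_borel \<mu>)"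
  proof (rule Bochner_Integration.integral_cong_AE)
    show "AE z in dunkl_borel \<mu>. (\<integral>y. ?F y z \<partial>dunkl_borel \<mu>) = f z * angular_translation \<mu> (- x) h z"
      using AE_dunkl_borel_nonzero
    proof (rule eventually_mono)
      fix z :: real assume z: "z \<noteq> 0"
      have "(\<lambda>y. ?F y z) = (\<lambda>y. f z * (h y * dunkl_W \<mu> (- x) z y))"
        by (rule ext) (simp add: dunkl_W_adjoint[of \<mu> x _ z])
      moreover have "(\<integral>y. h y * dunkl_W \<mu> (- x) z y \<partial>dunkl_borel \<mu>) = angular_translation \<mu> (- x) h z"
        using x by (intro integral_dunkl_W(2)[OF mu _ z _ Bh]) auto
      ultimately show "(\<integral>y. ?F y z \<partial>dunkl_borel \<mu>) = f z * angular_translation \<mu> (- x) h z" by simp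
    qed
  qed auto
  finally show ?thesis .
qed

section \<open>Contraction on continuous functions\<close>

lemma nn_integral_dunkl_borel_uminus:
  assumes [measurable]: "F \<in> borel_measurable borel"
  shows "(\<integral>\<^sup>+y. F (- y) \<partial>dunkl_borel \<mu>) = (\<integral>\<^sup>+y. F y \<partial>dunkl_borel \<mu>)"
proof -
  have "(\<integral>\<^sup>+y. F y \<partial>dunkl_borel \<mu>) = (\<integral>\<^sup>+y. ennreal (\<bar>y\<bar> powr (2 * \<mu> + 1)) * F y \<partial>lborel)"
    unfolding dunkl_borel_def by (subst nn_integral_density) auto
  also have "\<dots> = (\<integral>\<^sup>+y. ennreal (\<bar>y\<bar> powr (2 * \<mu> + 1)) * F (- y) \<partial>lborel)"
    by (subst nn_integral_real_affine[of _ "-1" 0]) auto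
  also have "\<dots> = (\<integral>\<^sup>+y. F (- y) \<partial>dunkl_borel \<mu>)"
    unfolding dunkl_borel_def by (subst nn_integral_density) auto
  finally show ?thesis ..
qed

text \<open>
  The Schur-type argument: for fixed \<open>z\<close> the kernel is, by symmetry, also of total mass 2 in \<open>y\<close>.
\<close>

lemma nn_integral_third_side_average:
  assumes mu: "\<mu> > -1/2" and x: "x \<noteq> 0" and F [measurable]: "F \<in> borel_measurable borel"
  shows "(\<integral>\<^sup>+y. \<integral>\<^sup>+c. F (third_side x y c) + F (- third_side x y c) \<partial>angle_measure \<mu> \<partial>dunkl_borel \<mu>)
    = 2 * (\<integral>\<^sup>+z. F z \<partial>dunkl_borel \<mu>)"
proof -
  interpret sf: sigma_finite_measure "dunkl_borel \<mu>" by (rule sigma_finite_dunkl_borel)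
  interpret pair_sigma_finite "dunkl_borel \<mu>" "dunkl_borel \<mu>" ..
  interpret prob_space "angle_measure \<mu>" by (rule angle_measure_prob_space[OF mu])
  have mass: "(\<integral>\<^sup>+y. ennreal (dunkl_k \<mu> \<bar>x\<bar> \<bar>y\<bar> \<bar>z\<bar>) \<partial>dunkl_borel \<mu>) = 2" if "z \<noteq> 0" for z
    using nn_integral_dunkl_k[OF mu x that, of "\<lambda>_. 1"] emeasure_space_1
    by (simp add: dunkl_k_commute[of \<mu> "\<bar>x\<bar>" _ "\<bar>z\<bar>"])
  have "(\<integral>\<^sup>+y. \<integral>\<^sup>+c. F (third_side x y c) + F (- third_side x y c) \<partial>angle_measure \<mu> \<partial>dunkl_borel \<mu>)
    = (\<integral>\<^sup>+y. \<integral>\<^sup>+z. F z * ennreal (dunkl_k \<mu> \<bar>x\<bar> \<bar>y\<bar> \<bar>z\<bar>) \<partial>dunkl_borel \<mu> \<partial>dunkl_borel \<mu>)"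
    by (rule nn_integral_cong_AE, rule eventually_mono[OF AE_dunkl_borel_nonzero])
      (rule nn_integral_dunkl_k[OF mu x _ F, symmetric])
  also have "\<dots> = (\<integral>\<^sup>+z. \<integral>\<^sup>+y. F z * ennreal (dunkl_k \<mu> \<bar>x\<bar> \<bar>y\<bar> \<bar>z\<bar>) \<partial>dunkl_borel \<mu> \<partial>dunkl_borel \<mu>)"
    by (rule Fubini'[symmetric]) measurable
  also have "\<dots> = (\<integral>\<^sup>+z. 2 * F z \<partial>dunkl_borel \<mu>)"
    by (rule nn_integral_cong_AE, rule eventually_mono[OF AE_dunkl_borel_nonzero])
      (simp add: nn_integral_cmult mass mult.commute)
  also have "\<dots> = 2 * (\<integral>\<^sup>+z. F z \<partial>dunkl_borel \<mu>)"
    by (rule nn_integral_cmult) simp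
  finally show ?thesis .
qed

text \<open>
  Adjointness and commutativity give
  $\|T_x g\|^2 = \langle g, T_{-x} T_x g\rangle = \langle g, T_x T_{-x} g\rangle = \|T_{-x} g\|^2$.
  Integrating the inequality for the four reflections bounds \<open>2 * (N x + N (- x)) = 4 * N x\<close> by
  four times the squared norm of \<open>g\<close>.  Normality is essential for the constant 1: the reflections alone only
  control the sum of the two squared norms.
\<close>

lemma angular_translation_contraction:
  assumes mu: "\<mu> > -1/2" and x: "x \<noteq> 0" and g: "continuous_on UNIV g" and R: "\<And>z. \<bar>z\<bar> > R \<Longrightarrow> g z = 0"
  shows "(\<integral>\<^sup>+y. ennreal ((angular_translation \<mu> x g y)\<^sup>2) \<partial>dunkl_borel \<mu>) \<le> (\<integral>\<^sup>+y. ennreal ((g y)\<^sup>2) \<partial>dunkl_borel \<mu>)"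
proof -
  interpret prob_space "angle_measure \<mu>" by (rule angle_measure_prob_space[OF mu])
  let ?T = "angular_translation \<mu>"
  have lg: "locally_bounded_borel g" by (rule continuous_locally_bounded_borel[OF g])
  note gm [measurable] = locally_bounded_borelD(1)[OF lg]
  have lT: "locally_bounded_borel (?T s g)" for s
    by (rule angular_translation_locally_bounded[OF mu lg])
  note Tm [measurable] = locally_bounded_borelD(1)[OF lT]
  have supp: "?T s g y = 0" if "\<bar>y\<bar> > R + \<bar>s\<bar>" for s y
    using R that by (rule angular_translation_support)
  have int2: "integrable (dunkl_borel \<mu>) (\<lambda>y. (?T s g y)\<^sup>2)" for s
  proof -
    obtain B where B: "\<forall>z. \<bar>z\<bar> \<le> R + \<bar>s\<bar> \<longrightarrow> \<bar>?T s g z\<bar> \<le> B" using locally_bounded_borelD(2)[OF lT] by blast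
    have "\<bar>(?T s g z)\<^sup>2\<bar> \<le> B\<^sup>2" for z
    proof (cases "\<bar>z\<bar> \<le> R + \<bar>s\<bar>")
      case True
      then have "\<bar>?T s g z\<bar>\<^sup>2 \<le> B\<^sup>2" using B by (intro power_mono) auto
      then show ?thesis by simp
    qed (simp add: supp)
    then show ?thesis by (rule integrable_dunkl_borel_compact[OF mu, rotated, where R = "R + \<bar>s\<bar>"]) (simp_all add: supp)
  qed
  define N where "N = (\<lambda>s. \<integral>\<^sup>+y. ennreal ((?T s g y)\<^sup>2) \<partial>dunkl_borel \<mu>)"
  have N: "N s = ennreal (\<integral>y. (?T s g y)\<^sup>2 \<partial>dunkl_borel \<mu>)" for s
    unfolding N_def by (rule nn_integral_eq_integral[OF int2]) simp
  have adj: "(\<integral>y. (?T s g y)\<^sup>2 \<partial>dunkl_borel \<mu>) = (\<integral>z. g z * ?T (- s) (?T s g) z \<partial>dunkl_borel \<mu>)" if "s \<noteq> 0" for s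
    unfolding power2_eq_square by (rule angular_translation_adjoint[OF mu that lg lT supp])
  have same: "N (- x) = N x"
    unfolding N using adj[of x] adj[of "- x"] x angular_translation_commute[OF mu, of x "- x" g] g by simp
  have four: "ennreal ((?T x g y)\<^sup>2) + ennreal ((?T (- x) g y)\<^sup>2) + ennreal ((?T x g (- y))\<^sup>2) + ennreal ((?T (- x) g (- y))\<^sup>2)
      \<le> 2 * (\<integral>\<^sup>+c. ennreal ((g (third_side x y c))\<^sup>2) + ennreal ((g (- third_side x y c))\<^sup>2) \<partial>angle_measure \<mu>)" for y
  proof -
    obtain B where B: "\<And>z. \<bar>z\<bar> \<le> \<bar>x\<bar> + \<bar>y\<bar> \<Longrightarrow> \<bar>g z\<bar> \<le> B" using locally_bounded_borelD(2)[OF lg] by blast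
    have sq: "(g z)\<^sup>2 \<le> B\<^sup>2" if "\<bar>z\<bar> \<le> \<bar>x\<bar> + \<bar>y\<bar>" for z
      using power_mono[OF B[OF that], of 2] by simp
    have i: "integrable (angle_measure \<mu>) (\<lambda>c. (g (third_side x y c))\<^sup>2 + (g (- third_side x y c))\<^sup>2)"
    proof (rule integrable_angle_measure[OF mu, where B = "B\<^sup>2 + B\<^sup>2"])
      fix c assume c: "c \<in> {-1<..<1::real}"
      show "\<bar>(g (third_side x y c))\<^sup>2 + (g (- third_side x y c))\<^sup>2\<bar> \<le> B\<^sup>2 + B\<^sup>2"
        using sq[OF third_side_in_ball(1)[OF c]] sq[OF third_side_in_ball(2)[OF c]] by simp
    qed simp
    have "ennreal ((?T x g y)\<^sup>2) + ennreal ((?T (- x) g y)\<^sup>2) + ennreal ((?T x g (- y))\<^sup>2) + ennreal ((?T (- x) g (- y))\<^sup>2)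
      = ennreal ((?T x g y)\<^sup>2 + (?T (- x) g y)\<^sup>2 + (?T x g (- y))\<^sup>2 + (?T (- x) g (- y))\<^sup>2)"
      by simp
    also have "\<dots> \<le> ennreal (2 * (\<integral>c. (g (third_side x y c))\<^sup>2 + (g (- third_side x y c))\<^sup>2 \<partial>angle_measure \<mu>))"
      by (rule ennreal_leI[OF angular_translation_four_reflections[OF mu x lg]])
    also have "\<dots> = 2 * ennreal (\<integral>c. (g (third_side x y c))\<^sup>2 + (g (- third_side x y c))\<^sup>2 \<partial>angle_measure \<mu>)"
      by (subst ennreal_mult') simp_all
    also have "ennreal (\<integral>c. (g (third_side x y c))\<^sup>2 + (g (- third_side x y c))\<^sup>2 \<partial>angle_measure \<mu>)
      = (\<integral>\<^sup>+c. ennreal ((g (third_side x y c))\<^sup>2 + (g (- third_side x y c))\<^sup>2) \<partial>angle_measure \<mu>)"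
      by (rule nn_integral_eq_integral[symmetric, OF i]) simp
    finally show ?thesis by (simp cong: nn_integral_cong)
  qed
  have "4 * N x = N x + N (- x) + N x + N (- x)"
  proof -
    have "(4 :: ennreal) = 1 + 1 + 1 + 1" by simp
    then show ?thesis unfolding same by (simp only: distrib_right mult_1)
  qed
  also have "\<dots> = (\<integral>\<^sup>+y. ennreal ((?T x g y)\<^sup>2) + ennreal ((?T (- x) g y)\<^sup>2) + ennreal ((?T x g (- y))\<^sup>2) + ennreal ((?T (- x) g (- y))\<^sup>2) \<partial>dunkl_borel \<mu>)"
    using nn_integral_dunkl_borel_uminus[of "\<lambda>y. ennreal ((?T x g y)\<^sup>2)" \<mu>] nn_integral_dunkl_borel_uminus[of "\<lambda>y. ennreal ((?T (- x) g y)\<^sup>2)" \<mu>]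
    by (simp add: nn_integral_add N_def)
  also have "\<dots> \<le> (\<integral>\<^sup>+y. 2 * (\<integral>\<^sup>+c. ennreal ((g (third_side x y c))\<^sup>2) + ennreal ((g (- third_side x y c))\<^sup>2) \<partial>angle_measure \<mu>) \<partial>dunkl_borel \<mu>)"
    by (intro nn_integral_mono four)
  also have "\<dots> = 2 * (\<integral>\<^sup>+y. (\<integral>\<^sup>+c. ennreal ((g (third_side x y c))\<^sup>2) + ennreal ((g (- third_side x y c))\<^sup>2) \<partial>angle_measure \<mu>) \<partial>dunkl_borel \<mu>)"
    by (rule nn_integral_cmult) measurable
  also have "\<dots> = 2 * (2 * (\<integral>\<^sup>+z. ennreal ((g z)\<^sup>2) \<partial>dunkl_borel \<mu>))"
    by (subst nn_integral_third_side_average[OF mu x]) simp_all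
  also have "\<dots> = 4 * (\<integral>\<^sup>+z. ennreal ((g z)\<^sup>2) \<partial>dunkl_borel \<mu>)"
    by (simp flip: mult.assoc)
  finally show ?thesis
    by (simp add: N_def ennreal_mult_le_mult_iff)
qed

section \<open>Extension to square-integrable functions\<close>

text \<open>
  The translation of real Borel functions.  Where the integral diverges its value is 0, as for
  \<open>dunkl_translation\<close>, which is harmless for upper bounds.
\<close>

definition kernel_translation :: "real \<Rightarrow> real \<Rightarrow> (real \<Rightarrow> real) \<Rightarrow> real \<Rightarrow> real" where
  "kernel_translation \<mu> x g y = (\<integral>z. g z * dunkl_W \<mu> x y z \<partial>dunkl_borel \<mu>)"

lemma kernel_translation_measurable:
  assumes [measurable]: "g \<in> borel_measurable borel"
  shows "kernel_translation \<mu> x g \<in> borel_measurable borel"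
proof -
  interpret sigma_finite_measure "dunkl_borel \<mu>" by (rule sigma_finite_dunkl_borel)
  have "(\<lambda>(y, z). g z * dunkl_W \<mu> x y z) \<in> borel_measurable (borel \<Otimes>\<^sub>M dunkl_borel \<mu>)"
    by measurable
  then have "(\<lambda>y. \<integral>z. g z * dunkl_W \<mu> x y z \<partial>dunkl_borel \<mu>) \<in> borel_measurable borel"
    by (rule borel_measurable_lebesgue_integral)
  then show ?thesis by (simp add: kernel_translation_def[abs_def])
qed

text \<open>
  Contraction passes to almost everywhere limits by Fatou's lemma: where the integral for \<open>g\<close> converges,
  dominated convergence gives pointwise limits, and elsewhere the translate of \<open>g\<close> is 0.
\<close>

lemma kernel_translation_fatou:
  fixes g :: "real \<Rightarrow> real" and G :: "nat \<Rightarrow> real \<Rightarrow> real"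
  assumes [measurable]: "g \<in> borel_measurable borel" "\<And>n. G n \<in> borel_measurable borel"
    and contr: "\<And>n. (\<integral>\<^sup>+y. ennreal ((kernel_translation \<mu> x (G n) y)\<^sup>2) \<partial>dunkl_borel \<mu>) \<le> (\<integral>\<^sup>+y. ennreal ((G n y)\<^sup>2) \<partial>dunkl_borel \<mu>)"
    and lim: "AE z in dunkl_borel \<mu>. (\<lambda>n. G n z) \<longlonglongrightarrow> g z"
    and dom: "\<And>y. y \<noteq> 0 \<Longrightarrow> integrable (dunkl_borel \<mu>) (\<lambda>z. g z * dunkl_W \<mu> x y z) \<Longrightarrow>
      \<exists>D. integrable (dunkl_borel \<mu>) D \<and> (\<forall>n z. \<bar>G n z * dunkl_W \<mu> x y z\<bar> \<le> D z)"
  shows "(\<integral>\<^sup>+y. ennreal ((kernel_translation \<mu> x g y)\<^sup>2) \<partial>dunkl_borel \<mu>)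
    \<le> liminf (\<lambda>n. \<integral>\<^sup>+y. ennreal ((G n y)\<^sup>2) \<partial>dunkl_borel \<mu>)"
proof -
  let ?K = "kernel_translation \<mu> x"
  note [measurable] = kernel_translation_measurable
  have pt: "ennreal ((?K g y)\<^sup>2) \<le> liminf (\<lambda>n. ennreal ((?K (G n) y)\<^sup>2))" if y: "y \<noteq> 0" for y
  proof (cases "integrable (dunkl_borel \<mu>) (\<lambda>z. g z * dunkl_W \<mu> x y z)")
    case True
    then obtain D where D: "integrable (dunkl_borel \<mu>) D" "\<And>n z. \<bar>G n z * dunkl_W \<mu> x y z\<bar> \<le> D z"
      using dom[OF y] by blast
    have "(\<lambda>n. ?K (G n) y) \<longlonglongrightarrow> ?K g y"
      unfolding kernel_translation_def
    proof (rule integral_dominated_convergence[OF _ _ D(1)])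
      show "AE z in dunkl_borel \<mu>. (\<lambda>n. G n z * dunkl_W \<mu> x y z) \<longlonglongrightarrow> g z * dunkl_W \<mu> x y z"
        using lim by (rule eventually_mono) (intro tendsto_mult tendsto_const)
    qed (use D(2) in auto)
    then have "(\<lambda>n. ennreal ((?K (G n) y)\<^sup>2)) \<longlonglongrightarrow> ennreal ((?K g y)\<^sup>2)"
      by (intro tendsto_ennrealI tendsto_power)
    from lim_imp_Liminf[OF trivial_limit_sequentially this] show ?thesis by simp
  next
    case False
    then show ?thesis by (simp add: kernel_translation_def not_integrable_integral_eq)
  qed
  have "(\<integral>\<^sup>+y. ennreal ((?K g y)\<^sup>2) \<partial>dunkl_borel \<mu>) \<le> (\<integral>\<^sup>+y. liminf (\<lambda>n. ennreal ((?K (G n) y)\<^sup>2)) \<partial>dunkl_borel \<mu>)"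
    by (rule nn_integral_mono_AE, rule eventually_mono[OF AE_dunkl_borel_nonzero pt])
  also have "\<dots> \<le> liminf (\<lambda>n. \<integral>\<^sup>+y. ennreal ((?K (G n) y)\<^sup>2) \<partial>dunkl_borel \<mu>)"
    by (rule nn_integral_liminf) simp
  also have "\<dots> \<le> liminf (\<lambda>n. \<integral>\<^sup>+y. ennreal ((G n y)\<^sup>2) \<partial>dunkl_borel \<mu>)"
    by (intro Liminf_mono always_eventually allI contr)
  finally show ?thesis .
qed

text \<open>
  A measurable function is an almost everywhere limit of continuous ones.  Clamping these to \<open>[- B, B]\<close> and
  multiplying by a cutoff function preserves the limit \<open>g\<close> and makes them compactly supported.
\<close>

lemma kernel_translation_contraction_bounded:
  assumes mu: "\<mu> > -1/2" and x: "x \<noteq> 0" and g [measurable]: "g \<in> borel_measurable borel"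
    and B: "\<And>z. \<bar>g z\<bar> \<le> B" and R: "\<And>z. \<bar>z\<bar> > R \<Longrightarrow> g z = 0"
  shows "(\<integral>\<^sup>+y. ennreal ((kernel_translation \<mu> x g y)\<^sup>2) \<partial>dunkl_borel \<mu>) \<le> (\<integral>\<^sup>+y. ennreal ((g y)\<^sup>2) \<partial>dunkl_borel \<mu>)"
proof -
  have B0: "B \<ge> 0" using B[of 0] by simp
  have "g \<in> borel_measurable lebesgue" by (rule measurable_completion) simp
  then have "g measurable_on UNIV" by (rule lebesgue_measurable_imp_measurable_on) simp
  then obtain N H where N: "negligible N" and H: "\<And>n. continuous_on UNIV (H n)" "\<And>z. z \<notin> N \<Longrightarrow> (\<lambda>n. H n z) \<longlonglongrightarrow> g z"
    unfolding measurable_on_def by auto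
  \<comment> \<open>The first factor is a cutoff: 1 on \<open>[- R, R]\<close> and 0 outside \<open>[- (R + 1), R + 1]\<close>.\<close>
  define G where "G = (\<lambda>n z. max 0 (min 1 (R + 1 - \<bar>z\<bar>)) * max (- B) (min B (H n z)))"
  have Gc: "continuous_on UNIV (G n)" for n
    unfolding G_def by (intro continuous_intros H(1))
  then have [measurable]: "G n \<in> borel_measurable borel" for n by (rule borel_measurable_continuous_onI)
  have GB: "\<bar>G n z\<bar> \<le> B" for n z
  proof -
    have "\<bar>max 0 (min 1 (R + 1 - \<bar>z\<bar>))\<bar> * \<bar>max (- B) (min B (H n z))\<bar> \<le> 1 * B"
      using B0 by (intro mult_mono) (auto simp: abs_le_iff max_def min_def)
    then show ?thesis by (simp add: G_def abs_mult)
  qed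
  have GR: "G n z = 0" if "\<bar>z\<bar> > R + 1" for n z
    using that by (simp add: G_def)
  have "AE z in lebesgue. z \<notin> N"
    using N by (simp add: negligible_iff_null_sets AE_not_in)
  then have "AE z in lborel. z \<notin> N" by (simp add: AE_completion_iff)
  then have "AE z in dunkl_borel \<mu>. z \<notin> N"
    unfolding dunkl_borel_def by (subst AE_density) auto
  then have lim: "AE z in dunkl_borel \<mu>. (\<lambda>n. G n z) \<longlonglongrightarrow> g z"
  proof (rule eventually_mono)
    fix z assume z: "z \<notin> N"
    have "(\<lambda>n. G n z) \<longlonglongrightarrow> max 0 (min 1 (R + 1 - \<bar>z\<bar>)) * max (- B) (min B (g z))"
      unfolding G_def by (intro tendsto_intros H(2)[OF z])
    moreover have "max (- B) (min B (g z)) = g z" using B[of z] by (auto simp: abs_le_iff)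
    moreover have "max 0 (min 1 (R + 1 - \<bar>z\<bar>)) * g z = g z" using R[of z] by (cases "\<bar>z\<bar> > R") auto
    ultimately show "(\<lambda>n. G n z) \<longlonglongrightarrow> g z" by simp
  qed
  have contr: "(\<integral>\<^sup>+y. ennreal ((kernel_translation \<mu> x (G n) y)\<^sup>2) \<partial>dunkl_borel \<mu>) \<le> (\<integral>\<^sup>+y. ennreal ((G n y)\<^sup>2) \<partial>dunkl_borel \<mu>)" for n
  proof -
    have "kernel_translation \<mu> x (G n) y = angular_translation \<mu> x (G n) y" if "y \<noteq> 0" for y
      unfolding kernel_translation_def by (rule integral_dunkl_W(2)[OF mu x that _ GB]) simp
    then have "(\<integral>\<^sup>+y. ennreal ((kernel_translation \<mu> x (G n) y)\<^sup>2) \<partial>dunkl_borel \<mu>) = (\<integral>\<^sup>+y. ennreal ((angular_translation \<mu> x (G n) y)\<^sup>2) \<partial>dunkl_borel \<mu>)"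
      by (intro nn_integral_cong_AE eventually_mono[OF AE_dunkl_borel_nonzero]) simp
    then show ?thesis using angular_translation_contraction[OF mu x Gc GR] by simp
  qed
  have "(\<integral>\<^sup>+y. ennreal ((kernel_translation \<mu> x g y)\<^sup>2) \<partial>dunkl_borel \<mu>) \<le> liminf (\<lambda>n. \<integral>\<^sup>+y. ennreal ((G n y)\<^sup>2) \<partial>dunkl_borel \<mu>)"
  proof (rule kernel_translation_fatou[OF g _ contr lim])
    fix y :: real assume y: "y \<noteq> 0"
    have "integrable (dunkl_borel \<mu>) (\<lambda>z. norm (B * dunkl_W \<mu> x y z))"
      by (rule integrable_norm, rule integral_dunkl_W(1)[OF mu x y, where B = B]) (use B0 in simp_all)
    moreover have "\<bar>G n z * dunkl_W \<mu> x y z\<bar> \<le> norm (B * dunkl_W \<mu> x y z)" for n z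
      using mult_right_mono[OF GB[of n z], of "\<bar>dunkl_W \<mu> x y z\<bar>"] B0 by (simp add: abs_mult)
    ultimately show "\<exists>D. integrable (dunkl_borel \<mu>) D \<and> (\<forall>n z. \<bar>G n z * dunkl_W \<mu> x y z\<bar> \<le> D z)" by blast
  qed simp
  also have "\<dots> = (\<integral>\<^sup>+y. ennreal ((g y)\<^sup>2) \<partial>dunkl_borel \<mu>)"
  proof (rule lim_imp_Liminf)
    have D: "integrable (dunkl_borel \<mu>) (\<lambda>z. indicator {-(R + 1)..R + 1} z * B\<^sup>2)"
      by (rule integrable_dunkl_borel_compact[OF mu, where B = "B\<^sup>2" and R = "R + 1"]) (auto simp: indicator_def)
    show "(\<lambda>n. \<integral>\<^sup>+y. ennreal ((G n y)\<^sup>2) \<partial>dunkl_borel \<mu>) \<longlonglongrightarrow> (\<integral>\<^sup>+y. ennreal ((g y)\<^sup>2) \<partial>dunkl_borel \<mu>)"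
    proof (rule nn_integral_dominated_convergence[where w = "\<lambda>z. ennreal (indicator {-(R + 1)..R + 1} z * B\<^sup>2)"])
      show "(\<integral>\<^sup>+z. ennreal (indicator {-(R + 1)..R + 1} z * B\<^sup>2) \<partial>dunkl_borel \<mu>) < \<infinity>"
        using nn_integral_eq_integral[OF D] by simp
      have "(G n z)\<^sup>2 \<le> indicator {-(R + 1)..R + 1} z * B\<^sup>2" for n z
      proof (cases "\<bar>z\<bar> > R + 1")
        case False
        then have "z \<in> {-(R + 1)..R + 1}" by (auto simp: abs_le_iff)
        then show ?thesis using power_mono[OF GB[of n z], of 2] by simp
      qed (simp add: GR)
      then show "AE z in dunkl_borel \<mu>. ennreal ((G n z)\<^sup>2) \<le> ennreal (indicator {-(R + 1)..R + 1} z * B\<^sup>2)" for n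
        by (intro AE_I2 ennreal_leI)
      show "AE z in dunkl_borel \<mu>. (\<lambda>n. ennreal ((G n z)\<^sup>2)) \<longlonglongrightarrow> ennreal ((g z)\<^sup>2)"
        using lim by (rule eventually_mono) (intro tendsto_ennrealI tendsto_power)
    qed simp_all
  qed simp
  finally show ?thesis .
qed

lemma kernel_translation_contraction:
  assumes mu: "\<mu> > -1/2" and x: "x \<noteq> 0" and g [measurable]: "g \<in> borel_measurable borel"
  shows "(\<integral>\<^sup>+y. ennreal ((kernel_translation \<mu> x g y)\<^sup>2) \<partial>dunkl_borel \<mu>) \<le> (\<integral>\<^sup>+y. ennreal ((g y)\<^sup>2) \<partial>dunkl_borel \<mu>)"
proof -
  define G where "G = (\<lambda>(n::nat) z. if \<bar>z\<bar> \<le> n \<and> \<bar>g z\<bar> \<le> n then g z else 0)"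
  have [measurable]: "G n \<in> borel_measurable borel" for n unfolding G_def by measurable
  have Gg: "\<bar>G n z\<bar> \<le> \<bar>g z\<bar>" for n z by (simp add: G_def)
  have "(\<lambda>n. G n z) \<longlonglongrightarrow> g z" for z
  proof (rule tendsto_eventually)
    obtain m :: nat where m: "max \<bar>z\<bar> \<bar>g z\<bar> \<le> m" using real_arch_simple by blast
    have "G n z = g z" if "n \<ge> m" for n
    proof -
      have "real m \<le> real n" using that by simp
      then show ?thesis using m by (simp add: G_def)
    qed
    then show "\<forall>\<^sub>F n in sequentially. G n z = g z"
      by (auto simp: eventually_sequentially)
  qed
  then have lim: "AE z in dunkl_borel \<mu>. (\<lambda>n. G n z) \<longlonglongrightarrow> g z" by simp
  have "(\<integral>\<^sup>+y. ennreal ((kernel_translation \<mu> x g y)\<^sup>2) \<partial>dunkl_borel \<mu>) \<le> liminf (\<lambda>n. \<integral>\<^sup>+y. ennreal ((G n y)\<^sup>2) \<partial>dunkl_borel \<mu>)"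
  proof (rule kernel_translation_fatou[OF g _ _ lim])
    fix n
    show "(\<integral>\<^sup>+y. ennreal ((kernel_translation \<mu> x (G n) y)\<^sup>2) \<partial>dunkl_borel \<mu>) \<le> (\<integral>\<^sup>+y. ennreal ((G n y)\<^sup>2) \<partial>dunkl_borel \<mu>)"
      by (rule kernel_translation_contraction_bounded[OF mu x, where B = n and R = n]) (auto simp: G_def)
  next
    fix y :: real assume y: "y \<noteq> 0" and i: "integrable (dunkl_borel \<mu>) (\<lambda>z. g z * dunkl_W \<mu> x y z)"
    have "\<bar>G n z * dunkl_W \<mu> x y z\<bar> \<le> norm (g z * dunkl_W \<mu> x y z)" for n z
      using mult_right_mono[OF Gg[of n z], of "\<bar>dunkl_W \<mu> x y z\<bar>"] by (simp add: abs_mult)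
    then show "\<exists>D. integrable (dunkl_borel \<mu>) D \<and> (\<forall>n z. \<bar>G n z * dunkl_W \<mu> x y z\<bar> \<le> D z)"
      using integrable_norm[OF i] by blast
  qed simp
  also have "\<dots> \<le> liminf (\<lambda>n. \<integral>\<^sup>+y. ennreal ((g y)\<^sup>2) \<partial>dunkl_borel \<mu>)"
    using Gg by (intro Liminf_mono always_eventually allI nn_integral_mono ennreal_leI) (simp add: abs_le_square_iff)
  also have "\<dots> = (\<integral>\<^sup>+y. ennreal ((g y)\<^sup>2) \<partial>dunkl_borel \<mu>)"
    by (rule lim_imp_Liminf) simp_all
  finally show ?thesis .
qed

section \<open>The wavelet transform\<close>

lemma dunkl_measure_eq_completion: "dunkl_measure \<mu> = completion (dunkl_borel \<mu>)"
proof -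
  have "AE y in lborel. y \<noteq> (0 :: real)" by (rule AE_lborel_singleton)
  then have "AE y in lborel. 0 < ennreal (\<bar>y\<bar> powr (2 * \<mu> + 1))"
    by (rule eventually_mono) simp
  then show ?thesis
    unfolding dunkl_measure_def dunkl_borel_def by (subst completion_density_eq) auto
qed

lemma dunkl_measure_ex_borel:
  fixes f :: "real \<Rightarrow> complex"
  assumes "f \<in> borel_measurable (dunkl_measure \<mu>)"
  obtains f' where "f' \<in> borel_measurable borel" "AE z in dunkl_borel \<mu>. f z = f' z"
proof -
  have m: "(\<lambda>z. Re (f z)) \<in> borel_measurable (completion (dunkl_borel \<mu>))" "(\<lambda>z. Im (f z)) \<in> borel_measurable (completion (dunkl_borel \<mu>))"
    using assms unfolding dunkl_measure_eq_completion by simp_all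
  obtain a where a: "a \<in> borel_measurable (dunkl_borel \<mu>)" "AE z in dunkl_borel \<mu>. Re (f z) = a z"
    using completion_ex_borel_measurable_real[OF m(1)] by blast
  obtain b where b: "b \<in> borel_measurable (dunkl_borel \<mu>)" "AE z in dunkl_borel \<mu>. Im (f z) = b z"
    using completion_ex_borel_measurable_real[OF m(2)] by blast
  note [measurable] = a(1) b(1)
  show thesis
  proof
    show "(\<lambda>z. Complex (a z) (b z)) \<in> borel_measurable borel"
      unfolding Complex_eq by measurable
    show "AE z in dunkl_borel \<mu>. f z = Complex (a z) (b z)"
      using a(2) b(2) by eventually_elim (simp add: complex_eq_iff)
  qed
qed

lemma dunkl_translation_borel:
  fixes f f' :: "real \<Rightarrow> complex"
  assumes f: "f \<in> borel_measurable (dunkl_measure \<mu>)" and f' [measurable]: "f' \<in> borel_measurable borel"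
    and ae: "AE z in dunkl_borel \<mu>. f z = f' z" and xy: "x \<noteq> 0" "y \<noteq> 0"
  shows "dunkl_translation \<mu> x f y = (\<integral>z. f' z * of_real (dunkl_W \<mu> x y z) \<partial>dunkl_borel \<mu>)"
proof -
  have W: "(\<lambda>z. complex_of_real (dunkl_W \<mu> x y z)) \<in> borel_measurable (dunkl_borel \<mu>)" by measurable
  have "dunkl_translation \<mu> x f y = (\<integral>z. f z * of_real (dunkl_W \<mu> x y z) \<partial>completion (dunkl_borel \<mu>))"
    using xy by (simp add: dunkl_translation_def dunkl_measure_eq_completion)
  also have "\<dots> = (\<integral>z. f' z * of_real (dunkl_W \<mu> x y z) \<partial>completion (dunkl_borel \<mu>))"
  proof (rule Bochner_Integration.integral_cong_AE)
    show "(\<lambda>z. f z * of_real (dunkl_W \<mu> x y z)) \<in> borel_measurable (completion (dunkl_borel \<mu>))"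
      using f measurable_completion[OF W] unfolding dunkl_measure_eq_completion by (rule borel_measurable_times)
    show "(\<lambda>z. f' z * of_real (dunkl_W \<mu> x y z)) \<in> borel_measurable (completion (dunkl_borel \<mu>))"
      by (intro measurable_completion) measurable
    show "AE z in completion (dunkl_borel \<mu>). f z * of_real (dunkl_W \<mu> x y z) = f' z * of_real (dunkl_W \<mu> x y z)"
      using AE_completion[OF ae] by (rule eventually_mono) simp
  qed
  also have "\<dots> = (\<integral>z. f' z * of_real (dunkl_W \<mu> x y z) \<partial>dunkl_borel \<mu>)"
    by (rule integral_completion) measurable
  finally show ?thesis .
qed

lemma dunkl_translation_measurable:
  fixes f :: "real \<Rightarrow> complex"
  assumes f: "f \<in> borel_measurable (dunkl_measure \<mu>)"
  shows "dunkl_translation \<mu> x f \<in> borel_measurable (dunkl_measure \<mu>)"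
proof (cases "x = 0")
  case True
  then show ?thesis using f by (simp add: dunkl_translation_def[abs_def])
next
  case False
  interpret sigma_finite_measure "dunkl_borel \<mu>" by (rule sigma_finite_dunkl_borel)
  obtain f' where f' [measurable]: "f' \<in> borel_measurable borel" "AE z in dunkl_borel \<mu>. f z = f' z"
    using dunkl_measure_ex_borel[OF f] by blast
  have "(\<lambda>(y, z). f' z * complex_of_real (dunkl_W \<mu> x y z)) \<in> borel_measurable (borel \<Otimes>\<^sub>M dunkl_borel \<mu>)"
    by measurable
  then have [measurable]: "(\<lambda>y. \<integral>z. f' z * complex_of_real (dunkl_W \<mu> x y z) \<partial>dunkl_borel \<mu>) \<in> borel_measurable borel"
    by (rule borel_measurable_lebesgue_integral)
  have "dunkl_translation \<mu> x f = (\<lambda>y. if y = 0 then f x else \<integral>z. f' z * complex_of_real (dunkl_W \<mu> x y z) \<partial>dunkl_borel \<mu>)"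
    using dunkl_translation_borel[OF f f' False] False by (auto simp: fun_eq_iff dunkl_translation_def)
  moreover have "\<dots> \<in> borel_measurable (dunkl_borel \<mu>)" by measurable
  ultimately show ?thesis unfolding dunkl_measure_eq_completion by (simp only: measurable_completion)
qed

text \<open>
  The kernel is real, so real and imaginary part are translated separately.  The squares are
  related by an inequality only, because one of the two real integrals may converge where the complex one does not.
\<close>

lemma dunkl_translation_contraction:
  fixes f :: "real \<Rightarrow> complex"
  assumes mu: "\<mu> > -1/2" and f: "f \<in> borel_measurable (dunkl_measure \<mu>)"
  shows "(\<integral>\<^sup>+y. ennreal ((norm (dunkl_translation \<mu> x f y))\<^sup>2) \<partial>dunkl_measure \<mu>) \<le> (\<integral>\<^sup>+y. ennreal ((norm (f y))\<^sup>2) \<partial>dunkl_measure \<mu>)"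
proof (cases "x = 0")
  case True
  then show ?thesis by (simp add: dunkl_translation_def)
next
  case False
  obtain f' where f' [measurable]: "f' \<in> borel_measurable borel" and ae: "AE z in dunkl_borel \<mu>. f z = f' z"
    using dunkl_measure_ex_borel[OF f] by blast
  let ?K = "kernel_translation \<mu> x"
  note [measurable] = kernel_translation_measurable
  have pt: "(norm (dunkl_translation \<mu> x f y))\<^sup>2 \<le> (?K (\<lambda>z. Re (f' z)) y)\<^sup>2 + (?K (\<lambda>z. Im (f' z)) y)\<^sup>2" if y: "y \<noteq> 0" for y
  proof (cases "integrable (dunkl_borel \<mu>) (\<lambda>z. f' z * complex_of_real (dunkl_W \<mu> x y z))")
    case True
    have "Re (dunkl_translation \<mu> x f y) = ?K (\<lambda>z. Re (f' z)) y" "Im (dunkl_translation \<mu> x f y) = ?K (\<lambda>z. Im (f' z)) y"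
      unfolding dunkl_translation_borel[OF f f' ae False y] kernel_translation_def
      using integral_Re[OF True] integral_Im[OF True] by simp_all
    then show ?thesis by (simp add: cmod_power2)
  next
    case nint: False
    then show ?thesis unfolding dunkl_translation_borel[OF f f' ae False y] by (simp add: not_integrable_integral_eq)
  qed
  have "(\<integral>\<^sup>+y. ennreal ((norm (dunkl_translation \<mu> x f y))\<^sup>2) \<partial>dunkl_measure \<mu>)
      = (\<integral>\<^sup>+y. ennreal ((norm (dunkl_translation \<mu> x f y))\<^sup>2) \<partial>dunkl_borel \<mu>)"
    by (simp add: dunkl_measure_eq_completion nn_integral_completion)
  also have "\<dots> \<le> (\<integral>\<^sup>+y. ennreal ((?K (\<lambda>z. Re (f' z)) y)\<^sup>2) + ennreal ((?K (\<lambda>z. Im (f' z)) y)\<^sup>2) \<partial>dunkl_borel \<mu>)"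
    by (rule nn_integral_mono_AE, rule eventually_mono[OF AE_dunkl_borel_nonzero])
      (simp add: pt ennreal_leI flip: ennreal_plus)
  also have "\<dots> = (\<integral>\<^sup>+y. ennreal ((?K (\<lambda>z. Re (f' z)) y)\<^sup>2) \<partial>dunkl_borel \<mu>) + (\<integral>\<^sup>+y. ennreal ((?K (\<lambda>z. Im (f' z)) y)\<^sup>2) \<partial>dunkl_borel \<mu>)"
    by (rule nn_integral_add) measurable
  also have "\<dots> \<le> (\<integral>\<^sup>+y. ennreal ((Re (f' y))\<^sup>2) \<partial>dunkl_borel \<mu>) + (\<integral>\<^sup>+y. ennreal ((Im (f' y))\<^sup>2) \<partial>dunkl_borel \<mu>)"
    by (intro add_mono kernel_translation_contraction[OF mu False]) measurable
  also have "\<dots> = (\<integral>\<^sup>+y. ennreal ((Re (f' y))\<^sup>2) + ennreal ((Im (f' y))\<^sup>2) \<partial>dunkl_borel \<mu>)"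
    by (rule nn_integral_add[symmetric]) measurable
  also have "\<dots> = (\<integral>\<^sup>+y. ennreal ((norm (f y))\<^sup>2) \<partial>dunkl_borel \<mu>)"
    by (rule nn_integral_cong_AE, rule eventually_mono[OF ae]) (simp add: cmod_power2)
  also have "\<dots> = (\<integral>\<^sup>+y. ennreal ((norm (f y))\<^sup>2) \<partial>dunkl_measure \<mu>)"
    by (simp add: dunkl_measure_eq_completion nn_integral_completion)
  finally show ?thesis .
qed

lemma dunkl_L2_norm_one:
  assumes "f \<in> dunkl_Lp \<mu> 2" "dunkl_norm \<mu> 2 f = 1"
  shows "f \<in> borel_measurable (dunkl_measure \<mu>)" "(\<integral>\<^sup>+y. ennreal ((norm (f y))\<^sup>2) \<partial>dunkl_measure \<mu>) = 1"
proof -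
  show "f \<in> borel_measurable (dunkl_measure \<mu>)" using assms(1) by (simp add: dunkl_Lp_def)
  have sq: "norm (f y) powr 2 = (norm (f y))\<^sup>2" for y by simp
  have i: "integrable (dunkl_measure \<mu>) (\<lambda>y. (norm (f y))\<^sup>2)"
    using assms(1) unfolding dunkl_Lp_def by (simp only: sq mem_Collect_eq)
  define I where "I = (LINT y|dunkl_measure \<mu>. (norm (f y))\<^sup>2)"
  have "I \<ge> 0" unfolding I_def by (rule integral_nonneg_AE) simp
  have "I powr (1 / 2) = 1" using assms(2) unfolding dunkl_norm_def I_def by (simp only: sq)
  then have "sqrt I = 1" using \<open>I \<ge> 0\<close> by (simp add: powr_half_sqrt)
  then have "I = 1" by simp
  then show "(\<integral>\<^sup>+y. ennreal ((norm (f y))\<^sup>2) \<partial>dunkl_measure \<mu>) = 1"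
    using nn_integral_eq_integral[OF i] by (simp add: I_def)
qed

lemma borel_measurable_dunkl_measure: "borel_measurable (dunkl_measure \<mu>) = borel_measurable lebesgue"
  unfolding dunkl_measure_def by (rule measurable_cong_sets) simp_all

lemma dunkl_dilation_measurable:
  assumes t: "t > 0" and f: "f \<in> borel_measurable (dunkl_measure \<mu>)"
  shows "dunkl_dilation \<mu> t f \<in> borel_measurable (dunkl_measure \<mu>)"
proof -
  have "(\<lambda>x. f (x / t)) \<in> borel_measurable lebesgue"
    using measurable_compose[OF lebesgue_measurable_scaling[of "1 / t"] f[unfolded borel_measurable_dunkl_measure]] by simp
  then have "(\<lambda>x. of_real (t powr (- (\<mu> + 1))) * f (x / t)) \<in> borel_measurable lebesgue" by simp
  then show ?thesis
    unfolding borel_measurable_dunkl_measure by (simp only: dunkl_dilation_def[abs_def])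
qed

text \<open>
  The weight \<open>\<bar>x\<bar> powr (2 * \<mu> + 1)\<close> is homogeneous, so the measure scales by \<open>t powr (2 * \<mu> + 2)\<close>, which the square
  of the normalisation \<open>t powr (- (\<mu> + 1))\<close> cancels.
\<close>

lemma dunkl_dilation_isometry:
  assumes t: "t > 0" and f: "f \<in> borel_measurable (dunkl_measure \<mu>)"
  shows "(\<integral>\<^sup>+x. ennreal ((norm (dunkl_dilation \<mu> t f x))\<^sup>2) \<partial>dunkl_measure \<mu>) = (\<integral>\<^sup>+x. ennreal ((norm (f x))\<^sup>2) \<partial>dunkl_measure \<mu>)"
proof -
  have fm [measurable]: "f \<in> borel_measurable lebesgue" using f by (simp add: borel_measurable_dunkl_measure)
  have dm [measurable]: "dunkl_dilation \<mu> t f \<in> borel_measurable lebesgue"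
    using dunkl_dilation_measurable[OF t f] by (simp add: borel_measurable_dunkl_measure)
  have w [measurable]: "(\<lambda>y. ennreal (\<bar>y\<bar> powr (2 * \<mu> + 1))) \<in> borel_measurable lebesgue"
    by (intro measurable_completion) measurable
  let ?G = "\<lambda>x. ennreal (\<bar>x\<bar> powr (2 * \<mu> + 1)) * ennreal ((norm (dunkl_dilation \<mu> t f x))\<^sup>2)"
  have G: "?G \<in> borel_measurable lebesgue" by measurable
  have "(\<integral>\<^sup>+x. ennreal ((norm (dunkl_dilation \<mu> t f x))\<^sup>2) \<partial>dunkl_measure \<mu>) = (\<integral>\<^sup>+x. ?G x \<partial>lebesgue)"
    unfolding dunkl_measure_def by (rule nn_integral_density[OF w]) measurable
  also have "\<dots> = ennreal \<bar>t\<bar> * (\<integral>\<^sup>+x. ?G (0 + t * x) \<partial>lebesgue)"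
    by (rule nn_integral_real_affine_lebesgue[OF G]) (use t in simp)
  also have "\<dots> = (\<integral>\<^sup>+x. ennreal \<bar>t\<bar> * ?G (0 + t * x) \<partial>lebesgue)"
  proof (rule nn_integral_cmult[symmetric])
    from measurable_compose[OF lebesgue_measurable_scaling[of t] G]
    show "(\<lambda>x. ?G (0 + t * x)) \<in> borel_measurable lebesgue" by simp
  qed
  also have "\<dots> = (\<integral>\<^sup>+x. ennreal (\<bar>x\<bar> powr (2 * \<mu> + 1)) * ennreal ((norm (f x))\<^sup>2) \<partial>lebesgue)"
  proof (rule nn_integral_cong)
    fix x
    have "t * (\<bar>t * x\<bar> powr (2 * \<mu> + 1) * (norm (dunkl_dilation \<mu> t f (t * x)))\<^sup>2)
      = (t * t powr (2 * \<mu> + 1) * (t powr (- (\<mu> + 1)))\<^sup>2) * (\<bar>x\<bar> powr (2 * \<mu> + 1) * (norm (f x))\<^sup>2)"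
      using t by (simp add: dunkl_dilation_def norm_mult abs_mult powr_mult power_mult_distrib ac_simps)
    also have "t * t powr (2 * \<mu> + 1) * (t powr (- (\<mu> + 1)))\<^sup>2 = 1"
    proof -
      have "t * t powr (2 * \<mu> + 1) * (t powr (- (\<mu> + 1)))\<^sup>2 = t powr 1 * t powr (2 * \<mu> + 1) * (t powr (- (\<mu> + 1)) * t powr (- (\<mu> + 1)))"
        using t by (simp add: power2_eq_square)
      also have "\<dots> = t powr (1 + (2 * \<mu> + 1) + (- (\<mu> + 1) + - (\<mu> + 1)))"
        by (simp only: powr_add)
      finally show ?thesis using t by simp
    qed
    finally have "t * (\<bar>t * x\<bar> powr (2 * \<mu> + 1) * (norm (dunkl_dilation \<mu> t f (t * x)))\<^sup>2) = \<bar>x\<bar> powr (2 * \<mu> + 1) * (norm (f x))\<^sup>2" by simp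
    then show "ennreal \<bar>t\<bar> * ?G (0 + t * x) = ennreal (\<bar>x\<bar> powr (2 * \<mu> + 1)) * ennreal ((norm (f x))\<^sup>2)"
      using t by (simp flip: ennreal_mult')
  qed
  also have "\<dots> = (\<integral>\<^sup>+x. ennreal ((norm (f x))\<^sup>2) \<partial>dunkl_measure \<mu>)"
    unfolding dunkl_measure_def by (rule nn_integral_density[OF w, symmetric]) measurable
  finally show ?thesis .
qed

text \<open>
  The chirp has modulus 1, and dilation and translation do not increase the norm of \<open>\<psi>\<close>.  As both norms
  are at most 1, the inequality \<open>2 * a * b \<le> a\<^sup>2 + b\<^sup>2\<close> takes the place of Cauchy--Schwarz.
\<close>

lemma norm_lc_dunkl_wavelet_transform_le_1:
  assumes mu: "\<mu> > -1/2" and \<psi>: "\<psi> \<in> dunkl_Lp \<mu> 2" "dunkl_norm \<mu> 2 \<psi> = 1"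
    and f: "f \<in> dunkl_Lp \<mu> 2" "dunkl_norm \<mu> 2 f = 1" and t: "t > 0"
  shows "norm (lc_dunkl_wavelet_transform \<mu> M \<psi> f t x) \<le> 1"
proof -
  let ?m = "dunkl_measure \<mu>"
  let ?\<tau> = "dunkl_translation \<mu> x (dunkl_dilation \<mu> t \<psi>)"
  let ?h = "\<lambda>z. f z * cnj (lc_dunkl_wavelet \<mu> M \<psi> t x z)"
  note f' = dunkl_L2_norm_one[OF f] and \<psi>' = dunkl_L2_norm_one[OF \<psi>]
  note dm = dunkl_dilation_measurable[OF t \<psi>'(1)]
  have [measurable]: "?\<tau> \<in> borel_measurable ?m" "f \<in> borel_measurable ?m"
    using dunkl_translation_measurable[OF dm] f'(1) by auto
  have \<tau>: "(\<integral>\<^sup>+z. ennreal ((norm (?\<tau> z))\<^sup>2) \<partial>?m) \<le> 1"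
    using dunkl_translation_contraction[OF mu dm, of x] unfolding dunkl_dilation_isometry[OF t \<psi>'(1)] \<psi>'(2) .
  have phase: "norm (lc_dunkl_wavelet \<mu> M \<psi> t x z) = norm (?\<tau> z)" for z
  proof -
    have "norm (exp (- (\<i> * complex_of_real r))) = 1" for r
      using norm_exp_i_times[of "- r"] by simp
    then show ?thesis by (simp add: lc_dunkl_wavelet_def norm_mult)
  qed
  have "ennreal (norm (integral\<^sup>L ?m ?h)) \<le> (\<integral>\<^sup>+z. ennreal (norm (?h z)) \<partial>?m)"
  proof (cases "integrable ?m ?h")
    case True
    then show ?thesis by (rule integral_norm_bound_ennreal)
  qed (simp add: not_integrable_integral_eq)
  also have "\<dots> \<le> (\<integral>\<^sup>+z. ennreal (1/2) * ennreal ((norm (f z))\<^sup>2) + ennreal (1/2) * ennreal ((norm (?\<tau> z))\<^sup>2) \<partial>?m)"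
  proof (rule nn_integral_mono)
    fix z
    have "norm (?h z) = norm (f z) * norm (?\<tau> z)" by (simp add: norm_mult phase)
    also have "\<dots> \<le> 1/2 * (norm (f z))\<^sup>2 + 1/2 * (norm (?\<tau> z))\<^sup>2"
      using sum_squares_bound[of "norm (f z)" "norm (?\<tau> z)"] by simp
    finally have "ennreal (norm (?h z)) \<le> ennreal (1/2 * (norm (f z))\<^sup>2 + 1/2 * (norm (?\<tau> z))\<^sup>2)" by (rule ennreal_leI)
    also have "\<dots> = ennreal (1/2) * ennreal ((norm (f z))\<^sup>2) + ennreal (1/2) * ennreal ((norm (?\<tau> z))\<^sup>2)"
      by (subst ennreal_plus) (simp_all only: ennreal_mult', simp_all)
    finally show "ennreal (norm (?h z)) \<le> \<dots>" .
  qed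
  also have "\<dots> = ennreal (1/2) * (\<integral>\<^sup>+z. ennreal ((norm (f z))\<^sup>2) \<partial>?m) + ennreal (1/2) * (\<integral>\<^sup>+z. ennreal ((norm (?\<tau> z))\<^sup>2) \<partial>?m)"
    by (subst nn_integral_add) (simp_all add: nn_integral_cmult)
  also have "\<dots> \<le> ennreal (1/2) * 1 + ennreal (1/2) * 1"
    unfolding f'(2) by (intro add_mono mult_left_mono \<tau>) auto
  also have "\<dots> = ennreal 1"
    unfolding mult_1_right by (subst ennreal_plus[symmetric]) simp_all
  finally show ?thesis
    by (simp add: lc_dunkl_wavelet_transform_def ennreal_le_1)
qed

theorem theorem5p3:
  fixes \<mu> :: real and M :: "real^2^2"
    and \<psi> f :: "real \<Rightarrow> complex" and \<Omega> :: "(real \<times> real) set"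
  assumes "\<mu> > - 1/2"
    and "det M = 1" and "M$1$2 \<noteq> 0"
    and "\<psi> \<in> dunkl_Lp \<mu> 2" and "f \<in> dunkl_Lp \<mu> 2"
    and "dunkl_norm \<mu> 2 \<psi> = 1" and "dunkl_norm \<mu> 2 f = 1"
    and "\<Omega> \<in> sets (half_plane_measure \<mu>)"
    and "emeasure (half_plane_measure \<mu>) \<Omega> < \<infinity>"
    and "\<forall>\<epsilon>::real. \<epsilon> > 0 \<longrightarrow>
      (\<integral>\<^sup>+(t, x)\<in>\<Omega>. ennreal ((norm (lc_dunkl_wavelet_transform \<mu> M \<psi> f t x))\<^sup>2)
        \<partial>half_plane_measure \<mu>) \<ge> ennreal (1 - \<epsilon>)"
  shows "\<forall>\<epsilon>::real. \<epsilon> > 0 \<longrightarrow> emeasure (half_plane_measure \<mu>) \<Omega> \<ge> ennreal (1 - \<epsilon>)"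
proof (intro allI impI)
  fix \<epsilon> :: real assume "\<epsilon> > 0"
  let ?\<Phi> = "lc_dunkl_wavelet_transform \<mu> M \<psi> f"
  have "ennreal (1 - \<epsilon>) \<le> (\<integral>\<^sup>+(t, x)\<in>\<Omega>. ennreal ((norm (?\<Phi> t x))\<^sup>2) \<partial>half_plane_measure \<mu>)"
    using assms(10) \<open>\<epsilon> > 0\<close> by blast
  also have "\<dots> \<le> (\<integral>\<^sup>+p. indicator \<Omega> p \<partial>half_plane_measure \<mu>)"
  proof (rule nn_integral_mono)
    fix p assume "p \<in> space (half_plane_measure \<mu>)"
    then obtain t x where p: "p = (t, x)" "t > 0"
      by (auto simp: half_plane_measure_def)
    have "norm (?\<Phi> t x) \<le> 1"
      by (rule norm_lc_dunkl_wavelet_transform_le_1[OF assms(1,4,6,5,7) p(2)])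
    then have "(norm (?\<Phi> t x))\<^sup>2 \<le> 1" by (simp add: power_le_one)
    then show "(case p of (t, x) \<Rightarrow> ennreal ((norm (?\<Phi> t x))\<^sup>2)) * indicator \<Omega> p \<le> indicator \<Omega> p"
      by (simp add: p(1) indicator_def)
  qed
  also have "\<dots> = emeasure (half_plane_measure \<mu>) \<Omega>"
    by (rule nn_integral_indicator[OF assms(8)])
  finally show "ennreal (1 - \<epsilon>) \<le> emeasure (half_plane_measure \<mu>) \<Omega>" .
qed

end
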